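(* Let $n\ge3$ and let $\widetilde W$ be the affine Weyl group of the twisted affine root system $\widetilde B_n$. (i) Any minimal affine NGT $\tilde w\in\widetilde W$ is either a $B$-positive element (given by the $B$-positive construction in terms of the data (a),(b),(c),(d) described in the context) or can be obtained from a $B$-positive minimal NGT by applying the automorphism $\imath_B$. All such $\tilde w$ are involutive ($\tilde w^2=1$). (ii) Every $B$-positive $\tilde w$ is covered by the following construction with $k=\bar k=n-v$ (the greatest line number in the bunch of lines for the last number $t_r$). Let $\Gamma'$ be obtained from the Dynkin diagram $\Gamma$ of $B_n$ by removing the vertices $\alpha_1,\dots,\alpha_u$ (geometrically, removing the top horizontal bunch, if present), let $w_0'$ be the longest element of the Weyl group $W'$ of $\Gamma'$, and let $\tilde w=bw$ with $b\in P$, $w\in W$. Then $b$ lies in the span of $\Gamma'$, $(b,\alpha_j)\ge0$ for all $1\le j\le n$, $j\ne k$, $(b,\alpha_k)\le 0$, $(b,\vartheta)\le0$, the analogous inequalities hold for $\varsigma'(b)=-w_0'(b)$, and $$\tilde w=b\,(w_0'\,\dot w_0^{b})^{-1},$$ where $\dot w_0^{b}$ is the longest element of the subgroup generated by the $s_j$ with $\alpha_j\in\Gamma'$, $j\ne k$, $(b,\alpha_j)=0$; such $\tilde w$ represents a minimal NGT.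
   Context: **Type $\widetilde B_n$ (twisted).** $R=B_n$, $\alpha_i=\epsilon_i-\epsilon_{i+1}$ ($1\le i<n$), $\alpha_n=\epsilon_n$, form $(\epsilon_i,\epsilon_j)=2\delta_{ij}$ (short roots have square length 2), $\nu_\alpha=(\alpha,\alpha)/2$, $Q=\oplus\mathbb Z\epsilon_i$, $P$ the weight lattice, $\vartheta=\epsilon_1$ the maximal short root. $\widetilde R=\{[\alpha,\nu_\alpha j]:\alpha\in R,j\in\mathbb Z\}$, $\widetilde R_+=R_+\cup\{[\alpha,\nu_\alpha j]:j>0\}$, $\alpha_0=[-\epsilon_1,1]$. $\widetilde W=W\ltimes Q$ is generated by $s_i=s_{\alpha_i}$, $0\le i\le n$, where $s_{[\alpha,\nu_\alpha j]}([z,\zeta])=[z,\zeta]-(z,\alpha^\vee)[\alpha,\nu_\alpha j]$, and $(wb)([z,\zeta])=[w(z),\zeta-(z,b)]$. $\imath_B$ is the automorphism of $\widetilde W$ induced by the involution of the affine Dynkin diagram: $s_i\mapsto s_{n-i}$, $0\le i\le n$ (it transposes $\alpha_0$ and $\alpha_n$; geometrically, it transposes the top and bottom mirrors). **$\lambda$-sequences and minimal NGT.** $\lambda(\tilde w)=\widetilde R_+\cap\tilde w^{-1}(-\widetilde R_+)$. For a reduced decomposition $\tilde w=s_{i_l}\cdots s_{i_1}$ it is ordered as $\alpha_{i_1},\,s_{i_1}(\alpha_{i_2}),\,\dots,\,s_{i_1}\cdots s_{i_{l-1}}(\alpha_{i_l})$. A triple is $\{\tilde\beta,\tilde\gamma,\tilde\alpha\}\subset\lambda(\tilde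 w)$ with $\tilde\alpha+\tilde\beta=\tilde\gamma$ and with all three nonaffine parts of the same length (here: long+long=long). $\tilde w$ is a minimal NGT if its $\lambda$-sequence begins with $\tilde\alpha$ and ends with $\tilde\beta$ for such a triple, for every choice of the reduced decomposition (the endpoints are non-movable under Coxeter transformations). **Planar configurations.** There are two mirrors in the plane: the bottom one parallel to the $x$-axis and the top one at angle $\delta/2$ to it. A configuration consists of $n$ zigzag lines between two vertical lines, reflecting in the mirrors, read from right to left, numbered from top to bottom at the right end, line $i$ having initial angle $\epsilon_i$ with the $x$-axis; there are no triple intersections or double reflections. A top reflection is the event $s_0$, a bottom reflection the event $s_n$, the intersection of lines with current local numbers $i,i+1$ the event $s_i$; the events read from right to left, $s_{i_1}$ first, give a reduced decomposition $\tilde w=s_{i_l}\cdots s_{i_1}$. The absolute angles at the left end, read from top to bottom, give $\delta(b_1,\dots,b_n)+w(1,\dots,n)$ and then $\tilde w=bw$ with $b=\sum b_i\epsilon_i$. A bunch is a maximal set of neighboring (combinatorially) parallel lines; horizontal lines are those with no reflections; the $t$-number of a line is its number of top reflections. **$B$-positive construction.** Data: (a) integers $u\ge0$, $v\ge1$ with $m=n-u-v\ge2$ (numbers of top and bottom horizontal lines neighboring the corresponding mirror); (b) a decomposition $m=p_1+\dots+p_r$ into positive integers with $p_r\ge2$ (the numbers of lines in the consecutive non-horizontal bunches, from top to bottom at the right end); (c) integers $0\le t_1<t_2<\dots<t_r$ (the $t$-numbers of these bunches); (d) each line of the $j$-th bunch has $t_j$ top and $t_j+1$ bottom reflections. These data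 determine the configuration, hence the element $\tilde w$, called $B$-positive. Explicitly: let $I_1,\dots,I_r$ be the consecutive intervals of lengths $p_1,\dots,p_r$ partitioning $\{u+1,\dots,u+m\}$; then $\tilde w=bw$ with $b=-\sum_j t_j\sum_{i\in I_j}\epsilon_i$, $w(\epsilon_i)=\epsilon_i$ for $i\notin\bigcup I_j$, and $w(\epsilon_i)=-\epsilon_{\iota_j(i)}$ for $i\in I_j$, where $\iota_j$ is the order-reversing bijection of $I_j$. *)

theory Defs
  imports Complex_Main "HOL-Algebra.Bij" "HOL-Algebra.Generated_Groups"
    "HOL-Library.Function_Algebras" "HOL-Library.Product_Plus"
begin

text \<open>
  The space \<open>\<real>\<^sup>n\<close> is modelled by functions \<open>nat \<Rightarrow> real\<close> of which only the coordinates \<open>1..n\<close>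
  are used, so that the rank \<open>n\<close> is an ordinary natural number; a pair \<open>(z, \<zeta>)\<close> is the vector
  \<open>[z, \<zeta>]\<close>. All group elements leave the coordinates outside \<open>1..n\<close> unchanged.
\<close>

type_synonym rvec = "nat \<Rightarrow> real"
type_synonym affvec = "rvec \<times> real"

definition eps :: "nat \<Rightarrow> rvec" where
  "eps i = (\<lambda>j. if j = i then 1 else 0)"

definition smul :: "real \<Rightarrow> rvec \<Rightarrow> rvec" where
  "smul c x = (\<lambda>i. c * x i)"

definition form :: "nat \<Rightarrow> rvec \<Rightarrow> rvec \<Rightarrow> real" where
  "form n x y = 2 * (\<Sum>i=1..n. x i * y i)"

text \<open>\<open>(z, \<alpha>\<^sup>\<or>)\<close> for the coroot \<open>\<alpha>\<^sup>\<or> = 2\<alpha> / (\<alpha>, \<alpha>)\<close>.\<close>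

definition copair :: "nat \<Rightarrow> rvec \<Rightarrow> rvec \<Rightarrow> real" where
  "copair n z \<alpha> = 2 * form n z \<alpha> / form n \<alpha> \<alpha>"

definition pos_roots :: "nat \<Rightarrow> rvec set" where
  "pos_roots n = {eps i | i. 1 \<le> i \<and> i \<le> n}
     \<union> {eps i - eps j | i j. 1 \<le> i \<and> i < j \<and> j \<le> n}
     \<union> {eps i + eps j | i j. 1 \<le> i \<and> i < j \<and> j \<le> n}"

definition roots :: "nat \<Rightarrow> rvec set" where
  "roots n = pos_roots n \<union> uminus ` pos_roots n"

definition nu :: "nat \<Rightarrow> rvec \<Rightarrow> real" where
  "nu n \<alpha> = form n \<alpha> \<alpha> / 2"

definition aff_pos_roots :: "nat \<Rightarrow> affvec set" where
  "aff_pos_roots n = {(\<alpha>, 0) | \<alpha>. \<alpha> \<in> pos_roots n}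
     \<union> {(\<alpha>, nu n \<alpha> * of_int j) | \<alpha> (j::int). \<alpha> \<in> roots n \<and> j > 0}"

definition weight_lattice :: "nat \<Rightarrow> rvec set" where
  "weight_lattice n =
     {b. (\<forall>i. i \<notin> {1..n} \<longrightarrow> b i = 0) \<and> (\<forall>\<alpha>\<in>roots n. copair n b \<alpha> \<in> \<int>)}"

definition simple_root :: "nat \<Rightarrow> nat \<Rightarrow> affvec" where
  "simple_root n i =
     (if i = 0 then (- eps 1, 1)
      else if i < n then (eps i - eps (i + 1), 0)
      else (eps n, 0))"

fun aff_reflection :: "nat \<Rightarrow> affvec \<Rightarrow> affvec \<Rightarrow> affvec" where
  "aff_reflection n (\<alpha>, c) (z, \<zeta>) =
     (z - smul (copair n z \<alpha>) \<alpha>, \<zeta> - copair n z \<alpha> * c)"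

definition simple_refl :: "nat \<Rightarrow> nat \<Rightarrow> affvec \<Rightarrow> affvec" where
  "simple_refl n i = aff_reflection n (simple_root n i)"

fun translation :: "nat \<Rightarrow> rvec \<Rightarrow> affvec \<Rightarrow> affvec" where
  "translation n b (z, \<zeta>) = (z, \<zeta> - form n z b)"

text \<open>
  The subgroup generated by the simple reflections with index in \<open>J\<close>: the nonaffine group
  \<open>W\<close> for \<open>J = {1..n}\<close> (acting on the first component only), the affine group for \<open>J = {0..n}\<close>.
\<close>

definition parabolic :: "nat \<Rightarrow> nat set \<Rightarrow> (affvec \<Rightarrow> affvec) set" where
  "parabolic n J = generate (BijGroup UNIV) (simple_refl n ` J)"

definition affine_weyl :: "nat \<Rightarrow> (affvec \<Rightarrow> affvec) monoid" where
  "affine_weyl n = (BijGroup UNIV)\<lparr>carrier := parabolic n {0..n}\<rparr>"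

text \<open>
  A word \<open>[i\<^sub>1, \<dots>, i\<^sub>l]\<close> lists the events in chronological order, \<open>i\<^sub>1\<close> first, and denotes the
  composite in which the reflection of index \<open>i\<^sub>1\<close> is applied first.
\<close>

primrec word :: "nat \<Rightarrow> nat list \<Rightarrow> affvec \<Rightarrow> affvec" where
  "word n [] = id"
| "word n (i # is) = word n is \<circ> simple_refl n i"

definition cox_length :: "nat \<Rightarrow> nat set \<Rightarrow> (affvec \<Rightarrow> affvec) \<Rightarrow> nat" where
  "cox_length n J w = (LEAST l. \<exists>is. set is \<subseteq> J \<and> word n is = w \<and> length is = l)"

definition reduced_word :: "nat \<Rightarrow> (affvec \<Rightarrow> affvec) \<Rightarrow> nat list \<Rightarrow> bool" where
  "reduced_word n w is \<longleftrightarrow>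
     set is \<subseteq> {0..n} \<and> word n is = w \<and> length is = cox_length n {0..n} w"

definition longest :: "nat \<Rightarrow> nat set \<Rightarrow> affvec \<Rightarrow> affvec" where
  "longest n J = (THE w. w \<in> parabolic n J \<and>
     (\<forall>v \<in> parabolic n J. cox_length n J v \<le> cox_length n J w))"

text \<open>Elements of \<open>auto G\<close> are extensional on the carrier, so the automorphism is unique.\<close>

definition iota_B :: "nat \<Rightarrow> (affvec \<Rightarrow> affvec) \<Rightarrow> (affvec \<Rightarrow> affvec)" where
  "iota_B n = (THE \<phi>. \<phi> \<in> auto (affine_weyl n) \<and>
     (\<forall>i\<le>n. \<phi> (simple_refl n i) = simple_refl n (n - i)))"

definition lambda_set :: "nat \<Rightarrow> (affvec \<Rightarrow> affvec) \<Rightarrow> affvec set" where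
  "lambda_set n w = aff_pos_roots n \<inter> w -` (uminus ` aff_pos_roots n)"

primrec lambda_seq :: "nat \<Rightarrow> nat list \<Rightarrow> affvec list" where
  "lambda_seq n [] = []"
| "lambda_seq n (i # is) = simple_root n i # map (simple_refl n i) (lambda_seq n is)"

definition is_triple ::
    "nat \<Rightarrow> (affvec \<Rightarrow> affvec) \<Rightarrow> affvec \<Rightarrow> affvec \<Rightarrow> affvec \<Rightarrow> bool" where
  "is_triple n w \<beta> \<gamma> \<alpha> \<longleftrightarrow>
     {\<beta>, \<gamma>, \<alpha>} \<subseteq> lambda_set n w \<and> \<alpha> + \<beta> = \<gamma> \<and>
     form n (fst \<alpha>) (fst \<alpha>) = form n (fst \<gamma>) (fst \<gamma>) \<and>
     form n (fst \<beta>) (fst \<beta>) = form n (fst \<gamma>) (fst \<gamma>)"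

text \<open>The triple is the same for all reduced decompositions: its ends are non-movable.\<close>

definition minimal_NGT :: "nat \<Rightarrow> (affvec \<Rightarrow> affvec) \<Rightarrow> bool" where
  "minimal_NGT n w \<longleftrightarrow> w \<in> carrier (affine_weyl n) \<and>
     (\<exists>\<alpha> \<beta> \<gamma>. is_triple n w \<beta> \<gamma> \<alpha> \<and>
        (\<forall>is. reduced_word n w is \<longrightarrow>
           hd (lambda_seq n is) = \<alpha> \<and> last (lambda_seq n is) = \<beta>))"

text \<open>
  The data of the \<open>B\<close>-positive construction: \<open>u\<close> and \<open>v\<close> count the top and bottom horizontal
  lines, and the successive bunches in between have the sizes and \<open>t\<close>-numbers given by
  \<open>ps = [p\<^sub>1, \<dots>, p\<^sub>r]\<close> and \<open>ts = [t\<^sub>1, \<dots>, t\<^sub>r]\<close>. In the definitions below the bunches are numbered from 0, so \<open>block u ps j\<close> is the interval \<open>I\<close> of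
  index \<open>j + 1\<close> and \<open>block_rev u ps j\<close> is its order-reversing bijection.
\<close>

definition B_positive_data :: "nat \<Rightarrow> nat \<Rightarrow> nat \<Rightarrow> nat list \<Rightarrow> nat list \<Rightarrow> bool" where
  "B_positive_data n u v ps ts \<longleftrightarrow>
     v \<ge> 1 \<and> u + v + 2 \<le> n \<and> sum_list ps = n - u - v \<and>
     (\<forall>p \<in> set ps. p \<ge> 1) \<and> last ps \<ge> 2 \<and>
     length ts = length ps \<and> sorted_wrt (<) ts"

definition block :: "nat \<Rightarrow> nat list \<Rightarrow> nat \<Rightarrow> nat set" where
  "block u ps j = {u + sum_list (take j ps) + 1 .. u + sum_list (take (Suc j) ps)}"

definition block_rev :: "nat \<Rightarrow> nat list \<Rightarrow> nat \<Rightarrow> nat \<Rightarrow> nat" where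
  "block_rev u ps j i =
     (u + sum_list (take j ps) + 1) + (u + sum_list (take (Suc j) ps)) - i"

definition B_positive_b :: "nat \<Rightarrow> nat list \<Rightarrow> nat list \<Rightarrow> rvec" where
  "B_positive_b u ps ts =
     - (\<Sum>j<length ps. smul (real (ts ! j)) (\<Sum>i\<in>block u ps j. eps i))"

text \<open>
  The linear map that sends \<open>\<epsilon>\<^sub>i\<close> to minus \<open>\<epsilon>\<close> with the reversed index for \<open>i\<close> in some block, and
  fixes the remaining \<open>\<epsilon>\<^sub>i\<close>; see \<open>B_positive_lin_block\<close> and \<open>B_positive_lin_fixed\<close>.
\<close>

definition B_positive_lin :: "nat \<Rightarrow> nat list \<Rightarrow> rvec \<Rightarrow> rvec" where
  "B_positive_lin u ps z =
     z - (\<Sum>j<length ps. \<Sum>i\<in>block u ps j. smul (z i) (eps i + eps (block_rev u ps j i)))"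

definition B_positive_elt ::
    "nat \<Rightarrow> nat \<Rightarrow> nat list \<Rightarrow> nat list \<Rightarrow> affvec \<Rightarrow> affvec" where
  "B_positive_elt n u ps ts =
     translation n (B_positive_b u ps ts) \<circ> (\<lambda>(z, \<zeta>). (B_positive_lin u ps z, \<zeta>))"

definition B_positive :: "nat \<Rightarrow> (affvec \<Rightarrow> affvec) \<Rightarrow> bool" where
  "B_positive n w \<longleftrightarrow>
     (\<exists>u v ps ts. B_positive_data n u v ps ts \<and> w = B_positive_elt n u ps ts)"

text \<open>The real span of the \<open>\<alpha>\<^sub>j\<close>, \<open>j \<in> J\<close>, for \<open>J \<subseteq> {1..n}\<close>.\<close>

definition root_span :: "nat \<Rightarrow> nat set \<Rightarrow> rvec set" where
  "root_span n J = {\<Sum>j\<in>J. smul (c j) (fst (simple_root n j)) | c. True}"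

text \<open>\<open>eps 1\<close> is the maximal short root.\<close>

definition sign_conditions :: "nat \<Rightarrow> nat \<Rightarrow> rvec \<Rightarrow> bool" where
  "sign_conditions n k b \<longleftrightarrow>
     (\<forall>j\<in>{1..n}. j \<noteq> k \<longrightarrow> form n b (fst (simple_root n j)) \<ge> 0) \<and>
     form n b (fst (simple_root n k)) \<le> 0 \<and>
     form n b (eps 1) \<le> 0"

text \<open>\<open>-w\<^sub>0(b)\<close> for the longest element \<open>w\<^sub>0\<close> of the subgroup given by \<open>J \<subseteq> {1..n}\<close>.\<close>

definition varsigma :: "nat \<Rightarrow> nat set \<Rightarrow> rvec \<Rightarrow> rvec" where
  "varsigma n J b = - fst (longest n J (b, 0))"

lemma smul_eps_sum_single:
  assumes "finite A" "i \<in> A"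
  shows "(\<Sum>l\<in>A. smul (eps i l) (f l)) = f i"
proof -
  have "(\<Sum>l\<in>A. smul (eps i l) (f l)) = (\<Sum>l\<in>A. if l = i then f l else 0)"
    by (rule sum.cong) (auto simp: smul_def eps_def fun_eq_iff zero_fun_def)
  then show ?thesis using assms by simp
qed

lemma smul_eps_sum_none:
  assumes "i \<notin> A"
  shows "(\<Sum>l\<in>A. smul (eps i l) (f l)) = 0"
  by (rule sum.neutral) (use assms in \<open>auto simp: smul_def eps_def zero_fun_def\<close>)

lemma block_disjoint:
  assumes "i \<in> block u ps j" "i \<in> block u ps j'"
  shows "j = j'"
proof -
  have mono: "sum_list (take a ps) \<le> sum_list (take b ps)" if "a \<le> b" for a b
  proof -
    have "take b ps = take a ps @ take (b - a) (drop a ps)"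
      using that by (metis le_add_diff_inverse take_add)
    then show ?thesis by simp
  qed
  show ?thesis
    using assms mono[of "Suc j" j'] mono[of "Suc j'" j]
    by (cases j j' rule: linorder_cases) (auto simp: block_def)
qed

lemma B_positive_lin_block:
  assumes "j < length ps" "i \<in> block u ps j"
  shows "B_positive_lin u ps (eps i) = - eps (block_rev u ps j i)"
proof -
  have "(\<Sum>l\<in>block u ps j'. smul (eps i l) (eps l + eps (block_rev u ps j' l)))
      = (if j' = j then eps i + eps (block_rev u ps j i) else 0)" for j'
  proof (cases "j' = j")
    case True
    then show ?thesis
      using assms(2) smul_eps_sum_single[of "block u ps j" i]
      by (simp only: block_def finite_atLeastAtMost if_True simp_thms)
  next
    case False
    then have "i \<notin> block u ps j'" using assms(2) block_disjoint by blast
    then show ?thesis using False by (subst smul_eps_sum_none) auto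
  qed
  then show ?thesis using assms(1) by (simp add: B_positive_lin_def)
qed

lemma B_positive_lin_fixed:
  assumes "\<And>j. j < length ps \<Longrightarrow> i \<notin> block u ps j"
  shows "B_positive_lin u ps (eps i) = eps i"
  using assms by (simp add: B_positive_lin_def smul_eps_sum_none)

end

theory Submission
  imports Defs
begin

text \<open>
  The argument translates the planar configurations into permutations of the integers. Put
  \<open>N = n + 1\<close>, let the bottom mirror be at \<open>0\<close> and the top mirror at \<open>N\<close>, place line \<open>i\<close> at \<open>N - i\<close>, and
  unfold the mirrors. This attaches a vector \<open>vec x\<close> to each integer \<open>x\<close> in such a way that the affine
  roots are the differences \<open>vec x - vec y\<close> of suitable pairs, positive if and only if \<open>x > y\<close>, and the
  simple roots are the differences of neighbours. An element of the affine Weyl group permutes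
  these vectors and so becomes a permutation \<open>f\<close> of the integers with \<open>f (- x) = - f x\<close> and
  \<open>f (x + 2 N) = f x + 2 N\<close>. Its inversions are the pairs whose order \<open>f\<close> reverses, and its possible
  first letters in reduced words are the descents of \<open>f\<close> in \<open>{0..n}\<close>; the possible last letters are
  the descents of the inverse. Since an element without descents is the identity, lengths, parabolic
  subgroups and their longest elements can be computed by counting inversions (\<open>cox_length_eq\<close>,
  \<open>parabolic_iff_face\<close>, \<open>longest_eqI\<close>).

  A minimal NGT therefore has exactly one descent, at \<open>d\<close> say, and its inverse has exactly one, at \<open>e\<close>
  (\<open>minimal_NGT_iff\<close>). The condition that the two end roots add up to a root of the same length is a
  statement about inner products, and because \<open>f\<close> and its inverse are increasing away from their
  descents it leaves two possibilities (\<open>minimal_NGT_cases\<close>): \<open>f d = e\<close> or \<open>f (d + 1) = e + 1\<close>. The exchange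
  of the two mirrors, which induces the diagram automorphism, interchanges them. In the first case
  (\<open>low_ends_B_positive\<close>) everything up to \<open>d\<close> is squeezed between the bottom mirror and the
  matched pair and does not move, which gives \<open>d = e\<close> and the bottom horizontal lines. A point \<open>x > d\<close> is
  either fixed, and then so are all points between \<open>x\<close> and the top mirror, or it satisfies
  \<open>f x = - \<pi> x - 2 N t x\<close> with \<open>t x \<ge> 0\<close>. Monotonicity of \<open>f\<close> and of its inverse shows that \<open>t\<close> is
  decreasing and invariant under \<open>\<pi>\<close>, and that \<open>\<pi>\<close> reverses each level of \<open>t\<close>. The levels are the
  bunches, and the element is B-positive; in particular it is an involution.

  Conversely the permutation of a B-positive element is explicit. Its only descent is between the
  bottom horizontal lines and the lowest bunch, and the triple is visible
  (\<open>minimal_NGT_B_positive_elt\<close>). For the factorization through longest elements, \<open>longest_eqI\<close> reduces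
  the claim to checking that two explicit signed permutations fix the right face of the alcove and
  make the right simple roots negative (\<open>longest_upper\<close>, \<open>longest_stabilizer\<close>).
\<close>

section \<open>Linear maps and linear forms\<close>

definition scale :: "real \<Rightarrow> affvec \<Rightarrow> affvec" where
  "scale c a = (smul c (fst a), c * snd a)"

lemma scale_simps [simp]: "fst (scale c a) i = c * fst a i" "snd (scale c a) = c * snd a"
  by (simp_all add: scale_def smul_def)

definition linear_map :: "(affvec \<Rightarrow> affvec) \<Rightarrow> bool" where
  "linear_map w \<longleftrightarrow> (\<forall>a b. w (a + b) = w a + w b) \<and> (\<forall>c a. w (scale c a) = scale c (w a))"

definition linear_form :: "(affvec \<Rightarrow> real) \<Rightarrow> bool" where
  "linear_form q \<longleftrightarrow> (\<forall>a b. q (a + b) = q a + q b) \<and> (\<forall>c a. q (scale c a) = c * q a)"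

lemma scale_minus_one: "scale (-1) a = - a"
  by (auto simp: prod_eq_iff fun_eq_iff)

lemma linear_map_add: "linear_map w \<Longrightarrow> w (a + b) = w a + w b"
  and linear_map_scale: "linear_map w \<Longrightarrow> w (scale c a) = scale c (w a)"
  unfolding linear_map_def by blast+

lemma linear_map_minus: "linear_map w \<Longrightarrow> w (- a) = - w a"
  using linear_map_scale[of w "-1" a] by (simp add: scale_minus_one)

lemma linear_map_diff: "linear_map w \<Longrightarrow> w (a - b) = w a - w b"
  using linear_map_add[of w a "- b"] by (simp add: linear_map_minus)

lemma linear_map_comp: "linear_map v \<Longrightarrow> linear_map w \<Longrightarrow> linear_map (v \<circ> w)"
  unfolding linear_map_def o_apply by metis

lemma linear_form_add: "linear_form q \<Longrightarrow> q (a + b) = q a + q b"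
  and linear_form_scale: "linear_form q \<Longrightarrow> q (scale c a) = c * q a"
  unfolding linear_form_def by blast+

lemma linear_form_minus: "linear_form q \<Longrightarrow> q (- a) = - q a"
  using linear_form_scale[of q "-1" a] by (simp add: scale_minus_one)

lemma linear_form_diff: "linear_form q \<Longrightarrow> q (a - b) = q a - q b"
  using linear_form_add[of q a "- b"] by (simp add: linear_form_minus)

section \<open>Consecutive blocks\<close>

lemma block_Cons_0: "block u (p # ps) 0 = {u + 1..u + p}"
  and block_Cons_Suc: "block u (p # ps) (Suc j) = block (u + p) ps j"
  by (auto simp: block_def)

lemma block_cover: "i \<in> {u + 1..u + sum_list ps} \<Longrightarrow> \<exists>j<length ps. i \<in> block u ps j"
proof (induction ps arbitrary: u)
  case (Cons p ps)
  show ?case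
  proof (cases "i \<le> u + p")
    case True
    then show ?thesis using Cons.prems block_Cons_0 by (intro exI[of _ 0]) auto
  next
    case False
    then obtain j where "j < length ps" "i \<in> block (u + p) ps j" using Cons.IH[of "u + p"] Cons.prems by auto
    then show ?thesis using block_Cons_Suc by (intro exI[of _ "Suc j"]) auto
  qed
qed simp

lemma block_subset: "j < length ps \<Longrightarrow> block u ps j \<subseteq> {u + 1..u + sum_list ps}"
proof (induction ps arbitrary: u j)
  case (Cons p ps)
  then show ?case
  proof (cases j)
    case (Suc k)
    then show ?thesis using Cons.IH[of k "u + p"] Cons.prems unfolding Suc block_Cons_Suc by fastforce
  qed (auto simp: block_Cons_0)
qed simp

lemma block_rev_in_block: "i \<in> block u ps j \<Longrightarrow> block_rev u ps j i \<in> block u ps j"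
  by (auto simp: block_def block_rev_def)

lemma block_rev_involution: "i \<in> block u ps j \<Longrightarrow> block_rev u ps j (block_rev u ps j i) = i"
  by (auto simp: block_def block_rev_def)

lemma last_block:
  assumes "ps \<noteq> []"
  shows "block u ps (length ps - 1) = {u + sum_list ps + 1 - last ps..u + sum_list ps}"
    and "block_rev u ps (length ps - 1) i = 2 * (u + sum_list ps) + 1 - last ps - i"
proof -
  have "take (length ps - 1) ps = butlast ps" by (simp add: butlast_conv_take)
  moreover have "sum_list (butlast ps) + last ps = sum_list ps"
    using assms by (metis append_butlast_last_id sum_list.append sum_list_simps(1,2) add.right_neutral sum_list.Cons sum_list.Nil)
  moreover have "take (Suc (length ps - 1)) ps = ps" using assms by simp
  ultimately show "block u ps (length ps - 1) = {u + sum_list ps + 1 - last ps..u + sum_list ps}"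
    "block_rev u ps (length ps - 1) i = 2 * (u + sum_list ps) + 1 - last ps - i"
    unfolding block_def block_rev_def by auto
qed

lemma block_less: "j < j' \<Longrightarrow> i \<in> block u ps j \<Longrightarrow> k \<in> block u ps j' \<Longrightarrow> i < k"
proof -
  assume "j < j'" "i \<in> block u ps j" "k \<in> block u ps j'"
  moreover have "sum_list (take (Suc j) ps) \<le> sum_list (take j' ps)"
  proof -
    have "take j' ps = take (Suc j) ps @ take (j' - Suc j) (drop (Suc j) ps)"
      using \<open>j < j'\<close> by (metis Suc_leI le_add_diff_inverse take_add)
    then show ?thesis by simp
  qed
  ultimately show ?thesis by (auto simp: block_def)
qed

lemma sorted_wrt_nth_inject:
  fixes ts :: "nat list"
  assumes "sorted_wrt (<) ts" "j < length ts" "k < length ts" "ts ! j = ts ! k" shows "j = k"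
  using sorted_wrt_nth_less[OF assms(1), of j k] sorted_wrt_nth_less[OF assms(1), of k j] assms(2-4)
  by (cases j k rule: linorder_cases) auto

text \<open>
  This is how the sizes and the \<open>t\<close>-numbers of the bunches are read off from a configuration: the
  blocks are the level sets of \<open>t\<close>.
\<close>

lemma block_decomposition:
  fixes t :: "nat \<Rightarrow> nat"
  assumes "\<And>i j. u < i \<Longrightarrow> i \<le> j \<Longrightarrow> j \<le> u + m \<Longrightarrow> t i \<le> t j"
  shows "\<exists>ps ts. length ts = length ps \<and> sum_list ps = m \<and> (\<forall>p\<in>set ps. 1 \<le> p) \<and>
    sorted_wrt (<) ts \<and> (\<forall>c\<in>set ts. \<exists>i. u < i \<and> i \<le> u + m \<and> t i = c) \<and>
    (\<forall>j<length ps. \<forall>i\<in>block u ps j. t i = ts ! j)"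
  using assms
proof (induction m arbitrary: u rule: less_induct)
  case (less m)
  show ?case
  proof (cases "m = 0")
    case True
    then show ?thesis by (intro exI[of _ "[]"]) simp
  next
    case False
    define c where "c = t (u + 1)"
    (* p is the length of the first level set; the rest is decomposed by induction. *)
    define p where "p = Max {i \<in> {1..m}. t (u + i) = c}"
    have "p \<in> {i \<in> {1..m}. t (u + i) = c}"
      unfolding p_def using False by (intro Max_in) (auto simp: c_def intro!: exI[of _ 1])
    then have p: "1 \<le> p" "p \<le> m" "t (u + p) = c" by auto
    have const: "t i = c" if "i \<in> {u + 1..u + p}" for i
      using less.prems[of "u + 1" i] less.prems[of i "u + p"] p that by (auto simp: c_def)
    have above: "c < t i" if "i \<in> {u + p + 1..u + m}" for i
    proof -
      have "t i \<noteq> c"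
      proof
        assume "t i = c"
        then have "i - u \<le> p" unfolding p_def using that by (intro Max_ge) auto
        then show False using that by auto
      qed
      moreover have "c \<le> t i" using less.prems[of "u + 1" i] that by (auto simp: c_def)
      ultimately show ?thesis by simp
    qed
    have mono: "t i \<le> t j" if "u + p < i" "i \<le> j" "j \<le> u + p + (m - p)" for i j
      using less.prems[of i j] p that by auto
    have "m - p < m" using p by simp
    from less.IH[OF this mono] obtain ps ts where *: "length ts = length ps" "sum_list ps = m - p" "\<forall>p\<in>set ps. 1 \<le> p"
      "sorted_wrt (<) ts" "\<forall>c\<in>set ts. \<exists>i. u + p < i \<and> i \<le> u + p + (m - p) \<and> t i = c"
      "\<forall>j<length ps. \<forall>i\<in>block (u + p) ps j. t i = ts ! j"
      by blast
    have "\<forall>c\<in>set (c # ts). \<exists>i. u < i \<and> i \<le> u + m \<and> t i = c"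
      using *(5) p const[of "u + 1"] by (auto, metis add_lessD1)
    moreover have "sorted_wrt (<) (c # ts)" using *(4,5) above p by fastforce
    moreover have "t i = (c # ts) ! j" if "j < length (p # ps)" "i \<in> block u (p # ps) j" for i j
      using that *(6) const by (cases j) (auto simp: block_Cons_0 block_Cons_Suc)
    ultimately show ?thesis using * p by (intro exI[of _ "p # ps"] exI[of _ "c # ts"]) simp
  qed
qed

text \<open>
  The squeezing argument used for all permutations below: where two such estimates from the ends
  of an interval meet, they determine the values in between.
\<close>

lemma strict_chain:
  fixes f :: "int \<Rightarrow> int"
  assumes "\<And>x. a \<le> x \<Longrightarrow> x < b \<Longrightarrow> f x < f (x + 1)" "a \<le> x" "y \<le> b" "x \<le> y"
  shows "f x + (y - x) \<le> f y"
  using assms(4,3)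
proof (induction y rule: int_ge_induct)
  case (step y)
  then show ?case using assms(1)[of y] assms(2) by simp
qed simp

lemma down_closed_eq:
  fixes A B :: "int set"
  assumes "finite R" "A \<subseteq> R" "B \<subseteq> R" "card A = card B"
    and "\<And>x y. x \<in> A \<Longrightarrow> y \<in> R \<Longrightarrow> y \<le> x \<Longrightarrow> y \<in> A" "\<And>x y. x \<in> B \<Longrightarrow> y \<in> R \<Longrightarrow> y \<le> x \<Longrightarrow> y \<in> B"
  shows "A = B"
proof -
  have "A \<subseteq> B \<or> B \<subseteq> A" using assms(2,3,5,6) by (meson linorder_linear subset_iff)
  then show ?thesis using assms(1-4) by (metis card_subset_eq finite_subset)
qed

text \<open>
  Squeezing from both ends leaves only the reversal. Inside one bunch this yields the
  order-reversing bijection.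
\<close>

lemma decreasing_self_map:
  fixes h :: "int \<Rightarrow> int"
  assumes "\<And>x. a \<le> x \<Longrightarrow> x \<le> b \<Longrightarrow> a \<le> h x \<and> h x \<le> b"
    and "\<And>x. a \<le> x \<Longrightarrow> x < b \<Longrightarrow> h (x + 1) < h x" and "a \<le> x" "x \<le> b"
  shows "h x = a + b - x"
  using strict_chain[of a b "\<lambda>x. - h x" a x] strict_chain[of a b "\<lambda>x. - h x" x b] assms(1)[of a] assms(1)[of b]
    assms(2-4) by fastforce

section \<open>The coordinates of a B-positive element\<close>

lemma sum_fun_apply: "(\<Sum>x\<in>A. f x) k = (\<Sum>x\<in>A. f x k)" for f :: "'a \<Rightarrow> 'b \<Rightarrow> real"
  by (induction A rule: infinite_finite_induct) auto

lemma B_positive_b_apply: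
  "B_positive_b u ps ts k = - (\<Sum>j<length ps. if k \<in> block u ps j then real (ts ! j) else 0)"
proof -
  have "(\<Sum>i\<in>block u ps j. eps i k) = of_bool (k \<in> block u ps j)" for j
  proof -
    have "(\<Sum>i\<in>block u ps j. eps i k) = (\<Sum>i\<in>block u ps j. if i = k then 1 else 0)"
      by (rule sum.cong) (auto simp: eps_def)
    then show ?thesis by (simp add: block_def)
  qed
  then have "smul (real (ts ! j)) (\<Sum>i\<in>block u ps j. eps i) k = (if k \<in> block u ps j then real (ts ! j) else 0)" for j
    by (simp add: sum_fun_apply smul_def)
  then show ?thesis unfolding B_positive_b_def by (simp add: sum_fun_apply)
qed

text \<open>
  The blocks are disjoint, so only one summand contributes to a given coordinate.
\<close>

lemma B_positive_b_block: "j < length ps \<Longrightarrow> k \<in> block u ps j \<Longrightarrow> B_positive_b u ps ts k = - real (ts ! j)"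
proof -
  assume j: "j < length ps" "k \<in> block u ps j"
  have "(\<Sum>j<length ps. if k \<in> block u ps j then real (ts ! j) else 0) =
    (\<Sum>j'<length ps. if j' = j then real (ts ! j) else 0)"
    by (rule sum.cong) (use j block_disjoint in auto)
  then show ?thesis using j unfolding B_positive_b_apply by simp
qed

lemma B_positive_b_outside:
  "(\<And>j. j < length ps \<Longrightarrow> k \<notin> block u ps j) \<Longrightarrow> B_positive_b u ps ts k = 0"
  unfolding B_positive_b_apply by (simp add: sum.neutral)

lemma smul_add_left: "smul (c + d) x = smul c x + smul d x"
  and smul_diff: "smul c (x - y) = smul c x - smul c y"
  by (auto simp: smul_def fun_eq_iff algebra_simps)

lemma smul_sum: "smul c (\<Sum>x\<in>A. f x) = (\<Sum>x\<in>A. smul c (f x))"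
  by (simp add: fun_eq_iff smul_def sum_fun_apply sum_distrib_left)

lemma B_positive_lin_add: "B_positive_lin u ps (x + y) = B_positive_lin u ps x + B_positive_lin u ps y"
  unfolding B_positive_lin_def by (simp add: smul_add_left sum.distrib)

lemma B_positive_lin_smul: "B_positive_lin u ps (smul c x) = smul c (B_positive_lin u ps x)"
proof -
  have "smul (smul c x i) v = smul c (smul (x i) v)" for i v by (simp add: smul_def mult.assoc)
  then show ?thesis unfolding B_positive_lin_def by (simp only: smul_diff smul_sum)
qed

section \<open>Vectors indexed by the integers\<close>

locale twisted_B =
  fixes n :: nat
  assumes rank: "n \<ge> 3"
begin

abbreviation N :: int where "N \<equiv> int n + 1"

text \<open>
  The height of an affine root, that is, the sum of its coefficients in the basis of simple roots:
  it takes the value \<open>1\<close> on each simple root. It decides positivity of roots.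
\<close>

definition height :: "affvec \<Rightarrow> real" where
  "height a = of_int N * snd a + (\<Sum>i=1..n. of_int (N - int i) * fst a i)"

text \<open>
  Think of the \<open>n\<close> lines at the right end as points at the levels \<open>1, \<dots>, n\<close> between the bottom mirror
  at level \<open>0\<close> and the top mirror at level \<open>N\<close>; line \<open>i\<close> has level \<open>N - i\<close>. Unfolding the two mirrors
  gives points at all integers, with period \<open>2 N\<close>, and \<open>vec x\<close> is the vector attached to the point
  \<open>x\<close>: it is \<open>\<epsilon>\<^sub>i\<close> at \<open>N - i\<close>, odd in \<open>x\<close>, grows by the constant \<open>[0, 2]\<close> in each period, and is
  constant at the mirrors \<open>N a\<close>. The last component is chosen so that \<open>vec x\<close> has height \<open>x\<close>.
\<close>

definition vec :: "int \<Rightarrow> affvec" where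
  "vec x = (let z = (\<lambda>i. if i \<in> {1..n}
      then of_bool (2 * N dvd x - (N - int i)) - of_bool (2 * N dvd x + (N - int i)) else 0)
    in (z, (of_int x - (\<Sum>i=1..n. of_int (N - int i) * z i)) / of_int N))"

lemma linear_height: "linear_form height"
  unfolding linear_form_def height_def
  by (simp add: distrib_left sum.distrib sum_distrib_left mult.left_commute)

lemmas height_add = linear_form_add[OF linear_height]
  and height_scale = linear_form_scale[OF linear_height]
  and height_minus = linear_form_minus[OF linear_height]
  and height_diff = linear_form_diff[OF linear_height]

lemma height_vec [simp]: "height (vec x) = of_int x"
proof -
  have "of_int N \<noteq> (0::real)" by linarith
  then show ?thesis unfolding height_def vec_def Let_def by simp
qed

text \<open>
  The height stands in for the last component, which makes identities between the vectors
  \<open>vec x\<close> a matter of their coordinates only.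
\<close>

lemma affvec_eqI: "fst a = fst b \<Longrightarrow> height a = height b \<Longrightarrow> a = b"
proof -
  assume "fst a = fst b" "height a = height b"
  moreover have "of_int N \<noteq> (0::real)" by linarith
  ultimately show "a = b" unfolding height_def by (simp add: prod_eq_iff)
qed

lemma height_const [simp]: "height (0, c) = of_int N * c"
  by (simp add: height_def)

lemma height_eps: "i \<in> {1..n} \<Longrightarrow> height (eps i, 0) = of_int (N - int i)"
proof -
  assume i: "i \<in> {1..n}"
  have "height (eps i, 0) = (\<Sum>j=1..n. if j = i then of_int (N - int i) else 0)"
    unfolding height_def by (simp add: eps_def if_distrib cong: if_cong)
  also have "\<dots> = of_int (N - int i)" using i by simp
  finally show ?thesis .
qed

lemma fst_vec: "fst (vec x) i = (if i \<in> {1..n}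
      then of_bool (2 * N dvd x - (N - int i)) - of_bool (2 * N dvd x + (N - int i)) else 0)"
  by (simp add: vec_def Let_def)

lemma vec_minus: "vec (- x) = - vec x"
proof (rule affvec_eqI)
  have *: "2 * N dvd - x - (N - int i) \<longleftrightarrow> 2 * N dvd x + (N - int i)"
    "2 * N dvd - x + (N - int i) \<longleftrightarrow> 2 * N dvd x - (N - int i)" for i
    using dvd_minus_iff[of "2 * N" "x + (N - int i)"] dvd_minus_iff[of "2 * N" "x - (N - int i)"]
    by (simp_all add: algebra_simps)
  show "fst (vec (- x)) = fst (- vec x)"
    unfolding fun_eq_iff by (simp only: fst_vec fst_uminus fun_Compl_def * uminus_apply) auto
qed (simp add: height_minus)

lemma dvd_period: "2 * N dvd x + 2 * N * a + c \<longleftrightarrow> 2 * N dvd x + c"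
proof -
  have "x + 2 * N * a + c = (x + c) + 2 * N * a" by simp
  then show ?thesis by (simp only: dvd_add_left_iff[OF dvd_triv_left])
qed

lemma vec_period: "vec (x + 2 * N * a) = vec x + (0, 2 * of_int a)"
proof (rule affvec_eqI)
  have *: "2 * N dvd x + 2 * N * a - c \<longleftrightarrow> 2 * N dvd x - c" for c
    using dvd_period[of x a "- c"] by simp
  show "fst (vec (x + 2 * N * a)) = fst (vec x + (0, 2 * of_int a))"
    unfolding fun_eq_iff by (simp only: fst_vec fst_add plus_fun_apply * dvd_period) simp
  show "height (vec (x + 2 * N * a)) = height (vec x + (0, 2 * of_int a))"
    by (simp add: height_add)
qed

lemma not_dvd_between: "0 < x \<Longrightarrow> x < m \<Longrightarrow> \<not> m dvd (x::int)"
  using zdvd_not_zless by blast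

lemma vec_wall: "vec (N * a) = (0, of_int a)"
proof (rule affvec_eqI)
  have no: "\<not> N dvd N - int i" if "i \<in> {1..n}" for i
    by (rule not_dvd_between) (use that in auto)
  have "\<not> 2 * N dvd N * a - (N - int i)" "\<not> 2 * N dvd N * a + (N - int i)" if "i \<in> {1..n}" for i
    using no[OF that] dvd_mult_right[of 2 N "N * a - (N - int i)"]
      dvd_mult_right[of 2 N "N * a + (N - int i)"]
    by (metis dvd_diff_right_iff dvd_triv_left)
      (metis no[OF that] dvd_add_right_iff dvd_triv_left dvd_mult_right)
  then show "fst (vec (N * a)) = fst (0, of_int a)"
    by (auto simp: fun_eq_iff fst_vec)
  show "height (vec (N * a)) = height (0, of_int a)" by simp
qed

lemma vec_zero: "vec 0 = (0, 0)" and vec_N: "vec N = (0, 1)"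
  using vec_wall[of 0] vec_wall[of 1] by simp_all

lemma vec_coordinate: "i \<in> {1..n} \<Longrightarrow> vec (N - int i) = (eps i, 0)"
proof (rule affvec_eqI)
  assume i: "i \<in> {1..n}"
  have 1: "2 * N dvd (N - int i) - (N - int j) \<longleftrightarrow> j = i" if "j \<in> {1..n}" for j
  proof
    assume *: "2 * N dvd (N - int i) - (N - int j)"
    have "\<bar>(N - int i) - (N - int j)\<bar> < 2 * N" using i that by auto
    have "(N - int i) - (N - int j) = 0"
      using dvd_imp_le_int[OF _ *] \<open>\<bar>(N - int i) - (N - int j)\<bar> < 2 * N\<close>
      by linarith
    then show "j = i" by simp
  qed auto
  have 2: "\<not> 2 * N dvd (N - int i) + (N - int j)" if "j \<in> {1..n}" for j
    by (rule not_dvd_between) (use i that in auto)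
  show "fst (vec (N - int i)) = fst (eps i, 0)"
  proof
    fix j show "fst (vec (N - int i)) j = fst (eps i, 0) j"
    proof (cases "j \<in> {1..n}")
      case True
      then show ?thesis
        by (simp only: fst_vec eps_def fst_conv if_True 1 2 of_bool_def simp_thms if_False diff_zero)
    next
      case False
      then show ?thesis using i by (auto simp only: fst_vec eps_def fst_conv if_False split: if_splits)
    qed
  qed
  show "height (vec (N - int i)) = height (eps i, 0)" using i by (simp add: height_eps)
qed

lemma vec_cases:
  obtains (wall) a where "x = N * a"
  | (pos) i a where "i \<in> {1..n}" "x = (N - int i) + 2 * N * a"
  | (neg) i a where "i \<in> {1..n}" "x = - (N - int i) + 2 * N * a"
proof -
  define r where "r = x mod (2 * N)"
  define a where "a = x div (2 * N)"
  have x: "x = r + 2 * N * a" unfolding r_def a_def by simp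
  have r: "0 \<le> r" "r < 2 * N" unfolding r_def by (auto simp: pos_mod_bound)
  consider "r = 0" | "0 < r" "r < N" | "r = N" | "r > N" using r by linarith
  then show ?thesis
  proof cases
    case 1 then show ?thesis using wall[of "2 * a"] x by simp
  next
    case 2 then show ?thesis using pos[of "nat (N - r)" a] x by simp
  next
    case 3 then show ?thesis using wall[of "2 * a + 1"] x by (simp add: algebra_simps)
  next
    case 4
    have "nat (r - N) \<in> {1..n}" "x = - (N - int (nat (r - N))) + 2 * N * (a + 1)"
      using 4 r x by (auto simp: algebra_simps)
    then show ?thesis by (rule neg)
  qed
qed

lemma vec_inject [simp]: "vec x = vec y \<longleftrightarrow> x = y"
  by (metis height_vec of_int_eq_iff)

text \<open>
  Linear statements about affine vectors reduce to the coordinate vectors and to the vectors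
  with vanishing coordinates \<open>1..n\<close>, on which all maps considered here act trivially.
\<close>

lemma span_induct [consumes 0, case_names outer coordinate add scale]:
  assumes "\<And>a. (\<forall>i\<in>{1..n}. fst a i = 0) \<Longrightarrow> P a"
    and "\<And>i. i \<in> {1..n} \<Longrightarrow> P (eps i, 0)"
    and "\<And>a b. P a \<Longrightarrow> P b \<Longrightarrow> P (a + b)"
    and "\<And>c a. P a \<Longrightarrow> P (scale c a)"
  shows "P a"
proof -
  have "m \<le> n \<Longrightarrow> (\<forall>i\<in>{m+1..n}. fst a i = 0) \<Longrightarrow> P a" for m
  proof (induction m arbitrary: a)
    case 0 then show ?case using assms(1) by simp
  next
    case (Suc m)
    let ?b = "((fst a)(Suc m := 0), snd a)"
    have eq: "a = ?b + scale (fst a (Suc m)) (eps (Suc m), 0)"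
      by (auto simp: prod_eq_iff fun_eq_iff eps_def)
    have "P ?b" using Suc.prems by (intro Suc.IH) (auto simp: le_Suc_eq)
    then show ?case by (subst eq) (rule assms(3), use assms(2,4) Suc.prems in auto)
  qed
  from this[of n] show ?thesis by simp
qed

text \<open>
  The linear maps that permute the vectors \<open>vec x\<close> among themselves; \<open>perm\<close> below is the map
  induced on the integers \<open>x\<close>. For invertible maps this is the realization of the affine Weyl group
  by affine signed permutations, \<open>f (- x) = - f x\<close> and \<open>f (x + 2 N) = f x + 2 N\<close>.
\<close>

definition lattice_map :: "(affvec \<Rightarrow> affvec) \<Rightarrow> bool" where
  "lattice_map w \<longleftrightarrow> linear_map w \<and> (\<forall>a. (\<forall>i\<in>{1..n}. fst a i = 0) \<longrightarrow> w a = a) \<and>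
     (\<forall>x. \<exists>y. w (vec x) = vec y)"

definition perm :: "(affvec \<Rightarrow> affvec) \<Rightarrow> int \<Rightarrow> int" where
  "perm w x = \<lfloor>height (w (vec x))\<rfloor>"

lemma lattice_map_linear: "lattice_map w \<Longrightarrow> linear_map w"
  and lattice_map_fix: "lattice_map w \<Longrightarrow> (\<And>i. i\<in>{1..n} \<Longrightarrow> fst a i = 0) \<Longrightarrow> w a = a"
  unfolding lattice_map_def by blast+

lemma apply_vec: "lattice_map w \<Longrightarrow> w (vec x) = vec (perm w x)"
  unfolding lattice_map_def perm_def by (metis height_vec floor_of_int)

lemma perm_eqI: "w (vec x) = vec y \<Longrightarrow> perm w x = y"
  by (simp add: perm_def)

lemma perm_minus: "lattice_map w \<Longrightarrow> perm w (- x) = - perm w x"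
  by (rule perm_eqI) (simp add: vec_minus linear_map_minus lattice_map_linear apply_vec)

lemma perm_period: "lattice_map w \<Longrightarrow> perm w (x + 2 * N * a) = perm w x + 2 * N * a"
  by (rule perm_eqI)
    (simp only: vec_period linear_map_add lattice_map_linear apply_vec, simp add: lattice_map_fix)

lemma perm_wall: "lattice_map w \<Longrightarrow> perm w (N * a) = N * a"
  by (rule perm_eqI) (simp only: vec_wall, simp add: lattice_map_fix)

lemma perm_zero: "lattice_map w \<Longrightarrow> perm w 0 = 0" and perm_N: "lattice_map w \<Longrightarrow> perm w N = N"
  using perm_wall[of w 0] perm_wall[of w 1] by simp_all

text \<open>
  By oddness and periodicity it is enough to look at the coordinate vectors.
\<close>

lemma lattice_mapI:
  assumes "linear_map w" "\<And>a. (\<And>i. i \<in> {1..n} \<Longrightarrow> fst a i = 0) \<Longrightarrow> w a = a"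
    and "\<And>i. i \<in> {1..n} \<Longrightarrow> \<exists>y. w (eps i, 0) = vec y"
  shows "lattice_map w"
  unfolding lattice_map_def
proof (intro conjI allI)
  have fix0: "w (0, c) = (0, c)" for c by (rule assms(2)) simp
  fix x show "\<exists>y. w (vec x) = vec y"
  proof (cases x rule: vec_cases)
    case (wall a)
    then show ?thesis using fix0 by (intro exI[of _ x]) (simp only: vec_wall)
  next
    case (pos i a)
    with assms(3) obtain y where "w (eps i, 0) = vec y" by blast
    then have "w (vec x) = vec (y + 2 * N * a)"
      unfolding pos(2) vec_period by (simp only: vec_coordinate[OF pos(1)] linear_map_add[OF assms(1)] fix0)
    then show ?thesis ..
  next
    case (neg i a)
    with assms(3) obtain y where "w (eps i, 0) = vec y" by blast
    then have "w (vec x) = vec (- y + 2 * N * a)"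
      unfolding neg(2) vec_period
      by (simp only: vec_minus vec_coordinate[OF neg(1)] linear_map_add[OF assms(1)]
          linear_map_minus[OF assms(1)] fix0)
    then show ?thesis ..
  qed
qed (use assms in auto)

lemma lattice_map_comp: "lattice_map v \<Longrightarrow> lattice_map w \<Longrightarrow> lattice_map (v \<circ> w)"
  unfolding lattice_map_def by (metis comp_apply linear_map_comp)

lemma perm_comp: "lattice_map v \<Longrightarrow> lattice_map w \<Longrightarrow> perm (v \<circ> w) x = perm v (perm w x)"
  by (rule perm_eqI) (simp add: apply_vec)

lemma lattice_map_id: "lattice_map id"
  by (auto simp: lattice_map_def linear_map_def)

lemma perm_id [simp]: "perm id x = x"
  by (simp add: perm_def)

lemma linear_map_eqI:
  assumes "linear_map v" "linear_map w" "\<And>a. (\<And>i. i \<in> {1..n} \<Longrightarrow> fst a i = 0) \<Longrightarrow> v a = w a"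
    and "\<And>i. i \<in> {1..n} \<Longrightarrow> v (eps i, 0) = w (eps i, 0)"
  shows "v = w"
proof
  fix a show "v a = w a"
    by (induction a rule: span_induct)
      (use assms in \<open>auto simp: linear_map_add linear_map_scale\<close>)
qed

lemma lattice_map_eqI:
  assumes "lattice_map v" "lattice_map w" "\<And>x. 1 \<le> x \<Longrightarrow> x \<le> int n \<Longrightarrow> perm v x = perm w x"
  shows "v = w"
proof (rule linear_map_eqI)
  fix i assume i: "i \<in> {1..n}"
  then have "perm v (N - int i) = perm w (N - int i)" by (intro assms(3)) auto
  then show "v (eps i, 0) = w (eps i, 0)"
    using apply_vec[OF assms(1), of "N - int i"] apply_vec[OF assms(2), of "N - int i"]
      vec_coordinate[OF i] by simp
next
  fix a :: affvec assume "\<And>i. i \<in> {1..n} \<Longrightarrow> fst a i = 0"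
  then show "v a = w a" using lattice_map_fix[OF assms(1)] lattice_map_fix[OF assms(2)] by metis
qed (use assms in \<open>auto simp: lattice_map_linear\<close>)


section \<open>Roots as differences of vectors\<close>

lemma form_add_left: "form n (x + y) z = form n x z + form n y z"
  and form_add_right: "form n z (x + y) = form n z x + form n z y"
  by (simp_all add: form_def algebra_simps sum.distrib)

lemma form_minus_left: "form n (- x) z = - form n x z"
  and form_minus_right: "form n z (- x) = - form n z x"
  by (simp_all add: form_def sum_negf)

lemma form_diff_left: "form n (x - y) z = form n x z - form n y z"
  and form_diff_right: "form n z (x - y) = form n z x - form n z y"
  by (simp_all add: form_def algebra_simps sum_subtractf)

lemma form_smul_left: "form n (smul c x) z = c * form n x z"
  by (simp add: form_def smul_def sum_distrib_left mult_ac)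

lemma form_commute: "form n x y = form n y x"
  by (simp add: form_def mult.commute)

lemma form_eps: "i \<in> {1..n} \<Longrightarrow> form n z (eps i) = 2 * z i"
proof -
  assume i: "i \<in> {1..n}"
  have "(\<Sum>j=1..n. z j * eps i j) = (\<Sum>j=1..n. if j = i then z i else 0)"
    by (rule sum.cong) (auto simp: eps_def)
  then show ?thesis using i by (simp add: form_def)
qed

lemmas form_simps = form_add_left form_add_right form_minus_left form_minus_right
  form_diff_left form_diff_right form_eps

lemma eps_apply: "eps i j = (if j = i then 1 else 0)"
  by (simp add: eps_def)

lemma nu_short: "i \<in> {1..n} \<Longrightarrow> nu n (eps i) = 1"
  and nu_minus: "nu n (- x) = nu n x"
  and nu_diff: "i \<in> {1..n} \<Longrightarrow> j \<in> {1..n} \<Longrightarrow> i \<noteq> j \<Longrightarrow> nu n (eps i - eps j) = 2"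
  and nu_add: "i \<in> {1..n} \<Longrightarrow> j \<in> {1..n} \<Longrightarrow> i \<noteq> j \<Longrightarrow> nu n (eps i + eps j) = 2"
  by (simp_all add: nu_def form_simps eps_apply)

text \<open>
  The pairs for which the difference of the attached vectors is a root: two points over different
  lines, or a point over a line and a mirror. The second kind gives the short roots, since the
  two reflected copies of one line differ by twice a short root.
\<close>

definition root_pair :: "int \<Rightarrow> int \<Rightarrow> bool" where
  "root_pair x y \<longleftrightarrow> \<not> (N dvd x \<and> N dvd y) \<and> \<not> 2 * N dvd x - y \<and> \<not> 2 * N dvd x + y"

lemma root_pair_commute: "root_pair x y \<longleftrightarrow> root_pair y x"
  unfolding root_pair_def by (metis add.commute dvd_diff_commute)

lemma not_dvd_coordinate: "i \<in> {1..n} \<Longrightarrow> \<not> N dvd N - int i"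
  by (rule not_dvd_between) auto

lemma period_dvd: "2 * N dvd x \<Longrightarrow> N dvd x"
  using dvd_mult_right by blast

lemma dvd_period0: "2 * N dvd x + 2 * N * a \<longleftrightarrow> 2 * N dvd x"
  using dvd_period[of x a 0] by simp

lemma dvd_wall: "N dvd x + 2 * N * a \<longleftrightarrow> N dvd x"
  by (metis dvd_add_left_iff dvd_triv_right mult.assoc mult.commute)

lemma small_not_dvd: "x \<noteq> 0 \<Longrightarrow> \<bar>x\<bar> < m \<Longrightarrow> \<not> m dvd (x::int)"
  using dvd_imp_le_int[of x m] by linarith

lemma root_pair_wall:
  assumes "\<not> N dvd x" shows "root_pair x (N * a)"
  unfolding root_pair_def
  using assms by (meson dvd_add_left_iff dvd_diff_left_iff dvd_triv_left period_dvd)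

lemma coordinate_diff_dvd:
  "i \<in> {1..n} \<Longrightarrow> j \<in> {1..n} \<Longrightarrow> 2 * N dvd (N - int i) - (N - int j) \<longleftrightarrow> i = j"
proof
  assume ij: "i \<in> {1..n}" "j \<in> {1..n}" "2 * N dvd (N - int i) - (N - int j)"
  have "\<bar>(N - int i) - (N - int j)\<bar> < 2 * N" using ij(1,2) by (auto simp: abs_less_iff)
  then have "(N - int i) - (N - int j) = 0" using ij(3) small_not_dvd by blast
  then show "i = j" by simp
qed simp

lemma coordinate_sum_not_dvd:
  "i \<in> {1..n} \<Longrightarrow> j \<in> {1..n} \<Longrightarrow> \<not> 2 * N dvd (N - int i) + (N - int j)"
  by (rule not_dvd_between) auto

text \<open>
  A short root \<open>[\<epsilon>\<^sub>i, m]\<close> is measured against the mirror at \<open>- N m\<close>, and the long roots \<open>[\<epsilon>\<^sub>i - \<epsilon>\<^sub>j, 2 m]\<close>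
  and \<open>[\<epsilon>\<^sub>i + \<epsilon>\<^sub>j, 2 m]\<close> against a point over line \<open>j\<close>. The height of the nonaffine part is positive and
  smaller than the step by which \<open>m\<close> changes the total, so the pair is in the opposite order
  exactly for \<open>m < 0\<close>.
\<close>

lemma pos_root_as_pair:
  assumes "\<alpha> \<in> pos_roots n"
  shows "\<exists>x y. (\<alpha>, nu n \<alpha> * of_int m) = vec x - vec y \<and> root_pair x y \<and>
    (0 \<le> m \<longrightarrow> y < x) \<and> (m < 0 \<longrightarrow> x < y)"
proof -
  have m: "m < 0 \<Longrightarrow> N * m \<le> - N" "0 \<le> m \<Longrightarrow> 0 \<le> N * m"
    using mult_left_mono[of m "-1" N] by (auto simp: zero_le_mult_iff)
  consider (short) i where "\<alpha> = eps i" "i \<in> {1..n}"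
    | (minus) i j where "\<alpha> = eps i - eps j" "i \<in> {1..n}" "j \<in> {1..n}" "i < j"
    | (plus) i j where "\<alpha> = eps i + eps j" "i \<in> {1..n}" "j \<in> {1..n}" "i < j"
    using assms unfolding pos_roots_def by fastforce
  then show ?thesis
  proof cases
    case short
    let ?x = "N - int i" and ?y = "N * (- m)"
    have "(\<alpha>, nu n \<alpha> * of_int m) = vec ?x - vec ?y"
      unfolding vec_wall using short by (simp add: vec_coordinate nu_short)
    moreover have "root_pair ?x ?y" using short not_dvd_coordinate root_pair_wall by blast
    moreover have "0 \<le> m \<Longrightarrow> ?y < ?x" "m < 0 \<Longrightarrow> ?x < ?y"
      using m short(2) unfolding mult_minus_right atLeastAtMost_iff by linarith+
    ultimately show ?thesis by blast
  next
    case minus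
    let ?x = "(N - int i) + 2 * N * m" and ?y = "N - int j"
    have "(\<alpha>, nu n \<alpha> * of_int m) = vec ?x - vec ?y"
      unfolding vec_period using minus by (simp add: vec_coordinate nu_diff)
    moreover have "root_pair ?x ?y"
    proof -
      have "?x - ?y = ((N - int i) - (N - int j)) + 2 * N * m"
        "?x + ?y = ((N - int i) + (N - int j)) + 2 * N * m" by simp_all
      then show ?thesis unfolding root_pair_def
        using minus not_dvd_coordinate coordinate_diff_dvd coordinate_sum_not_dvd dvd_period0
        by (metis less_irrefl)
    qed
    moreover have "0 \<le> m \<Longrightarrow> ?y < ?x" "m < 0 \<Longrightarrow> ?x < ?y" 
      using m minus(2-4) unfolding mult_minus_right atLeastAtMost_iff mult.assoc by linarith+
    ultimately show ?thesis by blast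
  next
    case plus
    let ?x = "(N - int i) + 2 * N * m" and ?y = "- (N - int j)"
    have "(\<alpha>, nu n \<alpha> * of_int m) = vec ?x - vec ?y"
      unfolding vec_period vec_minus using plus by (simp add: vec_coordinate nu_add)
    moreover have "root_pair ?x ?y"
    proof -
      have "?x - ?y = ((N - int i) + (N - int j)) + 2 * N * m"
        "?x + ?y = ((N - int i) - (N - int j)) + 2 * N * m" by simp_all
      moreover have "\<not> N dvd - (N - int j)" using not_dvd_coordinate[OF plus(3)] by (simp only: dvd_minus_iff not_False_eq_True)
      ultimately show ?thesis unfolding root_pair_def
        using plus coordinate_diff_dvd coordinate_sum_not_dvd dvd_period0
        by (metis less_irrefl)
    qed
    moreover have "0 \<le> m \<Longrightarrow> ?y < ?x" "m < 0 \<Longrightarrow> ?x < ?y" 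
      using m plus(2-4) unfolding mult_minus_right atLeastAtMost_iff mult.assoc by linarith+
    ultimately show ?thesis by blast
  qed
qed

text \<open>
  The converse: running through the possible positions of \<open>x\<close> and \<open>y\<close>, the difference is a root up
  to sign, and the excluded congruences are exactly the cases \<open>i = j\<close>.
\<close>

lemma pair_as_pos_root:
  assumes "root_pair x y"
  shows "\<exists>\<alpha>\<in>pos_roots n. \<exists>m. vec x - vec y = (\<alpha>, nu n \<alpha> * of_int m) \<or>
    vec x - vec y = - (\<alpha>, nu n \<alpha> * of_int m)"
proof -
  have short: "eps i \<in> pos_roots n" if "i \<in> {1..n}" for i
    using that unfolding pos_roots_def by auto
  have plus: "eps i + eps j \<in> pos_roots n" if "i \<in> {1..n}" "j \<in> {1..n}" "i \<noteq> j" for i j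
    using that unfolding pos_roots_def
    by (cases "i < j") (auto, metis add.commute linorder_neqE_nat)
  have minus: "eps i - eps j \<in> pos_roots n" if "i \<in> {1..n}" "j \<in> {1..n}" "i < j" for i j
    using that unfolding pos_roots_def by auto
  have S: ?thesis if "vec x - vec y = (eps i, of_int m) \<or> vec x - vec y = - (eps i, of_int m)"
    "i \<in> {1..n}" for i m
    using that short nu_short by (intro bexI[of _ "eps i"] exI[of _ m]) auto
  have P: ?thesis if "vec x - vec y = (eps i + eps j, 2 * of_int m) \<or>
      vec x - vec y = - (eps i + eps j, 2 * of_int m)"
    "i \<in> {1..n}" "j \<in> {1..n}" "i \<noteq> j" for i j m
    using that plus nu_add by (intro bexI[of _ "eps i + eps j"] exI[of _ m]) auto
  have M: ?thesis if "vec x - vec y = (eps i - eps j, 2 * of_int m)"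
    "i \<in> {1..n}" "j \<in> {1..n}" "i \<noteq> j" for i j m
  proof (cases "i < j")
    case True
    with that minus nu_diff show ?thesis
      by (intro bexI[of _ "eps i - eps j"] exI[of _ m]) auto
  next
    case False
    with that minus nu_diff show ?thesis
      by (intro bexI[of _ "eps j - eps i"] exI[of _ "- m"]) auto
  qed
  show ?thesis
  proof (cases x rule: vec_cases)
    case x: (wall a)
    show ?thesis
    proof (cases y rule: vec_cases)
      case y: (wall b)
      with x assms show ?thesis by (simp add: root_pair_def)
    next
      case y: (pos j b)
      show ?thesis by (rule S[of j "2 * b - a"])
        (use y(1) in \<open>simp_all only: x y(2) vec_wall vec_period vec_coordinate, simp_all\<close>)
    next
      case y: (neg j b)
      show ?thesis by (rule S[of j "a - 2 * b"])
        (use y(1) in \<open>simp_all only: x y(2) vec_wall vec_period vec_minus vec_coordinate, simp_all\<close>)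
    qed
  next
    case x: (pos i a)
    show ?thesis
    proof (cases y rule: vec_cases)
      case y: (wall b)
      show ?thesis by (rule S[of i "2 * a - b"])
        (use x(1) in \<open>simp_all only: y x(2) vec_wall vec_period vec_coordinate, simp_all\<close>)
    next
      case y: (pos j b)
      have "x - y = ((N - int i) - (N - int j)) + 2 * N * (a - b)"
        unfolding x y by (simp add: algebra_simps)
      then have "i \<noteq> j" using assms x y coordinate_diff_dvd dvd_period0 unfolding root_pair_def
        by metis
      then show ?thesis by (intro M[of i j "a - b"])
        (use x(1) y(1) in \<open>simp_all only: x(2) y(2) vec_period vec_coordinate, simp_all\<close>)
    next
      case y: (neg j b)
      have "x + y = ((N - int i) - (N - int j)) + 2 * N * (a + b)"
        unfolding x y by (simp add: algebra_simps)
      then have "i \<noteq> j" using assms x y coordinate_diff_dvd dvd_period0 unfolding root_pair_def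
        by metis
      then show ?thesis by (intro P[of i j "a - b"])
        (use x(1) y(1) in \<open>simp_all only: x(2) y(2) vec_period vec_minus vec_coordinate, simp_all\<close>)
    qed
  next
    case x: (neg i a)
    show ?thesis
    proof (cases y rule: vec_cases)
      case y: (wall b)
      show ?thesis by (rule S[of i "b - 2 * a"])
        (use x(1) in \<open>simp_all only: y x(2) vec_wall vec_period vec_minus vec_coordinate, simp_all\<close>)
    next
      case y: (pos j b)
      have "x + y = ((N - int j) - (N - int i)) + 2 * N * (a + b)"
        unfolding x y by (simp add: algebra_simps)
      then have "i \<noteq> j" using assms x y coordinate_diff_dvd dvd_period0 unfolding root_pair_def
        by metis
      then show ?thesis by (intro P[of i j "b - a"])
        (use x(1) y(1) in \<open>simp_all only: x(2) y(2) vec_period vec_minus vec_coordinate, simp_all\<close>)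
    next
      case y: (neg j b)
      have "x - y = ((N - int j) - (N - int i)) + 2 * N * (a - b)"
        unfolding x y by (simp add: algebra_simps)
      then have "j \<noteq> i" using assms x y coordinate_diff_dvd dvd_period0 unfolding root_pair_def
        by metis
      then show ?thesis by (intro M[of j i "a - b"])
        (use x(1) y(1) in \<open>simp_all only: x(2) y(2) vec_period vec_minus vec_coordinate, simp_all\<close>)
    qed
  qed
qed

text \<open>
  Positivity of a root is the order of the two points: an inversion of an element is a pair of
  points whose order it reverses.
\<close>

lemma aff_pos_roots_eq: "aff_pos_roots n = {vec x - vec y | x y. root_pair x y \<and> y < x}"
proof (intro Set.equalityI subsetI)
  fix a assume "a \<in> aff_pos_roots n"
  then consider (nonaffine) \<alpha> where "a = (\<alpha>, nu n \<alpha> * of_int 0)" "\<alpha> \<in> pos_roots n"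
    | (pos) \<alpha> m where "a = (\<alpha>, nu n \<alpha> * of_int m)" "\<alpha> \<in> pos_roots n" "m > 0"
    | (neg) \<alpha> m where "a = - (\<alpha>, nu n \<alpha> * of_int (- m))" "\<alpha> \<in> pos_roots n" "m > 0"
    unfolding aff_pos_roots_def roots_def by (fastforce simp: nu_minus)
  then show "a \<in> {vec x - vec y | x y. root_pair x y \<and> y < x}"
  proof cases
    case nonaffine
    then show ?thesis using pos_root_as_pair[of \<alpha> 0] by auto
  next
    case pos
    then show ?thesis using pos_root_as_pair[of \<alpha> m] by auto
  next
    case neg
    then obtain x y where "(\<alpha>, nu n \<alpha> * of_int (- m)) = vec x - vec y" "root_pair x y" "x < y"
      using pos_root_as_pair[of \<alpha> "- m"] by auto
    with neg(1) have "a = vec y - vec x" by (simp only: minus_diff_eq)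
    then show ?thesis using \<open>root_pair x y\<close> \<open>x < y\<close> root_pair_commute by blast
  qed
next
  fix a assume "a \<in> {vec x - vec y | x y. root_pair x y \<and> y < x}"
  then obtain x y where a: "a = vec x - vec y" "root_pair x y" "y < x" by blast
  then obtain \<alpha> m where \<alpha>: "\<alpha> \<in> pos_roots n"
    "a = (\<alpha>, nu n \<alpha> * of_int m) \<or> a = - (\<alpha>, nu n \<alpha> * of_int m)"
    using pair_as_pos_root by metis
  have h: "height a > 0" using a by (simp add: height_diff)
  have sgn: "height (\<alpha>, nu n \<alpha> * of_int m) > 0 \<longleftrightarrow> 0 \<le> m"
    "height (\<alpha>, nu n \<alpha> * of_int m) < 0 \<longleftrightarrow> m < 0"
    using pos_root_as_pair[OF \<alpha>(1), of m] by (auto simp: height_diff)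
  from \<alpha>(2) show "a \<in> aff_pos_roots n"
  proof
    assume eq: "a = (\<alpha>, nu n \<alpha> * of_int m)"
    with h sgn have "0 \<le> m" by simp
    then show ?thesis
      using eq \<alpha>(1) unfolding aff_pos_roots_def roots_def by (cases "m = 0") auto
  next
    assume eq: "a = - (\<alpha>, nu n \<alpha> * of_int m)"
    have m: "m < 0" using h sgn unfolding eq height_minus by linarith
    have "a = (- \<alpha>, nu n (- \<alpha>) * of_int (- m))" using eq by (simp add: nu_minus)
    moreover have "- \<alpha> \<in> roots n" using \<alpha>(1) unfolding roots_def by blast
    ultimately show ?thesis using m unfolding aff_pos_roots_def
      by (metis (mono_tags, lifting) UnI2 mem_Collect_eq neg_0_less_iff_less)
  qed
qed

definition aff_roots :: "affvec set" where
  "aff_roots = {vec x - vec y | x y. root_pair x y}"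

lemma aff_pos_roots_iff: "a \<in> aff_pos_roots n \<longleftrightarrow> a \<in> aff_roots \<and> 0 < height a"
proof -
  have "height (vec x - vec y) > 0 \<longleftrightarrow> y < x" for x y by (simp add: height_diff)
  then show ?thesis unfolding aff_pos_roots_eq aff_roots_def by blast
qed

lemma aff_rootsE:
  assumes "a \<in> aff_roots"
  obtains x y where "a = vec x - vec y" "root_pair x y" "x \<noteq> y"
proof -
  have "x \<noteq> y" if "root_pair x y" for x y using that by (auto simp: root_pair_def)
  then show ?thesis using assms that unfolding aff_roots_def by blast
qed

lemma height_root:
  assumes "a \<in> aff_roots"
  obtains m :: int where "height a = of_int m" "m \<noteq> 0"
  using aff_rootsE[OF assms] by (metis eq_iff_diff_eq_0 height_diff height_vec of_int_diff)

lemma uminus_aff_roots: "- a \<in> aff_roots \<longleftrightarrow> a \<in> aff_roots"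
proof -
  have "- a \<in> aff_roots" if "a \<in> aff_roots" for a
    using that root_pair_commute unfolding aff_roots_def by fastforce
  from this[of a] this[of "- a"] show ?thesis by auto
qed

lemma neg_aff_pos_roots_iff: "a \<in> uminus ` aff_pos_roots n \<longleftrightarrow> a \<in> aff_roots \<and> height a < 0"
  using aff_pos_roots_iff[of "- a"] uminus_aff_roots height_minus
  by (metis image_iff minus_minus neg_0_less_iff_less)


section \<open>Simple reflections\<close>

lemma copair_simple:
  assumes "j \<le> n"
  shows "copair n z (fst (simple_root n j)) =
    (if j = 0 then - 2 * z 1 else if j < n then z j - z (j + 1) else 2 * z n)"
  using assms rank by (auto simp: copair_def simple_root_def form_simps eps_apply)

lemma simple_refl_eq:
  "simple_refl n j a = a - scale (copair n (fst a) (fst (simple_root n j))) (simple_root n j)"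
proof -
  have "aff_reflection n b a = a - scale (copair n (fst a) (fst b)) b" for b
    by (cases b; cases a) (simp add: scale_def)
  then show ?thesis unfolding simple_refl_def by blast
qed

lemma simple_root_vec:
  assumes "j \<le> n"
  shows "simple_root n j = vec (int n - int j + 1) - vec (int n - int j)"
proof -
  consider "j = 0" | "0 < j" "j < n" | "j = n" using assms by linarith
  then show ?thesis
  proof cases
    case 1
    then show ?thesis using vec_coordinate[of 1] vec_N rank by (simp add: simple_root_def add.commute)
  next
    case 2
    then have "vec (int n - int j + 1) = (eps j, 0)" "vec (int n - int j) = (eps (j + 1), 0)"
      using vec_coordinate[of j] vec_coordinate[of "j + 1"] by (auto simp: algebra_simps)
    with 2 show ?thesis by (simp add: simple_root_def)
  next
    case 3
    then show ?thesis using vec_coordinate[of n] rank vec_zero by (simp add: simple_root_def prod_eq_iff fun_eq_iff)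
  qed
qed

lemma height_simple_root: "j \<le> n \<Longrightarrow> height (simple_root n j) = 1"
  by (simp add: simple_root_vec height_diff)

lemma linear_simple_refl: "linear_map (simple_refl n j)"
proof -
  have "copair n (x + y) z = copair n x z + copair n y z"
    "copair n (smul c x) z = c * copair n x z" for x y z c
    by (simp_all add: copair_def form_simps form_smul_left distrib_left add_divide_distrib)
  then show ?thesis
    unfolding linear_map_def simple_refl_eq
    by (auto simp: prod_eq_iff fun_eq_iff scale_def smul_def algebra_simps)
qed

lemma simple_refl_coordinate:
  assumes "j \<le> n" "i \<in> {1..n}"
  shows "simple_refl n j (eps i, 0) =
    (if j = 0 then if i = 1 then (- eps 1, 2) else (eps i, 0)
     else if j < n then if i = j then (eps (j + 1), 0) else if i = j + 1 then (eps j, 0) else (eps i, 0)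
     else if i = n then (- eps n, 0) else (eps i, 0))"
  unfolding simple_refl_eq using copair_simple[OF assms(1)] assms
  by (auto simp: simple_root_def eps_apply prod_eq_iff fun_eq_iff scale_def smul_def)

lemma lattice_map_simple_refl:
  assumes "j \<le> n"
  shows "lattice_map (simple_refl n j)"
proof (rule lattice_mapI)
  show "linear_map (simple_refl n j)" by (rule linear_simple_refl)
  show "simple_refl n j a = a" if "\<And>i. i \<in> {1..n} \<Longrightarrow> fst a i = 0" for a
  proof -
    have "copair n (fst a) (fst (simple_root n j)) = 0"
      using assms that rank unfolding copair_simple[OF assms] by auto
    then show ?thesis by (simp add: simple_refl_eq prod_eq_iff fun_eq_iff)
  qed
  fix i assume i: "i \<in> {1..n}"
  have *: "\<exists>y. (eps k, 0) = vec y" "\<exists>y. (- eps k, 0) = vec y" "\<exists>y. (- eps k, 2) = vec y"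
    if "k \<in> {1..n}" for k
  proof -
    show "\<exists>y. (eps k, 0) = vec y" using vec_coordinate[OF that] by metis
    show "\<exists>y. (- eps k, 0) = vec y"
      using vec_coordinate[OF that] vec_minus[of "N - int k"] by (intro exI[of _ "- (N - int k)"]) simp
    show "\<exists>y. (- eps k, 2) = vec y"
      using vec_coordinate[OF that] vec_minus[of "N - int k"] vec_period[of "- (N - int k)" 1]
      by (intro exI[of _ "- (N - int k) + 2 * N * 1"]) simp
  qed
  show "\<exists>y. simple_refl n j (eps i, 0) = vec y"
    unfolding simple_refl_coordinate[OF assms i]
    using *[of i] *[of j] *[of "j + 1"] *[of n] *[of 1] assms rank i
    by (auto split: if_splits)
qed

lemma copair_simple_self: "j \<le> n \<Longrightarrow> copair n (fst (simple_root n j)) (fst (simple_root n j)) = 2"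
  using rank by (auto simp: copair_simple) (auto simp: simple_root_def eps_apply)

lemma copair_simple_distinct:
  "i \<le> n \<Longrightarrow> j \<le> n \<Longrightarrow> i \<noteq> j \<Longrightarrow> copair n (fst (simple_root n i)) (fst (simple_root n j)) \<le> 0"
  using rank by (auto simp: copair_simple) (auto simp: simple_root_def eps_apply)

lemma simple_root_inject: "i \<le> n \<Longrightarrow> j \<le> n \<Longrightarrow> simple_root n i = simple_root n j \<longleftrightarrow> i = j"
  using copair_simple_distinct[of i j] copair_simple_self[of j] by fastforce

lemma simple_refl_root: "j \<le> n \<Longrightarrow> simple_refl n j (simple_root n j) = - simple_root n j"
  by (auto simp: simple_refl_eq copair_simple_self prod_eq_iff fun_eq_iff)

lemma simple_refl_involution:
  assumes "j \<le> n" shows "simple_refl n j \<circ> simple_refl n j = id"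
proof
  fix a
  have "simple_refl n j (simple_refl n j a) = simple_refl n j a -
    scale (copair n (fst a) (fst (simple_root n j))) (simple_refl n j (simple_root n j))"
    by (subst (2) simple_refl_eq) (simp add: linear_map_diff linear_map_scale linear_simple_refl)
  then show "(simple_refl n j \<circ> simple_refl n j) a = id a"
    by (simp add: simple_refl_root[OF assms])
      (simp add: simple_refl_eq prod_eq_iff fun_eq_iff)
qed

lemma height_simple_refl:
  "j \<le> n \<Longrightarrow> height (simple_refl n j a) = height a - copair n (fst a) (fst (simple_root n j))"
  by (simp add: simple_refl_eq height_diff height_scale height_simple_root)

text \<open>
  Modulo the period and the reflection in \<open>0\<close>, the smaller of two adjacent points may be taken in
  \<open>{0..n}\<close>, where \<open>simple_root_vec\<close> applies.
\<close>

lemma consecutive_simple: "\<exists>j\<le>n. vec (x + 1) - vec x = simple_root n j"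
proof -
  define r where "r = x mod (2 * N)"
  define a where "a = x div (2 * N)"
  have x: "x = r + 2 * N * a" unfolding r_def a_def by simp
  have r: "0 \<le> r" "r < 2 * N" unfolding r_def by (auto simp: pos_mod_bound)
  show ?thesis
  proof (cases "r \<le> int n")
    case True
    have "x + 1 = (r + 1) + 2 * N * a" using x by simp
    then have "vec (x + 1) - vec x = vec (r + 1) - vec r"
      by (simp only: x vec_period) simp
    also have "\<dots> = simple_root n (nat (int n - r))"
      using True r by (subst simple_root_vec) auto
    finally show ?thesis using True r by (intro exI[of _ "nat (int n - r)"]) auto
  next
    case False
    define d where "d = 2 * N - r - 1"
    have "x + 1 = - d + 2 * N * (a + 1)" "x = - (d + 1) + 2 * N * (a + 1)"
      using x by (simp_all add: d_def algebra_simps)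
    then have "vec (x + 1) - vec x = vec (d + 1) - vec d"
      by (simp only: vec_minus vec_period) simp
    also have "\<dots> = simple_root n (nat (int n - d))"
      using False r by (subst simple_root_vec) (auto simp: d_def)
    finally show ?thesis using False r by (intro exI[of _ "nat (int n - d)"]) (auto simp: d_def)
  qed
qed

lemma root_height_one:
  assumes "a \<in> aff_roots" "height a = 1"
  obtains j where "j \<le> n" "a = simple_root n j"
proof -
  obtain x y where a: "a = vec x - vec y" using aff_rootsE[OF assms(1)] by metis
  with assms(2) have "x = y + 1" by (simp add: height_diff)
  with a consecutive_simple[of y] that show thesis by blast
qed

lemma root_pair_consecutive:
  assumes "0 \<le> x" "x \<le> int n" shows "root_pair (x + 1) x"
proof -
  have "\<not> (N dvd x + 1 \<and> N dvd x)"
  proof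
    assume "N dvd x + 1 \<and> N dvd x"
    then have "N dvd (x + 1) - x" using dvd_diff by blast
    then show False using rank by simp
  qed
  moreover have "\<not> 2 * N dvd (x + 1) - x" "\<not> 2 * N dvd (x + 1) + x"
    using not_dvd_between[of "(x + 1) - x" "2 * N"] not_dvd_between[of "(x + 1) + x" "2 * N"] assms by auto
  ultimately show ?thesis unfolding root_pair_def by blast
qed

lemma simple_root_in_aff_roots: "j \<le> n \<Longrightarrow> simple_root n j \<in> aff_roots"
  unfolding aff_roots_def simple_root_vec using root_pair_consecutive[of "int n - int j"] by auto

text \<open>
  Bounds the values \<open>(\<beta>, \<alpha>\<^sub>j\<^sup>\<or>)\<close> by \<open>2\<close>, so that a simple reflection lowers the height of a root by
  at most \<open>2\<close>.
\<close>

lemma root_coordinate_bound: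
  assumes "a \<in> aff_roots" shows "\<bar>fst a i\<bar> \<le> 1"
proof -
  have "\<bar>\<alpha> i\<bar> \<le> 1" if "\<alpha> \<in> pos_roots n" for \<alpha>
    using that unfolding pos_roots_def by (auto simp: eps_apply)
  then show ?thesis
    using pair_as_pos_root aff_rootsE[OF assms] by (smt (verit) abs_minus_cancel fst_conv fst_uminus uminus_apply)
qed

lemma copair_root_le: "a \<in> aff_roots \<Longrightarrow> j \<le> n \<Longrightarrow> copair n (fst a) (fst (simple_root n j)) \<le> 2"
  using root_coordinate_bound[of a 1] root_coordinate_bound[of a j]
    root_coordinate_bound[of a "j + 1"] root_coordinate_bound[of a n]
  by (auto simp: copair_simple)

section \<open>Inversions and descents\<close>

abbreviation winv :: "(affvec \<Rightarrow> affvec) \<Rightarrow> affvec \<Rightarrow> affvec" where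
  "winv \<equiv> inv_into UNIV"

text \<open>
  The invertible maps of this kind. This intrinsic description of the affine Weyl group makes
  membership of an explicitly given map easy to check; that it is generated by the simple
  reflections is the equality \<open>parabolic n {0..n} = lattice_group\<close> below.
\<close>

definition lattice_group :: "(affvec \<Rightarrow> affvec) set" where
  "lattice_group = {w. lattice_map w \<and> (\<exists>w'. lattice_map w' \<and> w \<circ> w' = id \<and> w' \<circ> w = id)}"

lemma lattice_group_map: "w \<in> lattice_group \<Longrightarrow> lattice_map w"
  by (simp add: lattice_group_def)

lemma lattice_group_linear: "w \<in> lattice_group \<Longrightarrow> linear_map w"
  by (simp add: lattice_group_map lattice_map_linear)

lemma lattice_group_id: "id \<in> lattice_group"
  unfolding lattice_group_def using lattice_map_id by (auto intro!: exI[of _ id])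

lemma lattice_group_comp:
  assumes "v \<in> lattice_group" "w \<in> lattice_group" shows "v \<circ> w \<in> lattice_group"
proof -
  obtain v' w' where *: "lattice_map v'" "v \<circ> v' = id" "v' \<circ> v = id"
    "lattice_map w'" "w \<circ> w' = id" "w' \<circ> w = id"
    using assms unfolding lattice_group_def by blast
  then have "(v \<circ> w) \<circ> (w' \<circ> v') = id" "(w' \<circ> v') \<circ> (v \<circ> w) = id"
    by (metis comp_assoc comp_id)+
  with * assms show ?thesis unfolding lattice_group_def using lattice_map_comp by blast
qed

lemma lattice_group_bij: "w \<in> lattice_group \<Longrightarrow> bij w"
  unfolding lattice_group_def using o_bij by blast

lemma lattice_group_inv: "w \<in> lattice_group \<Longrightarrow> winv w \<in> lattice_group"
proof -
  assume w: "w \<in> lattice_group"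
  then obtain w' where *: "lattice_map w'" "w \<circ> w' = id" "w' \<circ> w = id"
    unfolding lattice_group_def by blast
  then have "winv w = w'" using inv_unique_comp by blast
  with * w show ?thesis unfolding lattice_group_def by blast
qed

lemma lattice_group_inv_comp: "w \<in> lattice_group \<Longrightarrow> w \<circ> winv w = id" "w \<in> lattice_group \<Longrightarrow> winv w \<circ> w = id"
  by (simp_all add: surj_iff[symmetric] bij_is_surj bij_is_inj lattice_group_bij)

lemma lattice_group_involution: "lattice_map w \<Longrightarrow> w \<circ> w = id \<Longrightarrow> w \<in> lattice_group"
  unfolding lattice_group_def by blast

lemma simple_refl_in_lattice_group: "j \<le> n \<Longrightarrow> simple_refl n j \<in> lattice_group"
  by (simp add: lattice_group_involution lattice_map_simple_refl simple_refl_involution)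

lemma perm_inv:
  assumes "w \<in> lattice_group"
  shows "perm (winv w) (perm w x) = x" "perm w (perm (winv w) x) = x"
  using perm_comp[of "winv w" w x] perm_comp[of w "winv w" x] assms
    lattice_group_inv lattice_group_map lattice_group_inv_comp by auto

text \<open>
  Congruences modulo the period are respected, hence so is the condition for a pair of points to
  define a root.
\<close>

lemma perm_dvd:
  assumes "lattice_map w"
  shows "N dvd x \<Longrightarrow> N dvd perm w x" "2 * N dvd x - y \<Longrightarrow> 2 * N dvd perm w x - perm w y"
    "2 * N dvd x + y \<Longrightarrow> 2 * N dvd perm w x + perm w y"
proof -
  show "N dvd x \<Longrightarrow> N dvd perm w x" using perm_wall[OF assms] unfolding dvd_def by metis
  have *: "2 * N dvd x - y \<Longrightarrow> 2 * N dvd perm w x - perm w y" for x y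
  proof -
    assume "2 * N dvd x - y"
    then obtain k where "x = y + 2 * N * k" by (metis dvd_def diff_add_cancel add.commute)
    then have "perm w x = perm w y + 2 * N * k" by (simp only: perm_period[OF assms])
    then show ?thesis by simp
  qed
  then show "2 * N dvd x - y \<Longrightarrow> 2 * N dvd perm w x - perm w y" .
  show "2 * N dvd x + y \<Longrightarrow> 2 * N dvd perm w x + perm w y"
    using *[of x "- y"] by (simp add: perm_minus[OF assms])
qed

lemma root_pair_perm:
  assumes "w \<in> lattice_group" "root_pair x y"
  shows "root_pair (perm w x) (perm w y)"
  using perm_dvd[OF lattice_group_map[OF lattice_group_inv[OF assms(1)]]] assms(2)
    perm_inv(1)[OF assms(1)] unfolding root_pair_def by metis

lemma apply_vec_diff: "w \<in> lattice_group \<Longrightarrow> w (vec x - vec y) = vec (perm w x) - vec (perm w y)"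
  by (simp add: linear_map_diff lattice_group_linear apply_vec lattice_group_map)

lemma lattice_group_roots: "w \<in> lattice_group \<Longrightarrow> a \<in> aff_roots \<Longrightarrow> w a \<in> aff_roots"
  unfolding aff_roots_def using root_pair_perm apply_vec_diff by blast

lemma lambda_set_iff:
  "w \<in> lattice_group \<Longrightarrow> a \<in> lambda_set n w \<longleftrightarrow> a \<in> aff_roots \<and> 0 < height a \<and> height (w a) < 0"
  unfolding lambda_set_def vimage_def Int_iff mem_Collect_eq aff_pos_roots_iff neg_aff_pos_roots_iff
  using lattice_group_roots by blast

text \<open>
  A simple reflection permutes the positive roots other than its own: if the height of \<open>a\<close> became
  negative, it would have to drop from \<open>1\<close> by \<open>2\<close>; but a root of height \<open>1\<close> is simple, and reflecting
  it in a different simple root does not lower its height.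
\<close>

lemma simple_refl_positive:
  assumes "j \<le> n" "a \<in> aff_roots" "0 < height a" "a \<noteq> simple_root n j"
  shows "0 < height (simple_refl n j a)"
proof (rule ccontr)
  assume neg: "\<not> 0 < height (simple_refl n j a)"
  have "simple_refl n j a \<in> aff_roots"
    using assms lattice_group_roots simple_refl_in_lattice_group by blast
  then obtain k where k: "height (simple_refl n j a) = of_int k" "k \<noteq> 0" by (rule height_root)
  obtain m where m: "height a = of_int m" "m \<noteq> 0" by (rule height_root[OF assms(2)])
  have "copair n (fst a) (fst (simple_root n j)) = of_int (m - k)"
    using height_simple_refl[OF assms(1), of a] k m by simp
  moreover have "copair n (fst a) (fst (simple_root n j)) \<le> 2" using assms copair_root_le by blast
  ultimately have "m - k \<le> 2" by linarith
  with k m neg assms(3) have "m = 1" "m - k = 2" by auto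
  then obtain i where i: "i \<le> n" "a = simple_root n i" using root_height_one[OF assms(2)] m by (metis of_int_1)
  with assms(4) have "i \<noteq> j" by blast
  with i copair_simple_distinct assms(1) have "copair n (fst a) (fst (simple_root n j)) \<le> 0" by blast
  with \<open>copair n (fst a) (fst (simple_root n j)) = of_int (m - k)\<close> \<open>m - k = 2\<close> show False by simp
qed

lemma simple_refl_cancel: "j \<le> n \<Longrightarrow> simple_refl n j (simple_refl n j a) = a"
  using simple_refl_involution by (metis comp_apply id_apply)

lemma lambda_comp_simple_refl:
  assumes "j \<le> n" "w \<in> lattice_group"
  shows "lambda_set n (w \<circ> simple_refl n j) - {simple_root n j} =
    simple_refl n j ` (lambda_set n w - {simple_root n j})"
proof -
  have main: "simple_refl n j a \<in> lambda_set n w - {simple_root n j}"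
    if a: "a \<in> lambda_set n (w \<circ> simple_refl n j) - {simple_root n j}" and w: "w \<in> lattice_group" for a w
  proof -
    have ws: "w \<circ> simple_refl n j \<in> lattice_group"
      using w assms(1) lattice_group_comp simple_refl_in_lattice_group by blast
    have "a \<in> aff_roots" "0 < height a" "height (w (simple_refl n j a)) < 0" "a \<noteq> simple_root n j"
      using a lambda_set_iff[OF ws] by auto
    then have "simple_refl n j a \<in> lambda_set n w"
      using lambda_set_iff[OF w] simple_refl_positive[OF assms(1)] lattice_group_roots
        simple_refl_in_lattice_group[OF assms(1)] by blast
    moreover have "simple_refl n j a \<noteq> simple_root n j"
    proof
      assume "simple_refl n j a = simple_root n j"
      then have "a = - simple_root n j"
        using simple_refl_cancel[OF assms(1), of a] simple_refl_root[OF assms(1)] by simp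
      then show False using \<open>0 < height a\<close> height_simple_root[OF assms(1)] by (simp add: height_minus)
    qed
    ultimately show ?thesis by blast
  qed
  have ws: "w \<circ> simple_refl n j \<in> lattice_group"
    using assms lattice_group_comp simple_refl_in_lattice_group by blast
  have eq: "(w \<circ> simple_refl n j) \<circ> simple_refl n j = w"
    using simple_refl_involution[OF assms(1)] by (metis comp_assoc comp_id)
  show ?thesis
  proof (intro Set.equalityI subsetI)
    fix a assume "a \<in> lambda_set n (w \<circ> simple_refl n j) - {simple_root n j}"
    from main[OF this assms(2)] show "a \<in> simple_refl n j ` (lambda_set n w - {simple_root n j})"
      using simple_refl_cancel[OF assms(1), of a] by (metis image_eqI)
  next
    fix a assume "a \<in> simple_refl n j ` (lambda_set n w - {simple_root n j})"
    then obtain b where b: "b \<in> lambda_set n w - {simple_root n j}" "a = simple_refl n j b" by blast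
    with main[of b "w \<circ> simple_refl n j"] ws eq
    show "a \<in> lambda_set n (w \<circ> simple_refl n j) - {simple_root n j}" by simp
  qed
qed

definition descent :: "(affvec \<Rightarrow> affvec) \<Rightarrow> nat \<Rightarrow> bool" where
  "descent w j \<longleftrightarrow> height (w (simple_root n j)) < 0"

lemma descent_iff_lambda: "w \<in> lattice_group \<Longrightarrow> j \<le> n \<Longrightarrow> simple_root n j \<in> lambda_set n w \<longleftrightarrow> descent w j"
  unfolding descent_def by (simp add: lambda_set_iff simple_root_in_aff_roots height_simple_root)

lemma descent_comp_simple_refl:
  assumes "w \<in> lattice_group" "j \<le> n"
  shows "descent (w \<circ> simple_refl n j) j \<longleftrightarrow> \<not> descent w j"
proof -
  have "w (simple_root n j) \<in> aff_roots"
    using assms lattice_group_roots simple_root_in_aff_roots by blast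
  then obtain m where "height (w (simple_root n j)) = of_int m" "m \<noteq> 0" by (rule height_root)
  then show ?thesis unfolding descent_def
    by (auto simp: simple_refl_root assms linear_map_minus lattice_group_linear height_minus)
qed

text \<open>
  A periodic displacement is bounded, so an inverted pair of points cannot be far apart; modulo the
  period there are finitely many such pairs.
\<close>

lemma finite_lambda_set:
  assumes w: "w \<in> lattice_group" shows "finite (lambda_set n w)"
proof -
  let ?f = "perm w"
  define m where "m = Min (?f ` {0..<2*N})"
  define D where "D = Max ((\<lambda>x. ?f x - x) ` {0..<2*N})"
  have m: "m \<le> ?f x" and D0: "?f x - x \<le> D" if "0 \<le> x" "x < 2 * N" for x
    unfolding m_def D_def using that by (auto intro!: Min_le Max_ge)
  have D: "?f y - y \<le> D" for y
  proof -
    define r c where "r = y mod (2*N)" and "c = y div (2*N)"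
    have y: "y = r + 2*N*c" unfolding r_def c_def by simp
    have "?f y - y = ?f r - r" unfolding y perm_period[OF lattice_group_map[OF w]] by simp
    then show ?thesis using D0[of r] unfolding r_def by (simp add: pos_mod_bound)
  qed
  have "lambda_set n w \<subseteq> (\<lambda>(x, y). vec x - vec y) ` ({0..<2*N} \<times> {m - D..2*N})"
  proof
    fix a assume a: "a \<in> lambda_set n w"
    then obtain x y where xy: "a = vec x - vec y" using lambda_set_iff[OF w] aff_rootsE by metis
    (* Shift the pair by whole periods so that its first point lies in the first period. *)
    define c where "c = x div (2*N)"
    define x' y' where "x' = x - 2*N*c" and "y' = y - 2*N*c"
    have "x = x' + 2*N*c" "y = y' + 2*N*c" by (simp_all add: x'_def y'_def)
    then have a': "a = vec x' - vec y'" unfolding xy by (simp only: vec_period) simp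
    have x': "0 \<le> x'" "x' < 2*N" unfolding x'_def c_def
      by (simp_all add: minus_mult_div_eq_mod pos_mod_bound)
    have "height a > 0" "height (w a) < 0" using a lambda_set_iff[OF w] by auto
    then have "y' < x'" "?f x' < ?f y'"
      unfolding a' apply_vec_diff[OF w] by (simp_all add: height_diff)
    with x' m[of x'] D[of y'] have "y' \<in> {m - D..2*N}" by auto
    with x' a' show "a \<in> (\<lambda>(x, y). vec x - vec y) ` ({0..<2*N} \<times> {m - D..2*N})" by force
  qed
  then show ?thesis by (rule finite_subset) auto
qed

lemma card_lambda_comp:
  assumes "w \<in> lattice_group" "j \<le> n"
  shows "descent w j \<Longrightarrow> Suc (card (lambda_set n (w \<circ> simple_refl n j))) = card (lambda_set n w)"
    and "\<not> descent w j \<Longrightarrow> card (lambda_set n (w \<circ> simple_refl n j)) = Suc (card (lambda_set n w))"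
proof -
  have ws: "w \<circ> simple_refl n j \<in> lattice_group"
    using assms lattice_group_comp simple_refl_in_lattice_group by blast
  note fin = finite_lambda_set[OF assms(1)] finite_lambda_set[OF ws]
  have inj: "inj_on (simple_refl n j) X" for X
    using simple_refl_cancel[OF assms(2)] by (metis inj_onI)
  have card: "card (lambda_set n (w \<circ> simple_refl n j) - {simple_root n j}) =
    card (lambda_set n w - {simple_root n j})"
    unfolding lambda_comp_simple_refl[OF assms(2,1)] by (rule card_image[OF inj])
  note mem = descent_iff_lambda[OF assms] descent_iff_lambda[OF ws assms(2)]
    descent_comp_simple_refl[OF assms]
  show "Suc (card (lambda_set n (w \<circ> simple_refl n j))) = card (lambda_set n w)" if "descent w j"
    using card mem that fin by (metis card_Suc_Diff1 Diff_empty Diff_insert0)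
  show "card (lambda_set n (w \<circ> simple_refl n j)) = Suc (card (lambda_set n w))" if "\<not> descent w j"
    using card mem that fin by (metis card_Suc_Diff1 Diff_empty Diff_insert0)
qed

lemma perm_increasing:
  assumes w: "w \<in> lattice_group" and "\<And>j. j \<le> n \<Longrightarrow> \<not> descent w j"
  shows "perm w x < perm w (x + 1)"
proof -
  obtain j where j: "j \<le> n" "vec (x + 1) - vec x = simple_root n j" using consecutive_simple by blast
  have "w (simple_root n j) \<in> aff_roots"
    using j lattice_group_roots[OF w] simple_root_in_aff_roots by blast
  then obtain m where m: "height (w (simple_root n j)) = of_int m" "m \<noteq> 0" by (rule height_root)
  with assms(2)[OF j(1)] have "height (w (simple_root n j)) > 0" unfolding descent_def by simp
  then show ?thesis unfolding j(2)[symmetric] apply_vec_diff[OF w] by (simp add: height_diff)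
qed

text \<open>
  Without descents the permutation increases along the whole line; since it fixes the two mirrors
  \<open>0\<close> and \<open>N\<close>, nothing between them can move.
\<close>

lemma no_descent_imp_id:
  assumes w: "w \<in> lattice_group" and "\<And>j. j \<le> n \<Longrightarrow> \<not> descent w j"
  shows "w = id"
proof (rule lattice_map_eqI)
  have step: "perm w x + int k \<le> perm w (x + int k)" for x k
  proof (induction k)
    case (Suc k)
    then show ?case using perm_increasing[OF assms, of "x + int k"] by (simp add: algebra_simps)
  qed simp
  fix x assume "1 \<le> x" "x \<le> int n"
  then show "perm w x = perm id x"
    using step[of 0 "nat x"] step[of x "nat (N - x)"] perm_zero perm_N lattice_group_map[OF w] by simp
qed (use w lattice_group_map lattice_map_id in auto)


section \<open>Words and parabolic subgroups\<close>

lemma word_in_lattice_group: "set is \<subseteq> {0..n} \<Longrightarrow> word n is \<in> lattice_group"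
  by (induction "is") (auto simp: lattice_group_id lattice_group_comp simple_refl_in_lattice_group)

lemma word_append: "word n (xs @ ys) = word n ys \<circ> word n xs"
  by (induction xs) (auto simp: comp_assoc)

lemma word_rev_comp: "set is \<subseteq> {0..n} \<Longrightarrow> word n (rev is) \<circ> word n is = id"
proof (induction "is")
  case (Cons i "is")
  then have "word n (rev (i # is)) \<circ> word n (i # is) =
      simple_refl n i \<circ> (word n (rev is) \<circ> word n is) \<circ> simple_refl n i"
    by (simp add: word_append comp_assoc)
  with Cons show ?case by (simp only: list.set insert_subset comp_id simple_refl_involution atLeastAtMost_iff)
qed simp

lemma word_rev: "set is \<subseteq> {0..n} \<Longrightarrow> word n (rev is) = winv (word n is)"
  using word_rev_comp[of "is"] word_rev_comp[of "rev is"] by (simp add: inv_unique_comp)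

lemma lambda_set_id: "lambda_set n id = {}"
  using lambda_set_iff[OF lattice_group_id] by auto

lemma card_lambda_word_le: "set is \<subseteq> {0..n} \<Longrightarrow> card (lambda_set n (word n is)) \<le> length is"
proof (induction "is")
  case Nil
  then show ?case by (simp only: word.simps lambda_set_id card.empty)
next
  case (Cons i "is")
  then have "card (lambda_set n (word n is \<circ> simple_refl n i)) \<le> Suc (card (lambda_set n (word n is)))"
    using card_lambda_comp[OF word_in_lattice_group, of "is" i] by (cases "descent (word n is) i") (auto simp del: comp_def)
  moreover have "card (lambda_set n (word n is)) \<le> length is" using Cons by simp
  ultimately show ?case by (simp only: word.simps list.size)
qed

text \<open>
  On roots this is the sum of the coefficients of the simple roots with index outside \<open>J\<close>. It is a
  functional that vanishes on \<open>\<alpha>\<^sub>j\<close> for \<open>j \<in> J\<close> and is \<open>1\<close> on the other simple roots. For a proper subset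
  \<open>J\<close> it is, up to scaling, a point of the face of the fundamental alcove fixed by the parabolic
  subgroup of \<open>J\<close>.
\<close>

definition face :: "nat set \<Rightarrow> affvec \<Rightarrow> real" where
  "face J a = real (card ({0..n} - J)) * snd a + (\<Sum>i=1..n. real (card ({i..n} - J)) * fst a i)"

lemma linear_face: "linear_form (face J)"
  unfolding linear_form_def face_def
  by (simp add: distrib_left sum.distrib sum_distrib_left mult.left_commute)

lemmas face_add = linear_form_add[OF linear_face]
  and face_scale = linear_form_scale[OF linear_face]
  and face_minus = linear_form_minus[OF linear_face]
  and face_diff = linear_form_diff[OF linear_face]

lemma face_eps: "i \<in> {1..n} \<Longrightarrow> face J (eps i, 0) = real (card ({i..n} - J))"
  unfolding face_def by (simp add: eps_apply if_distrib cong: if_cong)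

lemma face_const: "face J (0, c) = real (card ({0..n} - J)) * c"
  unfolding face_def by simp

lemma card_upper_diff:
  "i \<le> n \<Longrightarrow> card ({i..n} - J) = of_bool (i \<notin> J) + card ({Suc i..n} - J)"
proof -
  assume "i \<le> n"
  then have "{i..n} = insert i {Suc i..n}" by auto
  then show ?thesis by (cases "i \<in> J") (auto simp: insert_Diff_if)
qed

lemma face_simple_root: "j \<le> n \<Longrightarrow> face J (simple_root n j) = of_bool (j \<notin> J)"
proof -
  assume j: "j \<le> n"
  consider "j = 0" | "0 < j" "j < n" | "j = n" using j by linarith
  then show ?thesis
  proof cases
    case 1
    have "simple_root n j = (0, 1) - (eps 1, 0)" using 1 by (simp add: simple_root_def)
    then show ?thesis using card_upper_diff[of 0 J] rank 1
      by (simp only: face_diff face_const) (simp add: face_eps)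
  next
    case 2
    have "simple_root n j = (eps j, 0) - (eps (Suc j), 0)" using 2 by (simp add: simple_root_def)
    then show ?thesis using card_upper_diff[of j J] 2
      by (simp only: face_diff) (simp add: face_eps)
  next
    case 3
    have "simple_root n j = (eps n, 0)" using 3 rank by (simp add: simple_root_def)
    then show ?thesis using card_upper_diff[of n J] rank 3 by (simp add: face_eps)
  qed
qed

lemma face_step: "face J (vec x) \<le> face J (vec (x + 1))"
proof -
  obtain j where "j \<le> n" "vec (x + 1) - vec x = simple_root n j" using consecutive_simple by blast
  then have "face J (vec (x + 1) - vec x) \<ge> 0" by (simp add: face_simple_root)
  then show ?thesis by (simp add: face_diff)
qed

lemma face_mono: "x \<le> y \<Longrightarrow> face J (vec x) \<le> face J (vec y)"
proof (induction y rule: int_ge_induct)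
  case (step y)
  then show ?case using face_step[of J y] by simp
qed simp

lemma face_positive_root:
  assumes "a \<in> aff_roots" "0 < height a" shows "0 \<le> face J a"
proof -
  obtain x y where a: "a = vec x - vec y" using aff_rootsE[OF assms(1)] by metis
  with assms(2) have "y \<le> x" by (simp add: height_diff)
  then show ?thesis unfolding a face_diff using face_mono by simp
qed

lemma face_simple_refl: "j \<in> J \<Longrightarrow> j \<le> n \<Longrightarrow> face J (simple_refl n j a) = face J a"
  by (simp add: simple_refl_eq face_diff face_scale face_simple_root)

lemma face_word: "J \<subseteq> {0..n} \<Longrightarrow> set is \<subseteq> J \<Longrightarrow> face J (word n is a) = face J a"
  by (induction "is" arbitrary: a) (auto simp: face_simple_refl subset_iff)

text \<open>
  The value at an inversion is nonnegative before and nonpositive after applying the element, and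
  the element preserves it.
\<close>

lemma lambda_set_face:
  assumes "w \<in> lattice_group" "\<And>a. face J (w a) = face J a" "a \<in> lambda_set n w"
  shows "face J a = 0"
proof -
  have a: "a \<in> aff_roots" "0 < height a" "height (w a) < 0" using assms lambda_set_iff by blast+
  then have "face J a \<ge> 0" by (simp add: face_positive_root)
  moreover have "- w a \<in> aff_roots" "0 < height (- w a)"
    using a lattice_group_roots[OF assms(1)] by (auto simp: uminus_aff_roots height_minus)
  then have "face J (- w a) \<ge> 0" by (rule face_positive_root)
  ultimately show ?thesis using assms(2) by (simp add: face_minus)
qed

text \<open>
  Undoing one descent after the other reaches the identity. Each descent root lies on the face, so
  its index belongs to \<open>J\<close>, and each step uses up one inversion.
\<close>

lemma parabolic_word_exists:
  assumes "J \<subseteq> {0..n}" "w \<in> lattice_group" "\<And>a. a \<in> lambda_set n w \<Longrightarrow> face J a = 0"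
  shows "\<exists>is. set is \<subseteq> J \<and> word n is = w \<and> length is = card (lambda_set n w)"
  using assms(2,3)
proof (induction "card (lambda_set n w)" arbitrary: w)
  case 0
  then have "lambda_set n w = {}" using finite_lambda_set by simp
  then have "w = id" using no_descent_imp_id[OF 0(2)] descent_iff_lambda[OF 0(2)] by blast
  then show ?case using 0 by (intro exI[of _ "[]"]) simp
next
  case (Suc l)
  have "w \<noteq> id" using Suc.hyps(2) lambda_set_id by auto
  then obtain j where j: "j \<le> n" "descent w j" using no_descent_imp_id[OF Suc.prems(1)] by blast
  then have "face J (simple_root n j) = 0" using Suc.prems descent_iff_lambda by blast
  then have jJ: "j \<in> J" using j by (simp add: face_simple_root split: if_splits)
  let ?v = "w \<circ> simple_refl n j"
  have v: "?v \<in> lattice_group"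
    using Suc.prems(1) j(1) lattice_group_comp simple_refl_in_lattice_group by blast
  have card: "Suc (card (lambda_set n ?v)) = card (lambda_set n w)"
    using card_lambda_comp(1)[OF Suc.prems(1) j] .
  have "face J a = 0" if "a \<in> lambda_set n ?v" for a
  proof -
    have "a \<noteq> simple_root n j"
      using that j descent_iff_lambda[OF v] descent_comp_simple_refl[OF Suc.prems(1)] by blast
    with that have "a \<in> simple_refl n j ` (lambda_set n w - {simple_root n j})"
      unfolding lambda_comp_simple_refl[OF j(1) Suc.prems(1), symmetric] by simp
    then obtain b where "b \<in> lambda_set n w" "a = simple_refl n j b" by blast
    then show ?thesis using Suc.prems(2) face_simple_refl[OF jJ j(1)] by simp
  qed
  then obtain "is" where "is": "set is \<subseteq> J" "word n is = ?v" "length is = card (lambda_set n ?v)"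
    using Suc.hyps(1)[of ?v] Suc.hyps(2) card v by fastforce
  have "word n (j # is) = w \<circ> (simple_refl n j \<circ> simple_refl n j)" by (simp add: "is"(2) comp_assoc)
  also have "\<dots> = w" by (simp add: simple_refl_involution j)
  finally show ?case using "is" jJ card by (intro exI[of _ "j # is"]) simp
qed

text \<open>
  The generators are involutions, so inverses add nothing to the words.
\<close>

lemma parabolic_eq_words:
  assumes "J \<subseteq> {0..n}" shows "parabolic n J = {word n is | is. set is \<subseteq> J}"
proof (intro Set.equalityI subsetI)
  have bij: "simple_refl n j \<in> Bij UNIV" if "j \<in> J" for j
    using that assms lattice_group_bij[OF simple_refl_in_lattice_group, of j]
    by (auto simp: Bij_def)
  have wbij: "word n is \<in> Bij UNIV" if "set is \<subseteq> J" for "is"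
    using that assms lattice_group_bij[OF word_in_lattice_group, of "is"] by (auto simp: Bij_def)
  have mult: "f \<otimes>\<^bsub>BijGroup UNIV\<^esub> g = f \<circ> g" if "f \<in> Bij UNIV" "g \<in> Bij UNIV"
    for f g :: "affvec \<Rightarrow> affvec"
    using that by (auto simp: BijGroup_def compose_def)
  fix w
  {
    assume "w \<in> parabolic n J"
    then have "w \<in> generate (BijGroup UNIV) (simple_refl n ` J)" by (simp add: parabolic_def)
    then show "w \<in> {word n is | is. set is \<subseteq> J}"
    proof induction
      case one
      have "word n [] = \<one>\<^bsub>BijGroup UNIV\<^esub>" by (auto simp: BijGroup_def)
      then show ?case by (metis (mono_tags, lifting) empty_set empty_subsetI mem_Collect_eq)
    next
      case (incl h)
      then obtain j where "j \<in> J" "h = word n [j]" by auto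
      then show ?case by (metis (mono_tags, lifting) empty_set list.simps(15) empty_subsetI insert_subset mem_Collect_eq)
    next
      case (inv h)
      then obtain j where j: "j \<in> J" "h = simple_refl n j" by auto
      then have "winv h = h" using assms simple_refl_involution by (intro inv_unique_comp) auto
      moreover have "inv\<^bsub>BijGroup UNIV\<^esub> h = winv h"
        using inv_BijGroup[OF bij[OF j(1)]] unfolding j(2) restrict_UNIV by simp
      ultimately have "inv\<^bsub>BijGroup UNIV\<^esub> h = word n [j]" using j by simp
      with j(1) show ?case by (metis (mono_tags, lifting) empty_set list.simps(15) empty_subsetI insert_subset mem_Collect_eq)
    next
      case (eng f g)
      then obtain xs ys where xy: "f = word n xs" "g = word n ys" "set xs \<subseteq> J" "set ys \<subseteq> J" by blast
      then have "f \<otimes>\<^bsub>BijGroup UNIV\<^esub> g = word n (ys @ xs)" by (simp add: mult wbij word_append)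
      with xy show ?case by (intro CollectI exI[of _ "ys @ xs"]) auto
    qed
  next
    assume "w \<in> {word n is | is. set is \<subseteq> J}"
    then obtain "is" where "set is \<subseteq> J" "w = word n is" by blast
    then show "w \<in> parabolic n J"
    proof (induction "is" arbitrary: w)
      case Nil
      then have "w = \<one>\<^bsub>BijGroup UNIV\<^esub>" by (auto simp: BijGroup_def)
      then show ?case unfolding parabolic_def by (simp only: generate.one)
    next
      case (Cons i "is")
      then have "word n is \<in> generate (BijGroup UNIV) (simple_refl n ` J)"
        "simple_refl n i \<in> generate (BijGroup UNIV) (simple_refl n ` J)"
        by (auto simp: parabolic_def intro: generate.incl)
      from generate.eng[OF this]
      have "word n is \<circ> simple_refl n i \<in> generate (BijGroup UNIV) (simple_refl n ` J)"
        using mult[OF wbij bij, of "is" i] Cons.prems by simp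
      then show ?case using Cons.prems(2) by (simp only: parabolic_def word.simps)
    qed
  }
qed

text \<open>
  The inversions of an element that preserves the face functional lie on the face, so the
  element has a word in \<open>J\<close>.
\<close>

lemma parabolic_iff_face:
  assumes "J \<subseteq> {0..n}"
  shows "w \<in> parabolic n J \<longleftrightarrow> w \<in> lattice_group \<and> (\<forall>a. face J (w a) = face J a)"
proof
  assume "w \<in> parabolic n J"
  then show "w \<in> lattice_group \<and> (\<forall>a. face J (w a) = face J a)"
    using parabolic_eq_words[OF assms] face_word[OF assms] word_in_lattice_group assms
    by (auto simp: subset_iff)
next
  assume "w \<in> lattice_group \<and> (\<forall>a. face J (w a) = face J a)"
  then have w: "w \<in> lattice_group" "\<And>a. face J (w a) = face J a" by blast+
  then have "\<exists>is. set is \<subseteq> J \<and> word n is = w \<and> length is = card (lambda_set n w)"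
    using parabolic_word_exists[OF assms w(1) lambda_set_face[OF w]] by blast
  then show "w \<in> parabolic n J" using parabolic_eq_words[OF assms] by blast
qed

lemma face_full: "face {0..n} a = 0"
proof -
  have "{i..n} - {0..n} = {}" for i by auto
  then show ?thesis by (simp only: face_def) simp
qed

lemma parabolic_full: "parabolic n {0..n} = lattice_group"
  using parabolic_iff_face[of "{0..n}"] by (auto simp only: face_full)

text \<open>
  Each letter of a word creates at most one inversion, and \<open>parabolic_word_exists\<close> provides a word in
  \<open>J\<close> that attains the bound; so the length does not depend on the parabolic subgroup in which it
  is measured.
\<close>

lemma cox_length_eq:
  assumes "J \<subseteq> {0..n}" "w \<in> parabolic n J"
  shows "cox_length n J w = card (lambda_set n w)"
  unfolding cox_length_def
proof (rule Least_equality)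
  have w: "w \<in> lattice_group" "\<And>a. face J (w a) = face J a"
    using assms(2) parabolic_iff_face[OF assms(1)] by blast+
  show "\<exists>is. set is \<subseteq> J \<and> word n is = w \<and> length is = card (lambda_set n w)"
    using parabolic_word_exists[OF assms(1) w(1) lambda_set_face[OF w]] .
next
  fix l assume "\<exists>is. set is \<subseteq> J \<and> word n is = w \<and> length is = l"
  then show "card (lambda_set n w) \<le> l" using card_lambda_word_le assms(1) by blast
qed

section \<open>Longest elements\<close>

text \<open>
  If two elements have the same inversions, one times the inverse of the other has no descent.
\<close>

lemma lambda_set_inject:
  assumes "v \<in> lattice_group" "w \<in> lattice_group" "lambda_set n v = lambda_set n w"
  shows "v = w"
proof -
  let ?u = "v \<circ> winv w"
  have u: "?u \<in> lattice_group" using assms lattice_group_comp lattice_group_inv by blast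
  have wi: "w (winv w a) = a" for a using lattice_group_inv_comp(1)[OF assms(2)] by (metis comp_apply id_apply)
  have "\<not> descent ?u j" if j: "j \<le> n" for j
  proof
    assume d: "descent ?u j"
    let ?b = "winv w (simple_root n j)"
    have b: "?b \<in> aff_roots"
      using j lattice_group_roots[OF lattice_group_inv[OF assms(2)]] simple_root_in_aff_roots by blast
    then obtain m where m: "height ?b = of_int m" "m \<noteq> 0" by (rule height_root)
    have vb: "height (v ?b) < 0" using d by (simp add: descent_def)
    show False
    proof (cases "0 < height ?b")
      case True
      then have "?b \<in> lambda_set n w" using b vb assms lambda_set_iff by blast
      then show False using lambda_set_iff[OF assms(2)] wi height_simple_root[OF j] by simp
    next
      case False
      then have "0 < height (- ?b)" "- ?b \<in> aff_roots" "height (w (- ?b)) < 0"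
        using m b wi height_simple_root[OF j]
        by (auto simp: height_minus uminus_aff_roots linear_map_minus lattice_group_linear assms)
      then have "- ?b \<in> lambda_set n v" using assms lambda_set_iff by blast
      then show False using lambda_set_iff[OF assms(1)] vb
        by (simp add: linear_map_minus lattice_group_linear assms height_minus)
    qed
  qed
  then have "?u = id" using no_descent_imp_id[OF u] by blast
  then have "v \<circ> (winv w \<circ> w) = w" by (metis comp_assoc id_comp)
  then show ?thesis by (simp add: lattice_group_inv_comp assms)
qed

text \<open>
  The working criterion for longest elements: an element that stabilizes the face and makes every
  simple root of \<open>J\<close> negative inverts all positive roots on the face. Those contain the inversions
  of any other element of the subgroup.
\<close>

lemma longest_eqI:
  assumes "J \<subseteq> {0..n}" "w \<in> lattice_group" "\<And>a. face J (w a) = face J a"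
    and "\<And>j. j \<in> J \<Longrightarrow> descent w j"
  shows "longest n J = w"
proof -
  have w: "w \<in> parabolic n J" using assms parabolic_iff_face by blast
  have sub: "lambda_set n v \<subseteq> lambda_set n w" if "v \<in> parabolic n J" for v
  proof
    fix a assume a: "a \<in> lambda_set n v"
    have v: "v \<in> lattice_group" "\<And>a. face J (v a) = face J a"
      using that parabolic_iff_face[OF assms(1)] by blast+
    have a': "a \<in> aff_roots" "0 < height a" "face J a = 0"
      using a lambda_set_iff[OF v(1)] lambda_set_face[OF v] by blast+
    obtain x y where xy: "a = vec x - vec y" using aff_rootsE[OF a'(1)] by metis
    then have "y < x" "face J (vec x) = face J (vec y)" using a' by (auto simp: height_diff face_diff)
    (* A root on the face is a sum of simple roots with index in J, one for each unit step from y to x. *)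
    have step: "perm w (z + 1) < perm w z" if "y \<le> z" "z < x" for z
    proof -
      obtain j where j: "j \<le> n" "vec (z + 1) - vec z = simple_root n j" using consecutive_simple by blast
      have "face J (vec y) \<le> face J (vec z)" "face J (vec z) \<le> face J (vec (z + 1))"
        "face J (vec (z + 1)) \<le> face J (vec x)" using that by (auto intro: face_mono)
      then have "face J (simple_root n j) = 0"
        unfolding j(2)[symmetric] face_diff using \<open>face J (vec x) = face J (vec y)\<close> by linarith
      then have "j \<in> J" using j by (simp add: face_simple_root split: if_splits)
      then have "height (w (vec (z + 1) - vec z)) < 0" using assms(4) j unfolding descent_def by metis
      then show ?thesis unfolding apply_vec_diff[OF assms(2)] by (simp add: height_diff)
    qed
    have "z \<le> x \<Longrightarrow> perm w z < perm w y" if "y + 1 \<le> z" for z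
      using that
    proof (induction z rule: int_ge_induct)
      case base
      then show ?case using step[of y] by simp
    next
      case (step z)
      then show ?case using \<open>\<And>z. y \<le> z \<Longrightarrow> z < x \<Longrightarrow> perm w (z + 1) < perm w z\<close>[of z] by simp
    qed
    then have "perm w x < perm w y" using \<open>y < x\<close> by simp
    then have "height (w a) < 0" unfolding xy apply_vec_diff[OF assms(2)] by (simp add: height_diff)
    then show "a \<in> lambda_set n w" using a' lambda_set_iff[OF assms(2)] by blast
  qed
  note fin = finite_lambda_set[OF assms(2)]
  show ?thesis unfolding longest_def
  proof (rule the_equality)
    show "w \<in> parabolic n J \<and> (\<forall>v\<in>parabolic n J. cox_length n J v \<le> cox_length n J w)"
      using w sub cox_length_eq[OF assms(1)] card_mono[OF fin] by simp
  next
    fix v assume v: "v \<in> parabolic n J \<and> (\<forall>u\<in>parabolic n J. cox_length n J u \<le> cox_length n J v)"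
    then have "card (lambda_set n w) \<le> card (lambda_set n v)"
      using w cox_length_eq[OF assms(1)] by metis
    then have "lambda_set n v = lambda_set n w" using sub v card_seteq[OF fin] by blast
    then show "v = w" using lambda_set_inject assms(2) v parabolic_iff_face[OF assms(1)] by blast
  qed
qed

section \<open>Reduced words and the ends of lambda-sequences\<close>

lemma reduced_word_iff:
  assumes "w \<in> lattice_group"
  shows "reduced_word n w is \<longleftrightarrow> set is \<subseteq> {0..n} \<and> word n is = w \<and> length is = card (lambda_set n w)"
  using cox_length_eq[of "{0..n}" w] assms parabolic_full by (simp add: reduced_word_def)

lemma reduced_word_exists:
  assumes "w \<in> lattice_group" obtains "is" where "reduced_word n w is"
proof -
  have "\<exists>is. set is \<subseteq> {0..n} \<and> word n is = w \<and> length is = card (lambda_set n w)"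
    by (rule parabolic_word_exists[OF _ assms]) (simp_all only: face_full order_refl)
  then show thesis using that reduced_word_iff[OF assms] by blast
qed

text \<open>
  Removing the descent leaves an element with one inversion less.
\<close>

lemma descent_starts_reduced_word:
  assumes "w \<in> lattice_group" "j \<le> n" "descent w j"
  obtains "is" where "reduced_word n w (j # is)"
proof -
  have ws: "w \<circ> simple_refl n j \<in> lattice_group"
    using assms lattice_group_comp simple_refl_in_lattice_group by blast
  obtain "is" where "is": "reduced_word n (w \<circ> simple_refl n j) is" using reduced_word_exists[OF ws] .
  have "word n (j # is) = w \<circ> (simple_refl n j \<circ> simple_refl n j)"
    using "is" reduced_word_iff[OF ws] by (simp add: comp_assoc)
  then have "word n (j # is) = w" by (simp add: simple_refl_involution assms)
  then have "reduced_word n w (j # is)"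
    using "is" reduced_word_iff[OF ws] reduced_word_iff[OF assms(1)] card_lambda_comp(1)[OF assms] assms(2) by simp
  then show thesis by (rule that)
qed

lemma reduced_word_starts_with_descent:
  assumes "w \<in> lattice_group" "reduced_word n w (j # is)"
  shows "j \<le> n" "descent w j"
proof -
  have "is": "set is \<subseteq> {0..n}" "j \<le> n" "word n is \<circ> simple_refl n j = w"
    "Suc (length is) = card (lambda_set n w)"
    using assms reduced_word_iff[OF assms(1)] by auto
  show "j \<le> n" by (rule "is"(2))
  have "w \<circ> simple_refl n j = word n is \<circ> (simple_refl n j \<circ> simple_refl n j)"
    unfolding "is"(3)[symmetric] by (simp add: comp_assoc)
  then have "w \<circ> simple_refl n j = word n is" by (simp add: simple_refl_involution "is")
  then have "card (lambda_set n (w \<circ> simple_refl n j)) < card (lambda_set n w)"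
    using card_lambda_word_le[OF "is"(1)] "is"(4) by simp
  then show "descent w j" using card_lambda_comp(2)[OF assms(1) "is"(2)] by fastforce
qed

text \<open>
  Reversal exchanges first and last letters, so the last letters are the descents of the inverse.
\<close>

lemma reduced_word_rev:
  assumes "w \<in> lattice_group" "reduced_word n w is"
  shows "reduced_word n (winv w) (rev is)"
proof -
  have le: "card (lambda_set n (winv w)) \<le> card (lambda_set n w)" if w: "w \<in> lattice_group" for w
  proof -
    obtain "is" where "reduced_word n w is" using reduced_word_exists[OF w] .
    then show ?thesis
      using reduced_word_iff[OF w] word_rev[of "is"] card_lambda_word_le[of "rev is"] by auto
  qed
  have "card (lambda_set n (winv w)) = card (lambda_set n w)"
    using le[OF assms(1)] le[OF lattice_group_inv[OF assms(1)]]
    by (simp add: inv_inv_eq lattice_group_bij assms(1))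
  then show ?thesis
    using assms word_rev reduced_word_iff[OF assms(1)] reduced_word_iff[OF lattice_group_inv[OF assms(1)]] by auto
qed

lemma lambda_seq_eq_Nil [simp]: "lambda_seq n is = [] \<longleftrightarrow> is = []"
  by (cases "is") auto

lemma word_last_lambda_seq:
  "is \<noteq> [] \<Longrightarrow> set is \<subseteq> {0..n} \<Longrightarrow> word n is (last (lambda_seq n is)) = - simple_root n (last is)"
  by (induction "is") (auto simp: simple_refl_root last_map simple_refl_cancel)

text \<open>
  The last root of the sequence is the one that the last letter makes negative.
\<close>

lemma last_lambda_seq:
  assumes "w \<in> lattice_group" "reduced_word n w is" "is \<noteq> []"
  shows "last (lambda_seq n is) = - winv w (simple_root n (last is))"
proof -
  have "set is \<subseteq> {0..n}" "word n is = w" using assms(2) reduced_word_iff[OF assms(1)] by blast+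
  then have "w (last (lambda_seq n is)) = - simple_root n (last is)"
    using word_last_lambda_seq[OF assms(3)] by blast
  then have "winv w (w (last (lambda_seq n is))) = winv w (- simple_root n (last is))" by simp
  then show ?thesis
    by (simp add: linear_map_minus lattice_group_linear lattice_group_inv assms(1)
        inv_f_f[OF bij_is_inj[OF lattice_group_bij[OF assms(1)]]])
qed

text \<open>
  Every descent is the first letter of some reduced word, and every descent of the inverse is the
  last letter of one. So the ends of the \<open>\<lambda>\<close>-sequence do not depend on the reduced word exactly when
  both descents are unique.
\<close>

lemma minimal_NGT_iff:
  "minimal_NGT n w \<longleftrightarrow> w \<in> lattice_group \<and> (\<exists>i\<le>n. \<exists>k\<le>n. (\<forall>j\<le>n. descent w j \<longleftrightarrow> j = i) \<and>
    (\<forall>j\<le>n. descent (winv w) j \<longleftrightarrow> j = k) \<and>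
    (\<exists>\<gamma>. is_triple n w (- winv w (simple_root n k)) \<gamma> (simple_root n i)))"
    (is "?L \<longleftrightarrow> ?R")
proof
  assume ?L
  then obtain \<alpha> \<beta> \<gamma> where w: "w \<in> lattice_group" and tri: "is_triple n w \<beta> \<gamma> \<alpha>"
    and ends: "\<And>is. reduced_word n w is \<Longrightarrow> hd (lambda_seq n is) = \<alpha> \<and> last (lambda_seq n is) = \<beta>"
    unfolding minimal_NGT_def by (auto simp: affine_weyl_def parabolic_full)
  note wi = lattice_group_inv[OF w]
  have ww: "winv (winv w) = w" by (simp add: inv_inv_eq lattice_group_bij w)
  have "\<alpha> \<in> lambda_set n w" using tri by (simp add: is_triple_def)
  then have "card (lambda_set n w) \<noteq> 0" using finite_lambda_set[OF w] by auto
  have ne: "is \<noteq> []" if "reduced_word n w is" for "is"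
    using that reduced_word_iff[OF w] \<open>card (lambda_set n w) \<noteq> 0\<close> by auto
  obtain "is" where "is": "reduced_word n w is" using reduced_word_exists[OF w] .
  then obtain i js where ij: "is = i # js" using ne by (cases "is") auto
  have i: "i \<le> n" "descent w i" using reduced_word_starts_with_descent w "is" ij by blast+
  have \<alpha>: "\<alpha> = simple_root n i" using ends[OF "is"] ij by simp
  define k where "k = last is"
  have \<beta>: "\<beta> = - winv w (simple_root n k)" using ends[OF "is"] last_lambda_seq[OF w "is" ne[OF "is"]] k_def by simp
  have k: "k \<le> n" "descent (winv w) k"
  proof -
    have "rev is = k # tl (rev is)" using ne[OF "is"] by (simp add: k_def hd_rev[symmetric])
    then show "k \<le> n" "descent (winv w) k"
      using reduced_word_rev[OF w "is"] reduced_word_starts_with_descent[OF wi] by metis+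
  qed
  have "j = i" if d: "j \<le> n" "descent w j" for j
  proof -
    obtain xs where "reduced_word n w (j # xs)" using descent_starts_reduced_word[OF w d] .
    from ends[OF this] have "simple_root n j = simple_root n i" using \<alpha> by simp
    then show ?thesis using simple_root_inject[OF d(1) i(1)] by blast
  qed
  moreover have "j = k" if d: "j \<le> n" "descent (winv w) j" for j
  proof -
    obtain xs where "reduced_word n (winv w) (j # xs)" using descent_starts_reduced_word[OF wi d] .
    then have "reduced_word n w (rev xs @ [j])" using reduced_word_rev[OF wi] ww by fastforce
    from ends[OF this] last_lambda_seq[OF w this]
    have "winv w (simple_root n j) = winv w (simple_root n k)" using \<beta> by simp
    then have "simple_root n j = simple_root n k"
      using lattice_group_bij[OF wi] by (metis bij_is_inj injD)
    then show ?thesis using simple_root_inject[OF d(1) k(1)] by blast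
  qed
  ultimately show ?R using w i k tri \<alpha> \<beta> by blast
next
  assume ?R
  then obtain i k \<gamma> where w: "w \<in> lattice_group" and i: "i \<le> n" "\<forall>j\<le>n. descent w j \<longleftrightarrow> j = i"
    and k: "k \<le> n" "\<forall>j\<le>n. descent (winv w) j \<longleftrightarrow> j = k"
    and tri: "is_triple n w (- winv w (simple_root n k)) \<gamma> (simple_root n i)" by blast
  note wi = lattice_group_inv[OF w]
  have "hd (lambda_seq n is) = simple_root n i \<and> last (lambda_seq n is) = - winv w (simple_root n k)"
    if red: "reduced_word n w is" for "is"
  proof -
    have "simple_root n i \<in> lambda_set n w" using i descent_iff_lambda[OF w] by blast
    then have "card (lambda_set n w) \<noteq> 0" using finite_lambda_set[OF w] by auto
    then have ne: "is \<noteq> []" using red reduced_word_iff[OF w] by auto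
    obtain x xs where x: "is = x # xs" using ne by (cases "is") auto
    have "x = i" using reduced_word_starts_with_descent[OF w] red x i by metis
    have "rev is = last is # tl (rev is)" using ne by (simp add: hd_rev[symmetric])
    then have "last is = k"
      using reduced_word_rev[OF w red] reduced_word_starts_with_descent[OF wi] k by metis
    with last_lambda_seq[OF w red ne] x \<open>x = i\<close> show ?thesis by simp
  qed
  then have "\<forall>is. reduced_word n w is \<longrightarrow> hd (lambda_seq n is) = simple_root n i \<and>
      last (lambda_seq n is) = - winv w (simple_root n k)" by blast
  moreover have "w \<in> carrier (affine_weyl n)" using w by (simp add: affine_weyl_def parabolic_full)
  ultimately show ?L unfolding minimal_NGT_def using tri by blast
qed


section \<open>The triple condition\<close>

text \<open>
  Half the value of the invariant form on the vectors attached to \<open>x\<close> and \<open>y\<close>: it is \<open>1\<close> if the two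
  points lie over the same line with the same orientation, \<open>- 1\<close> if with opposite orientations,
  and \<open>0\<close> otherwise, in particular if one of them is a mirror.
\<close>

definition pairing :: "int \<Rightarrow> int \<Rightarrow> int" where
  "pairing x y = of_bool (2 * N dvd x - y) - of_bool (2 * N dvd x + y)"

lemma pairing_commute: "pairing x y = pairing y x"
  unfolding pairing_def by (simp add: dvd_diff_commute add.commute)

lemma pairing_minus: "pairing (- x) y = - pairing x y"
proof -
  have "2 * N dvd - x - y \<longleftrightarrow> 2 * N dvd x + y" "2 * N dvd - x + y \<longleftrightarrow> 2 * N dvd x - y"
    using dvd_minus_iff[of "2 * N" "x + y"] dvd_minus_iff[of "2 * N" "x - y"] by (simp_all add: algebra_simps)
  then show ?thesis unfolding pairing_def by simp
qed

lemma pairing_period: "pairing (x + 2 * N * a) y = pairing x y"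
  unfolding pairing_def using dvd_period[of x a y] dvd_period[of x a "- y"] by simp

lemma pairing_wall: "pairing (N * a) y = 0"
proof -
  have "2 * N dvd N * a - y \<longleftrightarrow> 2 * N dvd N * a + y"
  proof -
    have "N * a + y = - (N * a - y) + 2 * N * a" by simp
    then show ?thesis by (metis dvd_period0 dvd_minus_iff)
  qed
  then show ?thesis unfolding pairing_def by simp
qed

lemma pairing_coordinate:
  "i \<in> {1..n} \<Longrightarrow> j \<in> {1..n} \<Longrightarrow> pairing (N - int i) (N - int j) = of_bool (i = j)"
  unfolding pairing_def by (simp only: coordinate_diff_dvd coordinate_sum_not_dvd) simp

lemma fst_vec_simps:
  "fst (vec (x + 2 * N * a)) = fst (vec x)" "fst (vec (- x)) = - fst (vec x)" "fst (vec (N * a)) = 0"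
  "i \<in> {1..n} \<Longrightarrow> fst (vec (N - int i)) = eps i"
  by (simp_all only: vec_period vec_minus vec_wall vec_coordinate fst_add fst_uminus fst_conv
      zero_fun_def[symmetric] add_0_right)

lemma form_vec_vec: "form n (fst (vec x)) (fst (vec y)) = 2 * of_int (pairing x y)"
proof -
  have zero: "form n 0 z = 0" "form n z 0 = 0" for z by (simp_all add: form_def)
  have coord: "form n (fst (vec (N - int i))) (fst (vec y)) = 2 * of_int (pairing (N - int i) y)"
    if i: "i \<in> {1..n}" for i
  proof (cases y rule: vec_cases)
    case (wall a)
    then show ?thesis by (simp only: fst_vec_simps zero pairing_commute[of "N - int i"] pairing_wall of_int_0 mult_zero_right)
  next
    case (pos j a)
    have "form n (eps i) (eps j) = 2 * of_bool (i = j)"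
      using pos by (simp add: form_eps eps_apply)
    then show ?thesis unfolding pos(2) pairing_commute[of "N - int i"] pairing_period
      using pairing_coordinate[OF i pos(1)]
      by (simp only: fst_vec_simps pos(1) i pairing_commute[of "N - int i"] of_int_of_bool)
  next
    case (neg j a)
    have "form n (eps i) (- eps j) = - 2 * of_bool (i = j)"
      using neg by (simp add: form_simps eps_apply)
    then show ?thesis unfolding neg(2) pairing_commute[of "N - int i"] pairing_period pairing_minus
      using pairing_coordinate[OF i neg(1)]
      by (simp only: fst_vec_simps neg(1) i pairing_commute[of "N - int i"] of_int_of_bool of_int_minus)
  qed
  show ?thesis
  proof (cases x rule: vec_cases)
    case (wall a)
    then show ?thesis by (simp only: fst_vec_simps zero pairing_wall of_int_0 mult_zero_right)
  next
    case (pos i a)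
    then show ?thesis using coord[OF pos(1)] by (simp only: fst_vec_simps pairing_period)
  next
    case (neg i a)
    then show ?thesis using coord[OF neg(1)]
      by (simp only: fst_vec_simps(1,2) pairing_period pairing_minus form_minus_left of_int_minus mult_minus_right)
  qed
qed

lemma form_root:
  "form n (fst (vec x - vec y)) (fst (vec a - vec b)) =
    2 * of_int (pairing x a - pairing x b - pairing y a + pairing y b)"
  by (simp add: form_diff_left form_diff_right form_vec_vec algebra_simps)

lemma pairing_self: "pairing x x = of_bool (\<not> N dvd x)"
proof -
  have "2 * N dvd x + x \<longleftrightarrow> N dvd x" by (simp only: mult_2[symmetric] dvd_mult_cancel_left) simp
  then show ?thesis unfolding pairing_def by simp
qed

lemma pairing_root_pair: "root_pair x y \<Longrightarrow> pairing x y = 0"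
  unfolding pairing_def root_pair_def by simp

lemma form_root_self:
  "root_pair x y \<Longrightarrow> form n (fst (vec x - vec y)) (fst (vec x - vec y)) =
    2 * (of_bool (\<not> N dvd x) + of_bool (\<not> N dvd y))"
  by (subst form_root) (simp add: pairing_commute[of y x] pairing_root_pair pairing_self)

text \<open>
  In terms of points: among the adjacent pairs that represent the simple roots, only \<open>d, d + 1\<close> has
  its order reversed. The pair \<open>d, d + 1\<close> belongs to the simple root with index \<open>n - d\<close>.
\<close>

definition unique_descent :: "(affvec \<Rightarrow> affvec) \<Rightarrow> int \<Rightarrow> bool" where
  "unique_descent w d \<longleftrightarrow> (\<forall>x. 0 \<le> x \<and> x \<le> int n \<longrightarrow> (perm w (x + 1) < perm w x \<longleftrightarrow> x = d))"

lemma perm_inject: "w \<in> lattice_group \<Longrightarrow> perm w x = perm w y \<longleftrightarrow> x = y"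
  using perm_inv(1) by metis

lemma descent_iff_perm:
  assumes "w \<in> lattice_group" "j \<le> n"
  shows "descent w j \<longleftrightarrow> perm w (int n - int j + 1) < perm w (int n - int j)"
  unfolding descent_def simple_root_vec[OF assms(2)] apply_vec_diff[OF assms(1)]
  by (simp add: height_diff)

lemma unique_descent_iff:
  assumes "w \<in> lattice_group"
  shows "(\<forall>j\<le>n. descent w j \<longleftrightarrow> j = i) \<and> i \<le> n \<longleftrightarrow> unique_descent w (int n - int i) \<and> i \<le> n"
proof -
  have "(\<forall>j\<le>n. descent w j \<longleftrightarrow> j = i) \<longleftrightarrow> unique_descent w (int n - int i)" if "i \<le> n"
  proof
    assume L: "\<forall>j\<le>n. descent w j \<longleftrightarrow> j = i"
    show "unique_descent w (int n - int i)" unfolding unique_descent_def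
    proof (intro allI impI)
      fix x assume x: "0 \<le> x \<and> x \<le> int n"
      then have "int n - int (nat (int n - x)) = x" by simp
      then show "perm w (x + 1) < perm w x \<longleftrightarrow> x = int n - int i"
        using L[rule_format, of "nat (int n - x)"] descent_iff_perm[OF assms, of "nat (int n - x)"] x that by auto
    qed
  next
    assume "unique_descent w (int n - int i)"
    then show "\<forall>j\<le>n. descent w j \<longleftrightarrow> j = i"
      unfolding unique_descent_def using descent_iff_perm[OF assms] by auto
  qed
  then show ?thesis by blast
qed

text \<open>
  With \<open>\<alpha> = vec (d + 1) - vec d\<close> and \<open>\<beta> = vec a - vec b\<close>, where \<open>a\<close> and \<open>b\<close> are the points sent to \<open>e\<close>
  and \<open>e + 1\<close>, the equality of lengths in \<open>\<gamma> = \<alpha> + \<beta>\<close> reads \<open>(\<alpha>, \<alpha>) = - 2 (\<alpha>, \<beta>)\<close>. The value of the form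
  on vectors \<open>vec x\<close> is an even integer, so the roots cannot be short, of square length \<open>2\<close>. Hence
  they are long and neither descent involves a mirror.
\<close>

lemma minimal_NGT_pairing:
  assumes "minimal_NGT n w"
  obtains d e where "w \<in> lattice_group" "1 \<le> d" "d < int n" "1 \<le> e" "e < int n"
    "unique_descent w d" "unique_descent (winv w) e"
    "pairing (d + 1) (perm (winv w) e) - pairing (d + 1) (perm (winv w) (e + 1))
      - pairing d (perm (winv w) e) + pairing d (perm (winv w) (e + 1)) = - 1"
proof -
  obtain i k \<gamma> where w: "w \<in> lattice_group" and i: "i \<le> n" "\<forall>j\<le>n. descent w j \<longleftrightarrow> j = i"
    and k: "k \<le> n" "\<forall>j\<le>n. descent (winv w) j \<longleftrightarrow> j = k"
    and tri: "is_triple n w (- winv w (simple_root n k)) \<gamma> (simple_root n i)"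
    using assms minimal_NGT_iff by blast
  note wi = lattice_group_inv[OF w]
  define d e where "d = int n - int i" and "e = int n - int k"
  have ud: "unique_descent w d" "unique_descent (winv w) e"
    using unique_descent_iff[OF w] unique_descent_iff[OF wi] i k unfolding d_def e_def by blast+
  have de: "0 \<le> d" "d \<le> int n" "0 \<le> e" "e \<le> int n" using i k by (auto simp: d_def e_def)
  define a b where "a = perm (winv w) e" and "b = perm (winv w) (e + 1)"
  have \<alpha>: "simple_root n i = vec (d + 1) - vec d" using simple_root_vec[OF i(1)] d_def by simp
  have \<beta>: "- winv w (simple_root n k) = vec a - vec b"
    using simple_root_vec[OF k(1)] apply_vec_diff[OF wi] unfolding e_def a_def b_def by simp
  note root = root_pair_consecutive
  have rab: "root_pair a b" using root_pair_perm[OF wi root[OF de(3,4)]] root_pair_commute a_def b_def by blast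
  define c where "c = pairing (d + 1) a - pairing (d + 1) b - pairing d a + pairing d b"
  have \<gamma>: "\<gamma> = (vec (d + 1) - vec d) + (vec a - vec b)" using tri \<alpha> \<beta> unfolding is_triple_def by metis
  have "form n (fst \<gamma>) (fst \<gamma>) = form n (fst (vec (d + 1) - vec d)) (fst (vec (d + 1) - vec d))
      + form n (fst (vec a - vec b)) (fst (vec a - vec b)) + 4 * of_int c"
    unfolding \<gamma> fst_add form_add_left form_add_right
      form_commute[of "fst (vec a - vec b)" "fst (vec (d + 1) - vec d)"]
      form_root[of "d + 1" d a b] c_def[symmetric] by simp
  moreover have len: "form n (fst (vec (d + 1) - vec d)) (fst (vec (d + 1) - vec d)) = form n (fst \<gamma>) (fst \<gamma>)"
    "form n (fst (vec a - vec b)) (fst (vec a - vec b)) = form n (fst \<gamma>) (fst \<gamma>)"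
    using tri unfolding \<alpha> \<beta> is_triple_def by blast+
  ultimately have c4: "form n (fst \<gamma>) (fst \<gamma>) = - 4 * of_int c" by linarith
  have "2 * (of_bool (\<not> N dvd d + 1) + of_bool (\<not> N dvd d)) = - 4 * real_of_int c"
    "2 * (of_bool (\<not> N dvd a) + of_bool (\<not> N dvd b)) = - 4 * real_of_int c"
    using len c4 form_root_self[OF root[OF de(1,2)]] form_root_self[OF rab] by linarith+
  moreover have "of_bool A + of_bool B = - 2 * k"
    if "2 * (of_bool A + of_bool B) = - 4 * real_of_int k" for A B and k :: int
  proof -
    have "real_of_int (2 * (of_bool A + of_bool B)) = real_of_int (- 4 * k)" using that by simp
    then have "2 * (of_bool A + of_bool B) = - 4 * k" by (simp only: of_int_eq_iff)
    then show ?thesis by (cases A; cases B) simp_all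
  qed
  ultimately have eqs: "of_bool (\<not> N dvd d + 1) + of_bool (\<not> N dvd d) = - 2 * c"
    "of_bool (\<not> N dvd a) + of_bool (\<not> N dvd b) = - 2 * c"
    by blast+
  have "\<not> (N dvd d + 1 \<and> N dvd d)" using root[OF de(1,2)] by (simp add: root_pair_def)
  moreover have "k = - 1 \<and> \<not> A \<and> \<not> B"
    if "of_bool (\<not> A) + of_bool (\<not> B) = - 2 * k" "\<not> (A \<and> B)" for A B and k :: int
    using that by (cases A; cases B; simp?; presburger?)
  ultimately have "c = - 1 \<and> \<not> N dvd d + 1 \<and> \<not> N dvd d" using eqs(1) by blast
  then have c: "c = - 1" "\<not> N dvd d + 1" "\<not> N dvd d" by blast+
  have "\<not> N dvd a \<and> \<not> N dvd b"
    using eqs(2) c(1) by (cases "N dvd a"; cases "N dvd b"; simp)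
  then have ab: "\<not> N dvd a" "\<not> N dvd b" by blast+
  have "1 \<le> d" "d < int n"
    using c(2,3) de by (cases "d = 0", simp, simp, cases "d = int n", auto)
  moreover have "1 \<le> e"
  proof (rule ccontr)
    assume "\<not> 1 \<le> e"
    then have "e = 0" using de by simp
    then show False using ab(1) perm_zero[OF lattice_group_map[OF wi]] by (simp add: a_def)
  qed
  moreover have "e < int n"
  proof (rule ccontr)
    assume "\<not> e < int n"
    then have "e + 1 = N" using de by simp
    then show False using ab(2) perm_N[OF lattice_group_map[OF wi]] by (simp add: b_def)
  qed
  ultimately show thesis using that w ud c(1) unfolding c_def a_def b_def by blast
qed


section \<open>B-positive elements as permutations of points\<close>

lemma B_positive_elt_apply: "B_positive_elt n u ps ts a =
    (B_positive_lin u ps (fst a), snd a - form n (B_positive_lin u ps (fst a)) (B_positive_b u ps ts))"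
  by (cases a) (simp add: B_positive_elt_def)

lemma linear_B_positive_elt: "linear_map (B_positive_elt n u ps ts)"
  unfolding linear_map_def B_positive_elt_apply
  by (simp add: B_positive_lin_add B_positive_lin_smul scale_def form_add_left form_smul_left algebra_simps)

lemma B_positive_lin_outer:
  assumes "u + sum_list ps \<le> n" "\<And>i. i \<in> {1..n} \<Longrightarrow> z i = 0"
  shows "B_positive_lin u ps z = z"
proof -
  have "smul (z i) v = 0" if "j < length ps" "i \<in> block u ps j" for i j v
    using that block_subset[of j ps u] assms by (auto simp: smul_def fun_eq_iff)
  then show ?thesis unfolding B_positive_lin_def by (simp add: sum.neutral)
qed

lemma B_positive_elt_outer:
  assumes "u + sum_list ps \<le> n" "\<And>i. i \<in> {1..n} \<Longrightarrow> fst a i = 0"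
  shows "B_positive_elt n u ps ts a = a"
  unfolding B_positive_elt_apply using B_positive_lin_outer[OF assms] assms(2) by (simp add: form_def prod_eq_iff)

lemma block_in_range: "u + sum_list ps \<le> n \<Longrightarrow> j < length ps \<Longrightarrow> i \<in> block u ps j \<Longrightarrow> i \<in> {1..n}"
  using block_subset[of j ps u] by fastforce

lemma B_positive_elt_block:
  assumes "u + sum_list ps \<le> n" "j < length ps" "i \<in> block u ps j"
  shows "B_positive_elt n u ps ts (eps i, 0) =
    vec (- (N - int (block_rev u ps j i)) + 2 * N * (- int (ts ! j)))"
proof -
  let ?r = "block_rev u ps j i"
  have r: "?r \<in> block u ps j" "?r \<in> {1..n}"
    using block_rev_in_block[OF assms(3)] block_in_range[OF assms(1,2)] by blast+
  have "form n (- eps ?r) (B_positive_b u ps ts) = 2 * real (ts ! j)"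
    using r form_eps[OF r(2), of "B_positive_b u ps ts"] B_positive_b_block[OF assms(2) r(1)]
    by (simp add: form_minus_left form_commute[of "eps ?r"])
  then show ?thesis unfolding B_positive_elt_apply vec_period vec_minus
    using B_positive_lin_block[OF assms(2,3)] vec_coordinate[OF r(2)] by simp
qed

lemma B_positive_elt_fixed:
  assumes "i \<in> {1..n}" "\<And>j. j < length ps \<Longrightarrow> i \<notin> block u ps j"
  shows "B_positive_elt n u ps ts (eps i, 0) = (eps i, 0)"
  unfolding B_positive_elt_apply using B_positive_lin_fixed[OF assms(2)] B_positive_b_outside[OF assms(2)] assms(1)
  by (simp add: form_commute[of "eps i"] form_eps)

lemma lattice_map_B_positive_elt:
  assumes "u + sum_list ps \<le> n" shows "lattice_map (B_positive_elt n u ps ts)"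
proof (rule lattice_mapI)
  fix i assume i: "i \<in> {1..n}"
  show "\<exists>y. B_positive_elt n u ps ts (eps i, 0) = vec y"
  proof (cases "\<exists>j<length ps. i \<in> block u ps j")
    case True
    then show ?thesis using B_positive_elt_block[OF assms] by blast
  next
    case False
    then show ?thesis using B_positive_elt_fixed[OF i] vec_coordinate[OF i] by metis
  qed
qed (use linear_B_positive_elt B_positive_elt_outer[OF assms] in auto)

lemma perm_B_positive_block:
  assumes "u + sum_list ps \<le> n" "j < length ps" "i \<in> block u ps j"
  shows "perm (B_positive_elt n u ps ts) (N - int i) = - (N - int (block_rev u ps j i)) - 2 * N * int (ts ! j)"
proof (rule perm_eqI)
  show "B_positive_elt n u ps ts (vec (N - int i)) = vec (- (N - int (block_rev u ps j i)) - 2 * N * int (ts ! j))"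
    using B_positive_elt_block[OF assms] vec_coordinate[OF block_in_range[OF assms]] by simp
qed

lemma perm_B_positive_fixed:
  assumes "i \<in> {1..n}" "\<And>j. j < length ps \<Longrightarrow> i \<notin> block u ps j"
  shows "perm (B_positive_elt n u ps ts) (N - int i) = N - int i"
  by (rule perm_eqI) (simp only: vec_coordinate[OF assms(1)] B_positive_elt_fixed[OF assms])

text \<open>
  Reversing a block twice is the identity, and the translation by \<open>- 2 N t\<close> changes sign together
  with the coordinate.
\<close>

lemma B_positive_elt_involution:
  assumes "u + sum_list ps \<le> n"
  shows "B_positive_elt n u ps ts \<circ> B_positive_elt n u ps ts = id"
proof (rule lattice_map_eqI)
  let ?W = "B_positive_elt n u ps ts"
  note W = lattice_map_B_positive_elt[OF assms, of ts]
  show "lattice_map (?W \<circ> ?W)" "lattice_map id" by (rule lattice_map_comp[OF W W], rule lattice_map_id)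
  fix x assume x: "1 \<le> x" "x \<le> int n"
  define i where "i = nat (N - x)"
  have i: "i \<in> {1..n}" "x = N - int i" using x by (auto simp: i_def)
  have "perm ?W (perm ?W x) = x"
  proof (cases "\<exists>j<length ps. i \<in> block u ps j")
    case True
    then obtain j where j: "j < length ps" "i \<in> block u ps j" by blast
    have "perm ?W x = - (N - int (block_rev u ps j i)) + 2 * N * (- int (ts ! j))"
      using perm_B_positive_block[OF assms j] i by simp
    then have "perm ?W (perm ?W x) = - perm ?W (N - int (block_rev u ps j i)) + 2 * N * (- int (ts ! j))"
      by (simp only: perm_period[OF W] perm_minus[OF W])
    also have "\<dots> = N - int i"
      using perm_B_positive_block[OF assms j(1) block_rev_in_block[OF j(2)], of ts] block_rev_involution[OF j(2)] by simp
    finally show ?thesis using i by simp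
  next
    case False
    then show ?thesis using perm_B_positive_fixed[OF i(1)] i by auto
  qed
  then show "perm (?W \<circ> ?W) x = perm id x" by (simp only: perm_comp[OF W W] perm_id)
qed

lemma B_positive_elt_in_lattice_group:
  "u + sum_list ps \<le> n \<Longrightarrow> B_positive_elt n u ps ts \<in> lattice_group"
  by (rule lattice_group_involution[OF lattice_map_B_positive_elt B_positive_elt_involution])

lemma B_positive_eltI:
  assumes "w \<in> lattice_group" "u + sum_list ps \<le> n"
    and "\<And>i j. j < length ps \<Longrightarrow> i \<in> block u ps j \<Longrightarrow>
      perm w (N - int i) = - (N - int (block_rev u ps j i)) - 2 * N * int (ts ! j)"
    and "\<And>i. i \<in> {1..n} \<Longrightarrow> (\<And>j. j < length ps \<Longrightarrow> i \<notin> block u ps j) \<Longrightarrow> perm w (N - int i) = N - int i"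
  shows "w = B_positive_elt n u ps ts"
proof (rule lattice_map_eqI)
  fix x assume x: "1 \<le> x" "x \<le> int n"
  define i where "i = nat (N - x)"
  have i: "i \<in> {1..n}" "x = N - int i" using x by (auto simp: i_def)
  show "perm w x = perm (B_positive_elt n u ps ts) x"
  proof (cases "\<exists>j<length ps. i \<in> block u ps j")
    case True
    then show ?thesis using perm_B_positive_block[OF assms(2)] assms(3) i(2) by metis
  next
    case False
    then show ?thesis using perm_B_positive_fixed[OF i(1)] assms(4)[OF i(1)] i(2) by metis
  qed
qed (use assms lattice_group_map lattice_map_B_positive_elt in auto)

section \<open>The two ways in which the descents match\<close>

lemma unique_descent_ascent:
  assumes "w \<in> lattice_group" "unique_descent w d" "0 \<le> x" "x \<le> int n" "x \<noteq> d"
  shows "perm w x < perm w (x + 1)"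
proof -
  have "\<not> perm w (x + 1) < perm w x" using assms unfolding unique_descent_def by blast
  moreover have "perm w (x + 1) \<noteq> perm w x" by (simp add: perm_inject assms(1))
  ultimately show ?thesis by simp
qed

lemma unique_descent_low:
  assumes "w \<in> lattice_group" "unique_descent w d" "d \<le> int n" "0 \<le> x" "x \<le> y" "y \<le> d"
  shows "perm w x + (y - x) \<le> perm w y"
  by (rule strict_chain[of 0 d]) (use assms unique_descent_ascent[OF assms(1,2)] in auto)

lemma unique_descent_high:
  assumes "w \<in> lattice_group" "unique_descent w d" "0 \<le> d" "d + 1 \<le> x" "x \<le> y" "y \<le> N"
  shows "perm w x + (y - x) \<le> perm w y"
  by (rule strict_chain[of "d + 1" N]) (use assms unique_descent_ascent[OF assms(1,2)] in auto)

lemma dvd_double: "2 * N dvd x - y \<Longrightarrow> 2 * N dvd x + y \<Longrightarrow> N dvd x"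
proof -
  assume "2 * N dvd x - y" "2 * N dvd x + y"
  then have "2 * N dvd (x - y) + (x + y)" by (rule dvd_add)
  moreover have "(x - y) + (x + y) = 2 * x" by simp
  ultimately have "2 * N dvd 2 * x" by simp
  then show "N dvd x" by (metis dvd_mult_cancel_left zero_neq_numeral)
qed

text \<open>
  One of the four pairings must contribute \<open>- 1\<close> to the sum. Away from its descent the permutation
  is increasing, so its values are positive up to \<open>d\<close> and below \<open>N\<close> from \<open>d + 1\<close> on, and likewise
  for the inverse. These bounds leave no room for the two congruences with the wrong orientation,
  and turn the other two into equalities: either the lower ends \<open>d\<close>, \<open>e\<close> of the two descents match, or
  their upper ends \<open>d + 1\<close>, \<open>e + 1\<close> do.
\<close>

lemma minimal_NGT_cases:
  assumes "minimal_NGT n w"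
  obtains (low) d e where "w \<in> lattice_group" "1 \<le> d" "d < int n" "1 \<le> e" "e < int n"
    "unique_descent w d" "unique_descent (winv w) e"
    "perm (winv w) e = d" "\<not> 2 * N dvd perm (winv w) (e + 1) + (d + 1)"
  | (high) d e where "w \<in> lattice_group" "1 \<le> d" "d < int n" "1 \<le> e" "e < int n"
    "unique_descent w d" "unique_descent (winv w) e"
    "perm (winv w) (e + 1) = d + 1" "\<not> 2 * N dvd perm (winv w) e + d"
proof -
  obtain d e where w: "w \<in> lattice_group" and de: "1 \<le> d" "d < int n" "1 \<le> e" "e < int n"
    and ud: "unique_descent w d" "unique_descent (winv w) e"
    and sum: "pairing (d + 1) (perm (winv w) e) - pairing (d + 1) (perm (winv w) (e + 1))
      - pairing d (perm (winv w) e) + pairing d (perm (winv w) (e + 1)) = - 1"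
    using minimal_NGT_pairing[OF assms] .
  note wi = lattice_group_inv[OF w] and wm = lattice_group_map[OF w]
  note wim = lattice_group_map[OF wi]
  define a b where "a = perm (winv w) e" and "b = perm (winv w) (e + 1)"
  have fa: "perm w a = e" and fb: "perm w b = e + 1" by (simp_all only: a_def b_def perm_inv[OF w])
  have range: "0 < perm w d" "perm w (d + 1) < N" "0 < a" "b < N"
    using unique_descent_low[OF w ud(1), of 0 d] unique_descent_high[OF w ud(1), of "d + 1" N]
      unique_descent_low[OF wi ud(2), of 0 e] unique_descent_high[OF wi ud(2), of "e + 1" N] de
    unfolding a_def b_def perm_zero[OF wm] perm_N[OF wm] perm_zero[OF wim] perm_N[OF wim] by linarith+
  have mult: "k \<le> 0 \<Longrightarrow> 2 * N * k \<le> 0" "1 \<le> k \<Longrightarrow> 2 * N \<le> 2 * N * k" "k \<le> - 1 \<Longrightarrow> 2 * N * k \<le> - 2 * N" "0 \<le> k \<Longrightarrow> 0 \<le> 2 * N * k" for k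
    using mult_left_mono[of k 0 "2 * N"] mult_left_mono[of 1 k "2 * N"] mult_left_mono[of k "- 1" "2 * N"] mult_left_mono[of 0 k "2 * N"]
    by auto
  have 1: "\<not> 2 * N dvd (d + 1) + a"
  proof
    assume "2 * N dvd (d + 1) + a"
    then obtain k where "(d + 1) + a = 2 * N * k" by (metis dvdE)
    then have k: "a = - (d + 1) + 2 * N * k" by linarith
    have "e = - perm w (d + 1) + 2 * N * k" using fa unfolding k perm_period[OF wm] perm_minus[OF wm] by simp
    then have "k \<le> 0 \<Longrightarrow> False" "1 \<le> k \<Longrightarrow> False"
      using mult(1)[of k] mult(2)[of k] range k de by (smt (verit))+
    then show False by linarith
  qed
  have 2: "\<not> 2 * N dvd d + b"
  proof
    assume "2 * N dvd d + b"
    then obtain k where "d + b = 2 * N * k" by (metis dvdE)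
    then have k: "b = - d + 2 * N * k" by linarith
    have "e + 1 = - perm w d + 2 * N * k" using fb unfolding k perm_period[OF wm] perm_minus[OF wm] by simp
    then have "k \<le> 0 \<Longrightarrow> False" "1 \<le> k \<Longrightarrow> False"
      using mult(1)[of k] mult(2)[of k] range k de by (smt (verit))+
    then show False by linarith
  qed
  have 3: "b = d + 1" if "2 * N dvd (d + 1) - b"
  proof -
    obtain k where "b - (d + 1) = 2 * N * k" using \<open>2 * N dvd (d + 1) - b\<close> by (metis dvdE dvd_diff_commute)
    then have k: "b = (d + 1) + 2 * N * k" by linarith
    have "e + 1 = perm w (d + 1) + 2 * N * k" using fb unfolding k perm_period[OF wm] by simp
    then have "\<not> 1 \<le> k" "\<not> k \<le> - 1"
      using mult(2)[of k] mult(3)[of k] range k de by (smt (verit))+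
    then have "k = 0" by simp
    then show ?thesis using k by simp
  qed
  have 4: "a = d" if "2 * N dvd d - a"
  proof -
    obtain k where "a - d = 2 * N * k" using \<open>2 * N dvd d - a\<close> by (metis dvdE dvd_diff_commute)
    then have k: "a = d + 2 * N * k" by linarith
    have "e = perm w d + 2 * N * k" using fa unfolding k perm_period[OF wm] by simp
    then have "\<not> 1 \<le> k" "\<not> k \<le> - 1"
      using mult(2)[of k] mult(3)[of k] range k de by (smt (verit))+
    then have "k = 0" by simp
    then show ?thesis using k by simp
  qed
  have nd: "\<not> N dvd d" "\<not> N dvd d + 1" using not_dvd_between[of d N] not_dvd_between[of "d + 1" N] de by auto
  have s: "pairing (d + 1) a - pairing (d + 1) b - pairing d a + pairing d b = - 1"
    using sum by (simp only: a_def b_def)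
  have p: "0 \<le> pairing (d + 1) a" "0 \<le> pairing d b" using 1 2 by (auto simp: pairing_def)
  consider "2 * N dvd d - a" | "\<not> 2 * N dvd d - a" "2 * N dvd (d + 1) - b"
  proof -
    have "\<not> 2 * N dvd x - y \<Longrightarrow> pairing x y \<le> 0" for x y by (simp add: pairing_def)
    from this[of d a] this[of "d + 1" b] have "2 * N dvd d - a \<or> 2 * N dvd (d + 1) - b"
      using s p by linarith
    then show thesis using that by blast
  qed
  then show thesis
  proof cases
    case 1
    have "\<not> 2 * N dvd d + a" using dvd_double[OF 1] nd by blast
    then have "pairing d a = 1" using 1 by (simp add: pairing_def)
    have "\<not> 2 * N dvd (d + 1) + b"
    proof
      assume *: "2 * N dvd (d + 1) + b"
      then have "\<not> 2 * N dvd (d + 1) - b" using dvd_double nd by blast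
      with * have "pairing (d + 1) b = - 1" by (simp add: pairing_def)
      with s p \<open>pairing d a = 1\<close> show False by simp
    qed
    then have "\<not> 2 * N dvd b + (d + 1)" by (subst add.commute)
    then show thesis using low[OF w de ud] 4[OF 1] unfolding a_def b_def by blast
  next
    case 2
    have "\<not> 2 * N dvd (d + 1) + b" using dvd_double[OF 2(2)] nd by blast
    then have "pairing (d + 1) b = 1" using 2 by (simp add: pairing_def)
    have "\<not> 2 * N dvd d + a"
    proof
      assume "2 * N dvd d + a"
      with 2 have "pairing d a = - 1" by (simp add: pairing_def)
      with s p \<open>pairing (d + 1) b = 1\<close> show False by simp
    qed
    then have "\<not> 2 * N dvd a + d" by (subst add.commute)
    then show thesis using high[OF w de ud] 3[OF 2(2)] unfolding a_def b_def by blast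
  qed
qed


section \<open>Matching lower ends give B-positive elements\<close>

text \<open>
  Above the bottom horizontal lines both the permutation and its inverse move points down only.
  If the orientation of a point is preserved, the two inequalities allow no translation and force
  the point to be fixed. If it is reversed, the image lies below the bottom mirror, and \<open>t\<close> is the
  number of top reflections.
\<close>

lemma perm_above_cases:
  assumes w: "w \<in> lattice_group" and d: "1 \<le> d" "d < int n"
    and ud: "unique_descent w d" "unique_descent (winv w) d"
    and fixed: "\<And>x. 1 \<le> x \<Longrightarrow> x \<le> d \<Longrightarrow> perm (winv w) x = x"
    and x: "d + 1 \<le> x" "x \<le> int n"
  shows "perm w x = x \<or> (\<exists>y t. d + 1 \<le> y \<and> y \<le> int n \<and> 0 \<le> t \<and> perm w x = - y - 2 * N * t)"
proof -
  note wi = lattice_group_inv[OF w] and wm = lattice_group_map[OF w]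
  note wim = lattice_group_map[OF wi]
  have mult: "1 \<le> k \<Longrightarrow> 2 * N \<le> 2 * N * k" "k \<le> - 1 \<Longrightarrow> 2 * N * k \<le> - 2 * N" "k \<le> 0 \<Longrightarrow> 2 * N * k \<le> 0" for k
    using mult_left_mono[of 1 k "2 * N"] mult_left_mono[of k "- 1" "2 * N"] mult_left_mono[of k 0 "2 * N"] by auto
  have upper: "perm w y \<le> y" "perm (winv w) y \<le> y" if "d + 1 \<le> y" "y \<le> int n" for y
    using unique_descent_high[OF w ud(1), of y N] unique_descent_high[OF wi ud(2), of y N] that d
    unfolding perm_N[OF wm] perm_N[OF wim] by linarith+
  show ?thesis
  proof (cases "perm w x" rule: vec_cases)
    case (wall a)
    then have "N dvd perm (winv w) (perm w x)" using perm_dvd(1)[OF wim] by simp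
    then have "N dvd x" by (simp only: perm_inv[OF w])
    then show ?thesis using not_dvd_between[of x N] x d by auto
  next
    case (pos i a)
    define y where "y = N - int i"
    have y: "1 \<le> y" "y \<le> int n" using pos(1) by (auto simp: y_def)
    have fx: "perm w x = y + 2 * N * a" using pos(2) y_def by simp
    have "\<not> 1 \<le> a" using mult(1)[of a] fx upper(1)[OF x] y x by (smt (verit))
    then have a0: "a \<le> 0" by simp
    have "x = perm (winv w) (y + 2 * N * a)" using perm_inv(1)[OF w, of x] by (simp only: fx)
    then have gy: "x = perm (winv w) y + 2 * N * a" by (simp only: perm_period[OF wim])
    have "d + 1 \<le> y"
    proof (rule ccontr)
      assume "\<not> d + 1 \<le> y"
      then show False using gy fixed[of y] y mult(3)[OF a0] x by simp
    qed
    then have le: "perm (winv w) y \<le> y" using upper(2) y by blast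
    have "\<not> a \<le> - 1" using mult(2)[of a] gy le y x d by (smt (verit))
    then have "a = 0" using a0 by simp
    then show ?thesis using fx gy le upper(1)[OF x] by simp
  next
    case (neg i a)
    define y where "y = N - int i"
    have y: "1 \<le> y" "y \<le> int n" using neg(1) by (auto simp: y_def)
    have fx: "perm w x = - y + 2 * N * a" using neg(2) y_def by simp
    have "\<not> 1 \<le> a" using mult(1)[of a] fx upper(1)[OF x] y x by (smt (verit))
    then have a0: "a \<le> 0" by simp
    have "x = perm (winv w) (- y + 2 * N * a)" using perm_inv(1)[OF w, of x] by (simp only: fx)
    then have gy: "x = - perm (winv w) y + 2 * N * a" by (simp only: perm_period[OF wim] perm_minus[OF wim])
    have "d + 1 \<le> y"
    proof (rule ccontr)
      assume "\<not> d + 1 \<le> y"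
      then show False using gy fixed[of y] y mult(3)[OF a0] x d by simp
    qed
    then show ?thesis using fx a0 y by (intro disjI2 exI[of _ y] exI[of _ "- a"]) simp
  qed
qed

text \<open>
  Everything below the descents lies between the bottom mirror and a matched pair, and is squeezed
  into place: these are the bottom horizontal lines.
\<close>

lemma low_descent_fixes:
  assumes w: "w \<in> lattice_group" and de: "1 \<le> d" "d < int n" "1 \<le> e" "e < int n"
    and ud: "unique_descent w d" "unique_descent (winv w) e" and "perm (winv w) e = d"
  shows "e = d" and "0 \<le> x \<Longrightarrow> x \<le> d \<Longrightarrow> perm w x = x"
proof -
  note wi = lattice_group_inv[OF w] and wm = lattice_group_map[OF w]
  note wim = lattice_group_map[OF wi]
  have fd: "perm w d = e" using perm_inv(2)[OF w, of e] assms(8) by simp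
  have f0: "perm w 0 = 0" "perm (winv w) 0 = 0" using perm_zero wm wim by blast+
  show ed: "e = d"
    using unique_descent_low[OF w ud(1), of 0 d] unique_descent_low[OF wi ud(2), of 0 e] de fd assms(8) f0
    by simp
  show "0 \<le> x \<Longrightarrow> x \<le> d \<Longrightarrow> perm w x = x"
    using unique_descent_low[OF w ud(1), of 0 x] unique_descent_low[OF w ud(1), of x d] de fd f0 ed
    by simp
qed

text \<open>
  For a moving point \<open>x\<close> above the descent write \<open>f x = - \<pi> x - 2 N t x\<close>, and \<open>\<rho>\<close>, \<open>s\<close> for the
  corresponding functions of the inverse. Both \<open>t\<close> and \<open>s\<close> are weakly decreasing because \<open>f\<close> and its
  inverse increase, and they are rearrangements of one another along \<open>\<pi>\<close>; so they coincide. Thus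
  \<open>\<pi>\<close> preserves the levels of \<open>t\<close>, and since \<open>f\<close> increases on a level, \<open>\<pi>\<close> decreases there and is the
  reversal. The levels are the bunches, and \<open>t\<close> is the common \<open>t\<close>-number of each.
\<close>

lemma low_ends_B_positive:
  assumes w: "w \<in> lattice_group" and de: "1 \<le> d" "d < int n" "1 \<le> e" "e < int n"
    and ud: "unique_descent w d" "unique_descent (winv w) e" and ge: "perm (winv w) e = d"
    and last: "\<not> 2 * N dvd perm (winv w) (e + 1) + (d + 1)"
  shows "B_positive n w"
proof -
  define f g where "f = perm w" and "g = perm (winv w)"
  note wi = lattice_group_inv[OF w] and wm = lattice_group_map[OF w]
  note wim = lattice_group_map[OF wi]
  have ed: "e = d" and ffix: "f x = x" if "0 \<le> x" "x \<le> d" for x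
    using low_descent_fixes[OF w de ud ge] that unfolding f_def by blast+
  have ed: "e = d" using low_descent_fixes(1)[OF w de ud ge] .
  have gf: "g (f x) = x" and fg: "f (g x) = x" for x unfolding f_def g_def by (simp_all only: perm_inv[OF w])
  have gfix: "g x = x" if "0 \<le> x" "x \<le> d" for x using gf[of x] ffix[OF that] by simp
  have ww: "winv (winv w) = w" by (simp add: inv_inv_eq lattice_group_bij w)
  have udi: "unique_descent (winv w) d" using ud(2) ed by simp
  have fstep: "f x + (y - x) \<le> f y" and gstep: "g x + (y - x) \<le> g y"
    if "d + 1 \<le> x" "x \<le> y" "y \<le> N" for x y
    using unique_descent_high[OF w ud(1)] unique_descent_high[OF wi udi] that de unfolding f_def g_def by auto
  have fper: "f (- y - 2 * N * t) = - f y - 2 * N * t" and gper: "g (- y - 2 * N * t) = - g y - 2 * N * t" for y t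
    unfolding f_def g_def
    using perm_period[OF wm, of "- y" "- t"] perm_period[OF wim, of "- y" "- t"]
    by (simp_all add: perm_minus[OF wm] perm_minus[OF wim])
  (* The points over the lines that are not horizontal. *)
  define R where "R = {x \<in> {d + 1..int n}. f x \<noteq> x}"
  have R_iff: "x \<in> R \<longleftrightarrow> d + 1 \<le> x \<and> x \<le> int n \<and> f x \<noteq> x" for x unfolding R_def by auto
  have R_iff_g: "x \<in> R \<longleftrightarrow> d + 1 \<le> x \<and> x \<le> int n \<and> g x \<noteq> x" for x
    unfolding R_iff using gf fg by metis
  have fin: "finite R" by (rule finite_subset[of _ "{d + 1..int n}"]) (auto simp: R_def)
  define \<pi> t \<rho> s where "\<pi> x = (- f x) mod (2 * N)" and "t x = (- f x) div (2 * N)"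
    and "\<rho> x = (- g x) mod (2 * N)" and "s x = (- g x) div (2 * N)" for x
  have modq: "(y + 2 * N * c) mod (2 * N) = y" "(y + 2 * N * c) div (2 * N) = c" if "0 \<le> y" "y \<le> int n" for y c
    using that by (simp_all add: div_pos_pos_trivial mod_pos_pos_trivial)
  have fR: "d + 1 \<le> \<pi> x \<and> \<pi> x \<le> int n \<and> 0 \<le> t x \<and> f x = - \<pi> x - 2 * N * t x" if xR: "x \<in> R" for x
  proof -
    obtain y c where y: "d + 1 \<le> y" "y \<le> int n" "0 \<le> c" "f x = - y - 2 * N * c"
      using perm_above_cases[OF w de(1,2) ud(1) udi, of x] gfix xR unfolding R_iff f_def g_def by auto
    then have "- f x = y + 2 * N * c" by simp
    then have "\<pi> x = y" "t x = c" unfolding \<pi>_def t_def using modq[of y c] y de by simp_all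
    then show ?thesis using y by simp
  qed
  have gR: "d + 1 \<le> \<rho> x \<and> \<rho> x \<le> int n \<and> 0 \<le> s x \<and> g x = - \<rho> x - 2 * N * s x" if xR: "x \<in> R" for x
  proof -
    obtain y c where y: "d + 1 \<le> y" "y \<le> int n" "0 \<le> c" "g x = - y - 2 * N * c"
      using perm_above_cases[OF wi de(1,2) udi, of x] ud(1) ffix xR unfolding ww R_iff_g f_def g_def by auto
    then have "- g x = y + 2 * N * c" by simp
    then have "\<rho> x = y" "s x = c" unfolding \<rho>_def s_def using modq[of y c] y de by simp_all
    then show ?thesis using y by simp
  qed
  have g\<pi>: "g (\<pi> x) = - x - 2 * N * t x" if "x \<in> R" for x
  proof -
    have "x = g (- \<pi> x - 2 * N * t x)" using gf[of x] fR[OF that] by simp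
    then show ?thesis unfolding gper by simp
  qed
  have f\<rho>: "f (\<rho> x) = - x - 2 * N * s x" if "x \<in> R" for x
  proof -
    have "x = f (- \<rho> x - 2 * N * s x)" using fg[of x] gR[OF that] by simp
    then show ?thesis unfolding fper by simp
  qed
  have \<pi>R: "\<pi> x \<in> R" "\<rho> (\<pi> x) = x" "s (\<pi> x) = t x" if "x \<in> R" for x
  proof -
    have x: "d + 1 \<le> x" "x \<le> int n" using that R_iff by auto
    have "0 \<le> 2 * N * t x" using fR[OF that] by simp
    then have "g (\<pi> x) \<noteq> \<pi> x" using g\<pi>[OF that] fR[OF that] x de by linarith
    then show "\<pi> x \<in> R" using fR[OF that] R_iff_g by blast
    have "- g (\<pi> x) = x + 2 * N * t x" using g\<pi>[OF that] by simp
    then show "\<rho> (\<pi> x) = x" "s (\<pi> x) = t x" unfolding \<rho>_def s_def using modq[of x "t x"] x de by simp_all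
  qed
  have \<rho>R: "\<rho> x \<in> R" "\<pi> (\<rho> x) = x" "t (\<rho> x) = s x" if "x \<in> R" for x
  proof -
    have x: "d + 1 \<le> x" "x \<le> int n" using that R_iff by auto
    have "0 \<le> 2 * N * s x" using gR[OF that] by simp
    then have "f (\<rho> x) \<noteq> \<rho> x" using f\<rho>[OF that] gR[OF that] x de by linarith
    then show "\<rho> x \<in> R" using gR[OF that] R_iff by blast
    have "- f (\<rho> x) = x + 2 * N * s x" using f\<rho>[OF that] by simp
    then show "\<pi> (\<rho> x) = x" "t (\<rho> x) = s x" unfolding \<pi>_def t_def using modq[of x "s x"] x de by simp_all
  qed
  (* Below a moving point nothing is fixed: the top horizontal lines form an upper segment. *)
  have down: "y \<in> R" if "x \<in> R" "d + 1 \<le> y" "y \<le> x" for x y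
  proof (rule ccontr)
    assume "y \<notin> R"
    then have "f y = y" using that R_iff by auto
    then have "x \<le> f x" using fstep[of y x] that R_iff[of x] by auto
    moreover have "0 \<le> 2 * N * t x" using fR[OF that(1)] by simp
    ultimately show False using fR[OF that(1)] R_iff[of x] that(1) de by linarith
  qed
  have mult: "1 \<le> k \<Longrightarrow> 2 * N \<le> 2 * N * k" for k using mult_left_mono[of 1 k "2 * N"] by auto
  have tmono: "t y \<le> t x" "s y \<le> s x" if "x \<in> R" "y \<in> R" "x \<le> y" for x y
  proof -
    have "d + 1 \<le> x" "y \<le> N" using that(1,2) R_iff[of x] R_iff[of y] by auto
    then have "f x + (y - x) \<le> f y" "g x + (y - x) \<le> g y" using fstep gstep that(3) by blast+
    moreover define K where "K = 2 * N"
    then have K: "K = 2 * int n + 2" by simp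
    have "f x = - \<pi> x - K * t x" "f y = - \<pi> y - K * t y" "\<pi> x \<le> int n" "d + 1 \<le> \<pi> y"
      "g x = - \<rho> x - K * s x" "g y = - \<rho> y - K * s y" "\<rho> x \<le> int n" "d + 1 \<le> \<rho> y"
      using fR gR that(1,2) unfolding K_def by blast+
    ultimately have "K * t y - K * t x < K" "K * s y - K * s x < K"
      using that(3) de K by linarith+
    then have "2 * N * (t y - t x) < 2 * N" "2 * N * (s y - s x) < 2 * N"
      unfolding K_def by (simp_all only: right_diff_distrib)
    then show "t y \<le> t x" "s y \<le> s x" using mult[of "t y - t x"] mult[of "s y - s x"] by linarith+
  qed
  (* Superlevel sets of t and s are initial segments of R with equally many elements. *)
  have st: "s x = t x" if x: "x \<in> R" for x
  proof -
    have eq: "{x \<in> R. c \<le> t x} = {x \<in> R. c \<le> s x}" for c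
    proof (rule down_closed_eq[of R])
      show "finite R" by (rule fin)
      have "bij_betw \<pi> {x \<in> R. c \<le> t x} {x \<in> R. c \<le> s x}"
        by (rule bij_betw_byWitness[where f' = \<rho>]) (use \<pi>R \<rho>R in auto)
      then show "card {x \<in> R. c \<le> t x} = card {x \<in> R. c \<le> s x}" by (rule bij_betw_same_card)
      show "y \<in> {x \<in> R. c \<le> t x}" if "x \<in> {x \<in> R. c \<le> t x}" "y \<in> R" "y \<le> x" for x y
        using that tmono(1)[of y x] by auto
      show "y \<in> {x \<in> R. c \<le> s x}" if "x \<in> {x \<in> R. c \<le> s x}" "y \<in> R" "y \<le> x" for x y
        using that tmono(2)[of y x] by auto
    qed auto
    show ?thesis using eq[of "t x"] eq[of "s x"] x by (auto intro: antisym)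
  qed
  have t\<pi>: "t (\<pi> x) = t x" if "x \<in> R" for x using \<pi>R[OF that] st by metis
  have d1: "d + 1 \<in> R"
  proof -
    have "perm w (d + 1) < perm w d" using ud(1) de unfolding unique_descent_def by auto
    then show ?thesis using ffix[of d] de R_iff unfolding f_def by auto
  qed
  define b where "b = Max R"
  have "b \<in> R" unfolding b_def using fin d1 by (intro Max_in) auto
  have R_eq: "R = {d + 1..b}"
  proof (intro Set.equalityI subsetI)
    fix x assume "x \<in> R"
    then show "x \<in> {d + 1..b}" using R_iff Max_ge[OF fin] unfolding b_def by auto
  next
    fix x assume "x \<in> {d + 1..b}"
    then show "x \<in> R" using down[OF \<open>b \<in> R\<close>] by auto
  qed
  have b: "d + 1 \<le> b" "b \<le> int n" using \<open>b \<in> R\<close> R_iff by auto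
  (* Pass from levels of points, which increase upwards, to numbers of lines, counted downwards. *)
  define u v m where "u = nat (int n - b)" and "v = nat d" and "m = nat (b - d)"
  have uvm: "int u = int n - b" "int v = d" "int m = b - d" using b de unfolding u_def v_def m_def by auto
  have mid: "N - int i \<in> R \<longleftrightarrow> u < i \<and> i \<le> u + m" for i unfolding R_eq using uvm by auto
  define \<tau> where "\<tau> i = nat (t (N - int i))" for i :: nat
  have "\<tau> i \<le> \<tau> j" if "u < i" "i \<le> j" "j \<le> u + m" for i j
    unfolding \<tau>_def using tmono(1)[of "N - int j" "N - int i"] mid[of i] mid[of j] that by auto
  then obtain ps ts where ps: "length ts = length ps" "sum_list ps = m" "\<forall>p\<in>set ps. 1 \<le> p"
    "sorted_wrt (<) ts" "\<forall>j<length ps. \<forall>i\<in>block u ps j. \<tau> i = ts ! j"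
    using block_decomposition[of u m \<tau>] by blast
  have in_block: "N - int i \<in> R \<and> t (N - int i) = int (ts ! j)" if "j < length ps" "i \<in> block u ps j" for i j
  proof -
    have "N - int i \<in> R" using block_subset[OF that(1), of u] that(2) ps(2) mid by auto
    then show ?thesis using ps(5) that fR[of "N - int i"] unfolding \<tau>_def by force
  qed
  have distinct: "j = k" if "j < length ps" "k < length ps" "ts ! j = ts ! k" for j k
  proof (rule ccontr)
    assume "j \<noteq> k"
    then show False using sorted_wrt_nth_less[OF ps(4), of j k] sorted_wrt_nth_less[OF ps(4), of k j] that ps(1)
      by (cases "j < k") auto
  qed
  have rev: "\<pi> (N - int i) = N - int (block_rev u ps j i)" if j: "j < length ps" "i \<in> block u ps j" for i j
  proof -
    define A B where "A = u + sum_list (take j ps) + 1" and "B = u + sum_list (take (Suc j) ps)"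
    have block: "block u ps j = {A..B}" unfolding block_def A_def B_def by simp
    (* A block is exactly one level of t, so the permutation of the points maps it to itself. *)
    have level: "x \<in> R \<and> t x = int (ts ! j)" if "N - int B \<le> x" "x \<le> N - int A" for x
    proof -
      have "nat (N - x) \<in> block u ps j" "x = N - int (nat (N - x))" using that unfolding block by auto
      then show ?thesis using in_block[OF j(1)] by metis
    qed
    have from_level: "N - int B \<le> x \<and> x \<le> N - int A" if "x \<in> R" "t x = int (ts ! j)" for x
    proof -
      define k where "k = nat (N - x)"
      have x: "x = N - int k" using that(1) R_iff unfolding k_def by auto
      have "k \<in> {u + 1..u + sum_list ps}" using mid[of k] that(1) ps(2) unfolding x by auto
      then obtain j' where j': "j' < length ps" "k \<in> block u ps j'" using block_cover by blast
      then have "int (ts ! j') = int (ts ! j)" using in_block[OF j'] that(2) unfolding x by simp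
      then have "k \<in> block u ps j" using distinct[OF j'(1) j(1)] j'(2) by simp
      then show ?thesis unfolding x block by auto
    qed
    have "\<pi> x = (N - int B) + (N - int A) - x" if x: "N - int B \<le> x" "x \<le> N - int A" for x
    proof (rule decreasing_self_map[of "N - int B" "N - int A" \<pi> x, OF _ _ x])
      fix x assume "N - int B \<le> x" "x \<le> N - int A"
      then show "N - int B \<le> \<pi> x \<and> \<pi> x \<le> N - int A"
        using level \<pi>R(1) t\<pi> from_level by metis
    next
      fix x assume x: "N - int B \<le> x" "x < N - int A"
      then have *: "x \<in> R" "x + 1 \<in> R" "t x = t (x + 1)" using level[of x] level[of "x + 1"] by auto
      then show "\<pi> (x + 1) < \<pi> x"
        using fstep[of x "x + 1"] fR[OF *(1)] fR[OF *(2)] R_iff[of x] R_iff[of "x + 1"] by simp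
    qed
    from this[of "N - int i"] show ?thesis
      using j(2) unfolding block block_rev_def A_def[symmetric] B_def[symmetric] by auto
  qed
  have block_perm: "perm w (N - int i) = - (N - int (block_rev u ps j i)) - 2 * N * int (ts ! j)"
    if "j < length ps" "i \<in> block u ps j" for i j
    using fR[of "N - int i"] in_block[OF that] rev[OF that] unfolding f_def by simp
  have "w = B_positive_elt n u ps ts"
  proof (rule B_positive_eltI[OF w _ block_perm])
    show "u + sum_list ps \<le> n" using ps(2) uvm de by linarith
    fix i assume i: "i \<in> {1..n}" "\<And>j. j < length ps \<Longrightarrow> i \<notin> block u ps j"
    then have "N - int i \<notin> R" using block_cover[of i u ps] mid[of i] ps(2) by auto
    then show "perm w (N - int i) = N - int i"
      using R_iff[of "N - int i"] ffix[of "N - int i"] i(1) unfolding f_def by auto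
  qed
  moreover have "B_positive_data n u v ps ts"
  proof -
    have ne: "ps \<noteq> []" using ps(2) uvm b by auto
    then have last1: "1 \<le> last ps" using ps(3) by simp
    (* With a single line in the lowest bunch, the sum of the end roots would be twice a short root. *)
    have "last ps \<noteq> 1"
    proof
      assume one: "last ps = 1"
      let ?i = "u + m" and ?j = "length ps - 1"
      have "?i \<in> block u ps ?j" "block_rev u ps ?j ?i = ?i"
        using last_block[OF ne, of u] one ps(2) by auto
      moreover have "?j < length ps" using ne by simp
      ultimately have "\<pi> (N - int ?i) = N - int ?i" using rev by metis
      moreover have "N - int ?i = d + 1" using uvm by simp
      ultimately have "\<pi> (d + 1) = d + 1" by metis
      then have "g (d + 1) = - (d + 1) - 2 * N * t (d + 1)" using g\<pi>[OF d1] by simp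
      then have "g (d + 1) + (d + 1) = 2 * N * (- t (d + 1))" by simp
      then have "2 * N dvd g (d + 1) + (d + 1)" by (metis dvd_triv_left)
      then show False using last unfolding g_def ed by simp
    qed
    then have "2 \<le> last ps" using last1 by simp
    moreover have "last ps \<le> sum_list ps" using ne by (simp add: member_le_sum_list)
    ultimately show ?thesis unfolding B_positive_data_def using ps uvm de by auto
  qed
  ultimately show ?thesis unfolding B_positive_def by blast
qed


section \<open>B-positive elements are minimal\<close>

context
  fixes u v ps ts
  assumes data: "B_positive_data n u v ps ts"
begin

lemma B_data_facts: "1 \<le> v" "u + v + 2 \<le> n" "u + sum_list ps = n - v" "u + sum_list ps \<le> n" "2 \<le> last ps"
  "length ts = length ps" "sorted_wrt (<) ts" "ps \<noteq> []" "last ps \<le> sum_list ps"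
proof -
  show "1 \<le> v" "u + v + 2 \<le> n" "u + sum_list ps = n - v" "u + sum_list ps \<le> n" "2 \<le> last ps"
    "length ts = length ps" "sorted_wrt (<) ts"
    using data unfolding B_positive_data_def by auto
  show "ps \<noteq> []" using data unfolding B_positive_data_def by auto
  then show "last ps \<le> sum_list ps" by (simp add: member_le_sum_list)
qed

lemma B_data_block_iff: "(\<exists>j<length ps. i \<in> block u ps j) \<longleftrightarrow> u < i \<and> i \<le> n - v"
  using block_cover[of i u ps] block_subset[of _ ps u] B_data_facts(3) by fastforce

lemma B_data_vanish: "\<not> (u < i \<and> i \<le> n - v) \<Longrightarrow> B_positive_b u ps ts i = 0"
  using B_data_block_iff B_positive_b_outside by blast

lemma B_data_same_block:
  assumes "u < i" "i < n - v"
  obtains j j' where "j < length ps" "j' < length ps" "i \<in> block u ps j" "Suc i \<in> block u ps j'" "j \<le> j'"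
proof -
  obtain j j' where *: "j < length ps" "i \<in> block u ps j" "j' < length ps" "Suc i \<in> block u ps j'"
    using B_data_block_iff[of i] B_data_block_iff[of "Suc i"] assms by auto
  then have "\<not> j' < j" using block_less[of j' j "Suc i" u ps i] by auto
  then show thesis using that * by auto
qed

text \<open>
  On horizontal lines the permutation is the identity, and on the other lines it is negative. Inside
  a block the reversal followed by a sign increases, and passing to the next block upwards
  decreases the \<open>t\<close>-number, which adds at least one period \<open>2 N\<close>, more than the points over the \<open>n\<close>
  lines can differ by. The only drop is from the bottom horizontal lines to the lowest bunch.
\<close>

lemma unique_descent_B_positive: "unique_descent (B_positive_elt n u ps ts) (int v)"
proof -
  let ?f = "perm (B_positive_elt n u ps ts)"
  note wm = lattice_map_B_positive_elt[OF B_data_facts(4), of ts]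
  have inside: "\<exists>j<length ps. nat (N - x) \<in> block u ps j \<and>
      ?f x = - (N - int (block_rev u ps j (nat (N - x)))) - 2 * N * int (ts ! j) \<and> ?f x < 0"
    if x: "int v < x" "x < N - int u" for x
  proof -
    obtain j where j: "j < length ps" "nat (N - x) \<in> block u ps j"
      using B_data_block_iff[of "nat (N - x)"] x B_data_facts(2) by auto
    have "?f x = - (N - int (block_rev u ps j (nat (N - x)))) - 2 * N * int (ts ! j)"
      using perm_B_positive_block[OF B_data_facts(4) j, of ts] x by simp
    moreover have "block_rev u ps j (nat (N - x)) \<le> n"
      using block_in_range[OF B_data_facts(4) j(1) block_rev_in_block[OF j(2)]] by simp
    moreover have "0 \<le> 2 * N * int (ts ! j)" by simp
    ultimately have "?f x < 0" by linarith
    then show ?thesis using j \<open>?f x = _\<close> by blast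
  qed
  have outside: "?f x = x" if x: "0 \<le> x" "x \<le> N" "\<not> (int v < x \<and> x < N - int u)" for x
  proof -
    consider "x = 0" | "x = N" | "1 \<le> x" "x \<le> int n" using x by linarith
    then show ?thesis
    proof cases
      case 3
      define i where "i = nat (N - x)"
      have i: "i \<in> {1..n}" "x = N - int i" using 3 by (auto simp: i_def)
      have "\<not> (u < i \<and> i \<le> n - v)" using x(3) B_data_facts(2) unfolding i(2) by auto
      then have "\<And>j. j < length ps \<Longrightarrow> i \<notin> block u ps j" using B_data_block_iff by blast
      then show ?thesis using perm_B_positive_fixed[OF i(1)] i(2) by blast
    qed (use perm_zero[OF wm] perm_N[OF wm] in auto)
  qed
  show ?thesis unfolding unique_descent_def
  proof (intro allI impI)
    fix x assume x: "0 \<le> x \<and> x \<le> int n"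
    consider "x = int v" | "int v < x" "x + 1 < N - int u" | "int v < x" "x + 1 = N - int u"
      | "x < int v" | "N - int u \<le> x" by linarith
    then show "?f (x + 1) < ?f x \<longleftrightarrow> x = int v"
    proof cases
      case 1
      have "?f (x + 1) < 0" using inside[of "x + 1"] 1 B_data_facts(2) by auto
      moreover have "?f x = x" using outside[of x] 1 x by auto
      ultimately show ?thesis using 1 by simp
    next
      case 2
      have "?f x < ?f (x + 1)"
      proof -
        define i where "i = nat (N - x) - 1"
        have i: "nat (N - x) = Suc i" "nat (N - (x + 1)) = i" "u < i" "i < n - v"
          using 2 x B_data_facts(2) unfolding i_def by auto
        obtain j where j: "j < length ps" "Suc i \<in> block u ps j"
          "?f x = - (N - int (block_rev u ps j (Suc i))) - 2 * N * int (ts ! j)"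
          using inside[of x] 2 i by auto
        obtain j' where j': "j' < length ps" "i \<in> block u ps j'"
          "?f (x + 1) = - (N - int (block_rev u ps j' i)) - 2 * N * int (ts ! j')"
          using inside[of "x + 1"] 2 i by auto
        have "\<not> j < j'" using block_less[OF _ j(2) j'(2)] by auto
        show ?thesis
        proof (cases "j' = j")
          case True
          have "block_rev u ps j i = Suc (block_rev u ps j (Suc i))"
            using j(2) j'(2) True unfolding block_def block_rev_def by auto
          then show ?thesis using j(3) j'(3) True by simp
        next
          case False
          then have "ts ! j' < ts ! j"
            using \<open>\<not> j < j'\<close> sorted_wrt_nth_less[OF B_data_facts(7), of j' j] j(1) B_data_facts(6) by simp
          define K where "K = 2 * N"
          have K: "K = 2 * int n + 2" unfolding K_def by simp
          have "K * (int (ts ! j') + 1) \<le> K * int (ts ! j)"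
            using \<open>ts ! j' < ts ! j\<close> K by (intro mult_left_mono) auto
          then have "K * int (ts ! j') + K \<le> K * int (ts ! j)" by (simp add: distrib_left)
          moreover have "block_rev u ps j (Suc i) \<le> n" "1 \<le> block_rev u ps j' i"
            using block_in_range[OF B_data_facts(4) j(1) block_rev_in_block[OF j(2)]]
              block_in_range[OF B_data_facts(4) j'(1) block_rev_in_block[OF j'(2)]] by auto
          moreover have "?f x = - (N - int (block_rev u ps j (Suc i))) - K * int (ts ! j)"
            "?f (x + 1) = - (N - int (block_rev u ps j' i)) - K * int (ts ! j')"
            using j(3) j'(3) unfolding K_def by blast+
          ultimately show ?thesis using K by linarith
        qed
      qed
      then show ?thesis using 2 by simp
    next
      case 3
      have "?f x < 0" using inside[of x] 3 by auto
      moreover have "?f (x + 1) = x + 1" by (rule outside) (use 3 x in auto)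
      ultimately have "\<not> ?f (x + 1) < ?f x" using x by linarith
      then show ?thesis using 3(1) by blast
    next
      case 4
      have "?f x = x" "?f (x + 1) = x + 1" by (rule outside; use 4 x B_data_facts(2) in auto)+
      then have "\<not> ?f (x + 1) < ?f x" by linarith
      then show ?thesis using 4 by blast
    next
      case 5
      have "?f x = x" "?f (x + 1) = x + 1" by (rule outside; use 5 x B_data_facts(2) in auto)+
      then have "\<not> ?f (x + 1) < ?f x" by linarith
      moreover have "x \<noteq> int v" using 5 B_data_facts(2) by linarith
      ultimately show ?thesis by blast
    qed
  qed
qed

text \<open>
  The element is an involution, so its descent at \<open>v\<close> also determines the last root. With
  \<open>y = f (v + 1)\<close> the triple is formed by the points \<open>y < v < v + 1\<close>, which are sent to
  \<open>v + 1\<close>, \<open>v\<close> and \<open>y\<close>, so all three orders are reversed. The points \<open>y\<close> and \<open>v + 1\<close> lie over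
  different lines because the lowest bunch has at least two lines.
\<close>

lemma minimal_NGT_B_positive_elt: "minimal_NGT n (B_positive_elt n u ps ts)"
proof -
  let ?w = "B_positive_elt n u ps ts"
  let ?k = "n - v"
  have w: "?w \<in> lattice_group" by (rule B_positive_elt_in_lattice_group[OF B_data_facts(4)])
  have inv: "winv ?w = ?w" by (rule inv_unique_comp) (simp_all only: B_positive_elt_involution[OF B_data_facts(4)])
  have k: "?k \<le> n" "int n - int ?k = int v" using B_data_facts(2) by auto
  have ud: "\<forall>j\<le>n. descent ?w j \<longleftrightarrow> j = ?k"
    using unique_descent_iff[OF w, of ?k] unique_descent_B_positive k by simp
  let ?f = "perm ?w"
  define y where "y = ?f (int v + 1)"
  have fv: "?f (int v) = int v"
  proof -
    have "int v = N - int (n + 1 - v)" "n + 1 - v \<in> {1..n}" using B_data_facts(1,2) by auto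
    moreover have "\<And>j. j < length ps \<Longrightarrow> n + 1 - v \<notin> block u ps j"
      using B_data_block_iff[of "n + 1 - v"] B_data_facts(2) by auto
    ultimately show ?thesis using perm_B_positive_fixed[of "n + 1 - v" ps u ts] by metis
  qed
  have fy: "?f y = int v + 1" using perm_inv(1)[OF w, of "int v + 1"] unfolding inv y_def .
  define t where "t = ts ! (length ps - 1)"
  have y: "y = - (int v + int (last ps)) - 2 * N * int t"
  proof -
    have j: "length ps - 1 < length ps" "n - v \<in> block u ps (length ps - 1)"
      using B_data_facts last_block(1)[of ps u] by auto
    have "int (block_rev u ps (length ps - 1) (n - v)) = int n - int v + 1 - int (last ps)"
      using B_data_facts last_block(2)[of ps u "n - v"] by auto
    then have "N - int (block_rev u ps (length ps - 1) (n - v)) = int v + int (last ps)" by linarith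
    moreover have "int v + 1 = N - int (n - v)" using B_data_facts(2) by auto
    ultimately show ?thesis
      using perm_B_positive_block[OF B_data_facts(4) j, of ts] unfolding y_def t_def by (simp only:)
  qed
  have p: "2 \<le> int (last ps)" "int v + int (last ps) \<le> int n" using B_data_facts by linarith+
  have walls: "\<not> N dvd int v" "\<not> N dvd int v + 1" "\<not> N dvd y"
  proof -
    show "\<not> N dvd int v" "\<not> N dvd int v + 1" using not_dvd_between[of "int v" N] not_dvd_between[of "int v + 1" N] B_data_facts(1,2) by auto
    have "\<not> N dvd int v + int (last ps)" by (rule not_dvd_between) (use p B_data_facts(1) in auto)
    then have "\<not> N dvd - (int v + int (last ps))" by (simp only: dvd_minus_iff simp_thms)
    then show "\<not> N dvd y" unfolding y using dvd_wall[of "- (int v + int (last ps))" "- int t"]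
      by (simp only: mult_minus_right add_uminus_conv_diff simp_thms)
  qed
  have r\<alpha>: "root_pair (int v + 1) (int v)"
    using root_pair_consecutive[of "int v"] B_data_facts(2) by simp
  have r\<beta>: "root_pair (int v) y"
    using root_pair_perm[OF w r\<alpha>] root_pair_commute unfolding y_def fv by blast
  have r\<gamma>: "root_pair (int v + 1) y"
  proof -
    have "\<not> 2 * N dvd (2 * int v + 1 + int (last ps))"
      by (rule not_dvd_between) (use p B_data_facts(1,2) in auto)
    moreover have "\<not> 2 * N dvd int (last ps) - 1" by (rule not_dvd_between) (use p B_data_facts(1) in auto)
    then have "\<not> 2 * N dvd - (int (last ps) - 1)" by (simp only: dvd_minus_iff simp_thms)
    moreover have "int v + 1 - y = (2 * int v + 1 + int (last ps)) + 2 * N * int t"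
      "int v + 1 + y = - (int (last ps) - 1) + 2 * N * (- int t)" unfolding y by simp_all
    ultimately show ?thesis unfolding root_pair_def using walls dvd_period0 by metis
  qed
  have ylt: "y < int v"
  proof -
    have "0 \<le> 2 * N * int t" by simp
    then show ?thesis unfolding y using p by linarith
  qed
  have \<alpha>: "simple_root n ?k = vec (int v + 1) - vec (int v)" using simple_root_vec[OF k(1)] k(2) by simp
  have \<beta>: "- winv ?w (simple_root n ?k) = vec (int v) - vec y"
    unfolding inv \<alpha> apply_vec_diff[OF w] fv y_def by simp
  have "is_triple n ?w (- winv ?w (simple_root n ?k)) (vec (int v + 1) - vec y) (simple_root n ?k)"
    unfolding \<beta> unfolding \<alpha> is_triple_def
  proof (intro conjI)
    have mem: "vec a - vec c \<in> lambda_set n ?w" if "root_pair a c" "c < a" "?f a < ?f c" for a c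
      using that lambda_set_iff[OF w] apply_vec_diff[OF w] unfolding aff_roots_def
      by (auto simp: height_diff)
    have "vec (int v) - vec y \<in> lambda_set n ?w" by (rule mem[OF r\<beta> ylt]) (simp add: fv fy)
    moreover have "vec (int v + 1) - vec y \<in> lambda_set n ?w"
      by (rule mem[OF r\<gamma>]) (use ylt in \<open>simp_all add: fy y_def[symmetric]\<close>)
    moreover have "vec (int v + 1) - vec (int v) \<in> lambda_set n ?w"
      by (rule mem[OF r\<alpha>]) (use ylt in \<open>simp_all add: fv y_def[symmetric]\<close>)
    ultimately show "{vec (int v) - vec y, vec (int v + 1) - vec y, vec (int v + 1) - vec (int v)} \<subseteq> lambda_set n ?w"
      by blast
    show "vec (int v + 1) - vec (int v) + (vec (int v) - vec y) = vec (int v + 1) - vec y" by simp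
    show "form n (fst (vec (int v + 1) - vec (int v))) (fst (vec (int v + 1) - vec (int v))) =
        form n (fst (vec (int v + 1) - vec y)) (fst (vec (int v + 1) - vec y))"
      "form n (fst (vec (int v) - vec y)) (fst (vec (int v) - vec y)) =
        form n (fst (vec (int v + 1) - vec y)) (fst (vec (int v + 1) - vec y))"
      unfolding form_root_self[OF r\<alpha>] form_root_self[OF r\<beta>] form_root_self[OF r\<gamma>] using walls by simp_all
  qed
  then show ?thesis unfolding minimal_NGT_iff using w ud inv k(1) by metis
qed

end

section \<open>Factorization through longest elements\<close>

definition negate_above :: "nat \<Rightarrow> affvec \<Rightarrow> affvec" where
  "negate_above u a = ((\<lambda>i. if u < i \<and> i \<le> n then - fst a i else fst a i), snd a)"

lemma negate_above_simps [simp]: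
  "fst (negate_above u a) i = (if u < i \<and> i \<le> n then - fst a i else fst a i)"
  "snd (negate_above u a) = snd a"
  by (simp_all add: negate_above_def)

lemma linear_negate_above: "linear_map (negate_above u)"
  unfolding linear_map_def by (auto simp: prod_eq_iff fun_eq_iff)

lemma negate_above_coordinate: "negate_above u (eps i, 0) = (if u < i \<and> i \<le> n then (- eps i, 0) else (eps i, 0))"
  by (auto simp: prod_eq_iff fun_eq_iff eps_apply)

lemma negate_above_in_lattice_group: "negate_above u \<in> lattice_group"
proof (rule lattice_group_involution[OF lattice_mapI])
  show "linear_map (negate_above u)" by (rule linear_negate_above)
  show "negate_above u \<circ> negate_above u = id" by (auto simp: fun_eq_iff prod_eq_iff)
  show "negate_above u a = a" if "\<And>i. i \<in> {1..n} \<Longrightarrow> fst a i = 0" for a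
    using that by (auto simp: prod_eq_iff fun_eq_iff)
  fix i assume i: "i \<in> {1..n}"
  have "vec (- (N - int i)) = (- eps i, 0)" using vec_coordinate[OF i] by (simp only: vec_minus) simp
  then show "\<exists>y. negate_above u (eps i, 0) = vec y"
    using vec_coordinate[OF i] unfolding negate_above_coordinate by metis
qed

text \<open>
  Negating the coordinates \<open>u + 1, \<dots>, n\<close> makes all simple roots of \<open>\<Gamma>'\<close> negative, and the face functional
  does not involve these coordinates.
\<close>

lemma longest_upper: "longest n {u + 1..n} = negate_above u"
proof (rule longest_eqI)
  have "card ({i..n} - {u + 1..n}) = 0" if "u < i" for i
  proof -
    have "{i..n} - {u + 1..n} = {}" using that by auto
    then show ?thesis by simp
  qed
  then have "real (card ({i..n} - {u + 1..n})) * fst (negate_above u a) i =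
      real (card ({i..n} - {u + 1..n})) * fst a i" for a i by simp
  then show "face {u + 1..n} (negate_above u a) = face {u + 1..n} a" for a
    unfolding face_def by (simp only: negate_above_simps(2))
  fix j assume j: "j \<in> {u + 1..n}"
  have "fst (simple_root n j) i = 0" if "\<not> (u < i \<and> i \<le> n)" for i
    using j that by (auto simp: simple_root_def eps_apply)
  moreover have "snd (simple_root n j) = 0" using j by (simp add: simple_root_def)
  ultimately have "negate_above u (simple_root n j) = - simple_root n j"
    by (auto simp: prod_eq_iff fun_eq_iff)
  then show "descent (negate_above u) j" using height_simple_root[of j] j by (simp add: descent_def height_minus)
qed (use negate_above_in_lattice_group in auto)

text \<open>
  With all \<open>t\<close>-numbers equal to \<open>0\<close> there is no translation, so the nonaffine part is covered by what
  is known about B-positive elements.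
\<close>

lemma linear_part_eq:
  "(\<lambda>(z, \<zeta>). (B_positive_lin u ps z, \<zeta>)) = B_positive_elt n u ps (replicate (length ps) 0)"
proof -
  have "B_positive_b u ps (replicate (length ps) 0) = 0"
    by (auto simp: fun_eq_iff B_positive_b_apply intro!: sum.neutral)
  then show ?thesis unfolding B_positive_elt_apply by (auto simp: fun_eq_iff form_def B_positive_elt_apply)
qed

lemma parabolic_nonaffine:
  assumes "w \<in> lattice_group" "\<And>a. snd (w a) = snd a" shows "w \<in> parabolic n {1..n}"
proof -
  have "real (card ({i..n} - {1..n})) * x = 0" if "i \<in> {1..n}" for i x
  proof -
    have "{i..n} - {1..n} = {}" using that by auto
    then show ?thesis by (simp only: card.empty of_nat_0 mult_zero_left)
  qed
  then have "(\<Sum>i=1..n. real (card ({i..n} - {1..n})) * z i) = 0" for z by (intro sum.neutral) blast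
  moreover have "{0..n} - {1..n} = {0}" by auto
  ultimately have "face {1..n} a = snd a" for a unfolding face_def by simp
  then show ?thesis using assms parabolic_iff_face[of "{1..n}"] by auto
qed

lemma simple_root_fst: "1 \<le> j \<Longrightarrow> j \<le> n \<Longrightarrow> fst (simple_root n j) i = (if i = j then 1 else if i = j + 1 \<and> j < n then - 1 else 0)"
  by (auto simp: simple_root_def eps_apply)

lemma form_simple_root:
  "1 \<le> j \<Longrightarrow> j \<le> n \<Longrightarrow> form n b (fst (simple_root n j)) = (if j < n then 2 * (b j - b (j + 1)) else 2 * b n)"
  using rank by (auto simp: simple_root_def form_simps)

text \<open>
  The coefficients are the partial sums of the coordinates.
\<close>

lemma root_span_upper:
  assumes "\<And>i. \<not> (u < i \<and> i \<le> n) \<Longrightarrow> b i = 0"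
  shows "b \<in> root_span n {u + 1..n}"
proof -
  define c where "c j = (\<Sum>i\<in>{u + 1..j}. b i)" for j
  have "(\<Sum>j\<in>{u + 1..n}. smul (c j) (fst (simple_root n j))) k = b k" for k
  proof -
    have "(\<Sum>j\<in>{u + 1..n}. smul (c j) (fst (simple_root n j))) k =
        (\<Sum>j\<in>{u + 1..n}. (if j = k then c k else 0) - (if j = k - 1 then (if 1 \<le> k \<and> k \<le> n then c (k - 1) else 0) else 0))"
      unfolding sum_fun_apply smul_def by (rule sum.cong) (auto simp: simple_root_fst)
    also have "\<dots> = (if k \<in> {u + 1..n} then c k else 0) -
        (if k - 1 \<in> {u + 1..n} then (if 1 \<le> k \<and> k \<le> n then c (k - 1) else 0) else 0)"
      by (simp only: sum_subtractf sum.delta finite_atLeastAtMost)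
    also have "\<dots> = b k"
    proof (cases "u < k \<and> k \<le> n")
      case True
      then have "{u + 1..k} = insert k {u + 1..k - 1}" by auto
      moreover have "k \<notin> {u + 1..k - 1}" using True by auto
      ultimately have "c k = c (k - 1) + b k" unfolding c_def by (simp only: sum.insert finite_atLeastAtMost simp_thms add.commute)
      moreover have "c (k - 1) = 0" if "k - 1 \<notin> {u + 1..n}"
      proof -
        have "{u + 1..k - 1} = {}" using that True by auto
        then show ?thesis unfolding c_def by (simp only: sum.empty)
      qed
      ultimately show ?thesis using True by auto
    next
      case False
      then show ?thesis using assms[of k] by auto
    qed
    finally show ?thesis .
  qed
  then have "b = (\<Sum>j\<in>{u + 1..n}. smul (c j) (fst (simple_root n j)))" by auto
  then show ?thesis unfolding root_span_def by blast
qed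

lemma weight_latticeI:
  assumes "\<And>i. b i \<in> \<int>" "\<And>i. i \<notin> {1..n} \<Longrightarrow> b i = 0"
  shows "b \<in> weight_lattice n"
proof -
  have "copair n b \<alpha> \<in> \<int>" if root: "\<alpha> \<in> pos_roots n" for \<alpha>
  proof -
    consider (short) i where "\<alpha> = eps i" "i \<in> {1..n}"
      | (minus) i j where "\<alpha> = eps i - eps j" "i \<in> {1..n}" "j \<in> {1..n}" "i < j"
      | (plus) i j where "\<alpha> = eps i + eps j" "i \<in> {1..n}" "j \<in> {1..n}" "i < j"
      using root unfolding pos_roots_def by fastforce
    then show ?thesis
    proof cases
      case short
      then have "copair n b \<alpha> = 2 * b i" by (simp add: copair_def form_simps eps_apply)
      then show ?thesis using assms(1) by simp
    next
      case minus
      then have "copair n b \<alpha> = b i - b j" by (simp add: copair_def form_simps eps_apply)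
      then show ?thesis using assms(1) by simp
    next
      case plus
      then have "copair n b \<alpha> = b i + b j" by (simp add: copair_def form_simps eps_apply)
      then show ?thesis using assms(1) by simp
    qed
  qed
  moreover have "copair n b (- \<alpha>) = - copair n b \<alpha>" for \<alpha> by (simp add: copair_def form_simps)
  ultimately have "copair n b \<alpha> \<in> \<int>" if "\<alpha> \<in> roots n" for \<alpha> using that unfolding roots_def by auto
  then show ?thesis unfolding weight_lattice_def using assms(2) by blast
qed


context
  fixes u v ps ts
  assumes data: "B_positive_data n u v ps ts"
begin

lemma B_data_step:
  assumes "u < j" "j < n - v"
  shows "B_positive_b u ps ts (Suc j) \<le> B_positive_b u ps ts j"
proof -
  note facts = B_data_facts[OF data]
  obtain i i' where i: "i < length ps" "i' < length ps" "j \<in> block u ps i" "Suc j \<in> block u ps i'" "i \<le> i'"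
    using B_data_same_block[OF data assms] .
  have "ts ! i \<le> ts ! i'"
    using sorted_wrt_nth_less[OF facts(7), of i i'] i facts(6) by (cases "i = i'") auto
  then show ?thesis unfolding B_positive_b_block[OF i(1,3)] B_positive_b_block[OF i(2,4)] by simp
qed

lemma B_data_nonpos: "B_positive_b u ps ts i \<le> 0"
  by (cases "\<exists>j<length ps. i \<in> block u ps j") (use B_positive_b_block B_positive_b_outside in fastforce)+

text \<open>
  The coordinates of \<open>b\<close> are \<open>0\<close> on the top lines, then the decreasing sequence of the \<open>- t\<^sub>j\<close>, and
  again \<open>0\<close> on the bottom lines; the only increase is at \<open>n - v\<close>.
\<close>

lemma B_data_sign_conditions: "sign_conditions n (n - v) (B_positive_b u ps ts)"
proof -
  note facts = B_data_facts[OF data] and vanish = B_data_vanish[OF data]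
  have "form n (B_positive_b u ps ts) (fst (simple_root n j)) \<ge> 0" if j: "j \<in> {1..n}" "j \<noteq> n - v" for j
  proof -
    have "B_positive_b u ps ts (Suc j) \<le> B_positive_b u ps ts j" if "j < n"
    proof (cases "u < j \<and> j < n - v")
      case True
      then show ?thesis using B_data_step by blast
    next
      case False
      then show ?thesis using vanish[of j] B_data_nonpos[of "Suc j"] j by auto
    qed
    moreover have "B_positive_b u ps ts n = 0" using vanish[of n] facts by auto
    ultimately show ?thesis using form_simple_root[of j] j by auto
  qed
  moreover have "form n (B_positive_b u ps ts) (fst (simple_root n (n - v))) \<le> 0"
    using form_simple_root[of "n - v" "B_positive_b u ps ts"] B_data_nonpos[of "n - v"]
      vanish[of "n - v + 1"] facts by auto
  moreover have "form n (B_positive_b u ps ts) (eps 1) \<le> 0"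
    using form_eps[of 1 "B_positive_b u ps ts"] B_data_nonpos[of 1] rank by auto
  ultimately show ?thesis unfolding sign_conditions_def by blast
qed

lemma linear_part_coordinate:
  defines "L \<equiv> B_positive_elt n u ps (replicate (length ps) 0)"
  shows "j < length ps \<Longrightarrow> i \<in> block u ps j \<Longrightarrow> L (eps i, 0) = (- eps (block_rev u ps j i), 0)"
    and "i \<in> {1..n} \<Longrightarrow> \<not> (u < i \<and> i \<le> n - v) \<Longrightarrow> L (eps i, 0) = (eps i, 0)"
proof -
  note facts = B_data_facts[OF data]
  show "L (eps i, 0) = (- eps (block_rev u ps j i), 0)" if j: "j < length ps" "i \<in> block u ps j"
  proof -
    have "block_rev u ps j i \<in> {1..n}"
      using block_in_range[OF facts(4) j(1) block_rev_in_block[OF j(2)]] .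
    then have "vec (- (N - int (block_rev u ps j i))) = (- eps (block_rev u ps j i), 0)"
      by (simp only: vec_minus vec_coordinate) simp
    then show ?thesis unfolding L_def B_positive_elt_block[OF facts(4) j]
      by (simp only: nth_replicate[OF j(1)] of_nat_0 minus_zero mult_zero_right add_0_right)
  qed
  show "L (eps i, 0) = (eps i, 0)" if "i \<in> {1..n}" "\<not> (u < i \<and> i \<le> n - v)"
    unfolding L_def using B_positive_elt_fixed[OF that(1)] B_data_block_iff[OF data, of i] that(2) by blast
qed

text \<open>
  The simple roots in question join neighbouring lines of one bunch, and the bottom horizontal
  lines among themselves and with the bottom mirror. So the longest element reverses each bunch and
  negates the bottom lines, which is what remains of the nonaffine part after
  negating all coordinates from \<open>u + 1\<close> on. The face functional is constant on bunches and
  vanishes on the bottom lines.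
\<close>

lemma longest_stabilizer:
  "longest n {j \<in> {u + 1..n}. j \<noteq> n - v \<and> form n (B_positive_b u ps ts) (fst (simple_root n j)) = 0} =
    negate_above u \<circ> B_positive_elt n u ps (replicate (length ps) 0)" (is "longest n ?J = ?w")
proof -
  define J where "J = ?J"
  have "longest n J = ?w"
  proof (rule longest_eqI)
    note facts = B_data_facts[OF data]
    let ?L = "B_positive_elt n u ps (replicate (length ps) 0)"
    let ?b = "B_positive_b u ps ts"
    have L: "?L \<in> lattice_group" by (rule B_positive_elt_in_lattice_group[OF facts(4)])
    show J: "J \<subseteq> {0..n}" by (auto simp: J_def)
    show w: "?w \<in> lattice_group" by (rule lattice_group_comp[OF negate_above_in_lattice_group L])
    have inJ: "j \<in> J \<longleftrightarrow> u < j \<and> j \<le> n \<and> j \<noteq> n - v \<and> (if j < n then ?b j = ?b (j + 1) else ?b n = 0)" for j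
      unfolding J_def using form_simple_root[of j ?b] by (cases "1 \<le> j \<and> j \<le> n") auto
    (* The three kinds of lines: bunches, bottom horizontal lines, top horizontal lines. *)
    have low: "?w (eps i, 0) = (eps (block_rev u ps j i), 0)" if j: "j < length ps" "i \<in> block u ps j" for i j
    proof -
      have "u < block_rev u ps j i" "block_rev u ps j i \<le> n"
        using block_subset[OF j(1), of u] block_rev_in_block[OF j(2)] facts(4) by auto
      then have "negate_above u (- eps (block_rev u ps j i), 0) = (eps (block_rev u ps j i), 0)"
        by (auto simp: prod_eq_iff fun_eq_iff eps_apply)
      then show ?thesis using linear_part_coordinate(1)[OF j] by simp
    qed
    have high: "?w (eps i, 0) = (- eps i, 0)" if "n - v < i" "i \<le> n" for i
      using linear_part_coordinate(2)[of i] negate_above_coordinate[of u i] that facts by auto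
    have top: "?w (eps i, 0) = (eps i, 0)" if "1 \<le> i" "i \<le> u" for i
      using linear_part_coordinate(2)[of i] negate_above_coordinate[of u i] that facts by auto
    have same: "card ({i..n} - J) = card ({k..n} - J)"
      if j: "j < length ps" "i \<in> block u ps j" "k \<in> block u ps j" and ik: "i \<le> k" for i j k
    proof -
      have "l \<in> J" if l: "i \<le> l" "l < k" for l
      proof -
        have "l \<in> block u ps j" "l + 1 \<in> block u ps j" using j l unfolding block_def by auto
        then have "?b l = ?b (l + 1)" using B_positive_b_block[OF j(1)] by simp
        moreover have "u < l" "l < n - v"
          using l j block_subset[OF j(1), of u] facts(3) by (auto simp: subset_iff)
        ultimately show ?thesis using inJ[of l] by auto
      qed
      moreover have "{i..n} - S = {k..n} - S" if "\<And>l. i \<le> l \<Longrightarrow> l < k \<Longrightarrow> l \<in> S" for S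
      proof (rule Set.set_eqI)
        fix l show "l \<in> {i..n} - S \<longleftrightarrow> l \<in> {k..n} - S"
          using that[of l] ik by (cases "l < k"; cases "i \<le> l") auto
      qed
      ultimately have "{i..n} - J = {k..n} - J" by blast
      then show ?thesis by simp
    qed
    show "face J (?w a) = face J a" for a
    proof (induction a rule: span_induct)
      case (outer a)
      then show ?case using lattice_map_fix[OF lattice_group_map[OF w], of a] by auto
    next
      case (coordinate i)
      consider "\<exists>j<length ps. i \<in> block u ps j" | "n - v < i" | "i \<le> u"
        unfolding B_data_block_iff[OF data] by linarith
      then show ?case
      proof cases
        case 1
        then obtain j where j: "j < length ps" "i \<in> block u ps j" by blast
        let ?r = "block_rev u ps j i"
        have r: "?r \<in> block u ps j" using block_rev_in_block[OF j(2)] .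
        have "card ({i..n} - J) = card ({?r..n} - J)"
          using same[OF j(1) j(2) r] same[OF j(1) r j(2)] by (metis linorder_linear)
        then show ?thesis
          unfolding low[OF j] face_eps[OF coordinate] face_eps[OF block_in_range[OF facts(4) j(1) r]] by simp
      next
        case 2
        have "{i..n} - J = {}"
        proof -
          have "l \<in> J" if "i \<le> l" "l \<le> n" for l
            using inJ[of l] B_data_vanish[OF data, of l] B_data_vanish[OF data, of "l + 1"] that 2 facts by auto
          then show ?thesis by auto
        qed
        then have "card ({i..n} - J) = 0" by (simp only: card.empty)
        then have "face J (eps i, 0) = 0" using face_eps[OF coordinate, of J] by (simp only: of_nat_0)
        moreover have "?w (eps i, 0) = - (eps i, 0)" using high[of i] 2 coordinate by simp
        ultimately show ?thesis using face_minus[of J "(eps i, 0)"] by (simp only: neg_0_equal_iff_equal)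
      next
        case 3
        then show ?thesis using top[of i] coordinate by simp
      qed
    next
      case (add a b)
      then show ?case by (simp only: linear_map_add[OF lattice_group_linear[OF w]] face_add)
    next
      case (scale c a)
      then show ?case by (simp only: linear_map_scale[OF lattice_group_linear[OF w]] face_scale)
    qed
    fix j assume j: "j \<in> J"
    then have jn: "u < j" "j \<le> n" "j \<noteq> n - v" using inJ by blast+
    have "height (?w (simple_root n j)) = - 1"
    proof (cases "j < n - v")
      case False
      then have "n - v < j" using jn by simp
      have "?w (simple_root n j) = - simple_root n j"
      proof (cases "j = n")
        case True
        then have "simple_root n j = (eps n, 0)" using rank by (simp add: simple_root_def)
        then show ?thesis using high[of n] facts True by simp
      next
        case False
        then have "simple_root n j = (eps j, 0) - (eps (j + 1), 0)" using jn by (simp add: simple_root_def)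
        then show ?thesis using high[of j] high[of "j + 1"] \<open>n - v < j\<close> jn False
          by (simp only: linear_map_diff[OF lattice_group_linear[OF w]]) simp
      qed
      then show ?thesis using height_simple_root[of j] jn by (simp only: height_minus)
    next
      case True
      obtain i i' where i: "i < length ps" "i' < length ps" "j \<in> block u ps i" "Suc j \<in> block u ps i'"
        using B_data_same_block[OF data jn(1) True] .
      have "?b j = ?b (j + 1)" using inJ[of j] j True by auto
      then have "ts ! i = ts ! i'" using B_positive_b_block[OF i(1) i(3), of ts] B_positive_b_block[OF i(2) i(4), of ts] by simp
      then have eq: "i' = i" using sorted_wrt_nth_inject[OF facts(7)] i facts(6) by metis
      let ?r = "block_rev u ps i"
      have r: "?r j = Suc (?r (Suc j))" using i(3,4) unfolding eq block_def block_rev_def by auto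
      have rn: "?r j \<in> {1..n}" "?r (Suc j) \<in> {1..n}"
        using block_in_range[OF facts(4) i(1)] block_rev_in_block i(3,4) eq by blast+
      have "j < n" using True by linarith
      then have "simple_root n j = (eps j, 0) - (eps (Suc j), 0)" using jn by (simp add: simple_root_def)
      then have "?w (simple_root n j) = (eps (?r j), 0) - (eps (?r (Suc j)), 0)"
        using low[OF i(1,3)] low[OF i(1), of "Suc j"] i(4) eq
        by (simp only: linear_map_diff[OF lattice_group_linear[OF w]])
      then have "height (?w (simple_root n j)) = height (eps (?r j), 0) - height (eps (?r (Suc j)), 0)"
        by (simp only: height_diff)
      then show ?thesis unfolding height_eps[OF rn(1)] height_eps[OF rn(2)] using r by simp
    qed
    then show "descent ?w j" unfolding descent_def by simp
  qed
  then show ?thesis unfolding J_def .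
qed

end

text \<open>
  The longest element of \<open>\<Gamma>'\<close> is the negation of the coordinates \<open>u + 1, \<dots>, n\<close>. Multiplied by the
  longest element of the stabilizer of \<open>b\<close>, the two negations cancel and leave the involution that
  is the nonaffine part of the B-positive element.
\<close>

lemma B_positive_decomposition:
  assumes data: "B_positive_data n u v ps ts"
  shows "let w' = B_positive_elt n u ps ts; k = n - v; \<Gamma>' = {u + 1..n} in
          (\<exists>b \<in> weight_lattice n. \<exists>w \<in> parabolic n {1..n}.
             w' = translation n b \<circ> w \<and>
             b \<in> root_span n \<Gamma>' \<and>
             sign_conditions n k b \<and>
             sign_conditions n k (varsigma n \<Gamma>' b) \<and>
             w' = translation n b \<circ>
               inv_into UNIV (longest n \<Gamma>' \<circ>
                 longest n {j \<in> \<Gamma>'. j \<noteq> k \<and> form n b (fst (simple_root n j)) = 0})) \<and>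
          minimal_NGT n w'"
proof -
  note facts = B_data_facts[OF data] and vanish = B_data_vanish[OF data]
  let ?b = "B_positive_b u ps ts" and ?L = "B_positive_elt n u ps (replicate (length ps) 0)"
  have L: "?L \<in> lattice_group" by (rule B_positive_elt_in_lattice_group[OF facts(4)])
  have W: "B_positive_elt n u ps ts = translation n ?b \<circ> ?L"
    unfolding B_positive_elt_def[of n u ps ts] linear_part_eq ..
  have off: "?b i = 0" if "\<not> (u < i \<and> i \<le> n)" for i by (rule vanish) (use that in auto)
  have weight: "?b \<in> weight_lattice n"
  proof (rule weight_latticeI)
    show "?b i \<in> \<int>" for i
      by (cases "\<exists>j<length ps. i \<in> block u ps j") (use B_positive_b_block B_positive_b_outside in fastforce)+
    show "?b i = 0" if "i \<notin> {1..n}" for i using off[of i] that by auto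
  qed
  have par: "?L \<in> parabolic n {1..n}"
    by (rule parabolic_nonaffine[OF L]) (simp only: linear_part_eq[symmetric] split_beta snd_conv)
  have varsigma: "varsigma n {u + 1..n} ?b = ?b"
    unfolding varsigma_def longest_upper using off by (auto simp: fun_eq_iff)
  have span: "?b \<in> root_span n {u + 1..n}" using off by (rule root_span_upper)
  have longest: "winv (longest n {u + 1..n} \<circ> longest n {j \<in> {u + 1..n}. j \<noteq> n - v \<and> form n ?b (fst (simple_root n j)) = 0}) = ?L"
  proof -
    have "negate_above u \<circ> negate_above u = id" by (auto simp: fun_eq_iff prod_eq_iff)
    then have "negate_above u \<circ> (negate_above u \<circ> ?L) = ?L" by (metis comp_assoc id_comp)
    moreover have "winv ?L = ?L" by (rule inv_unique_comp) (simp_all only: B_positive_elt_involution[OF facts(4)])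
    ultimately show ?thesis unfolding longest_upper longest_stabilizer[OF data] by (simp only:)
  qed
  show ?thesis
    unfolding Let_def
  proof (intro conjI bexI[where x = ?b] bexI[where x = ?L])
    show "B_positive_elt n u ps ts = translation n ?b \<circ> winv (longest n {u + 1..n} \<circ>
        longest n {j \<in> {u + 1..n}. j \<noteq> n - v \<and> form n ?b (fst (simple_root n j)) = 0})"
      unfolding longest by (rule W)
    show "sign_conditions n (n - v) (varsigma n {u + 1..n} ?b)"
      unfolding varsigma by (rule B_data_sign_conditions[OF data])
  qed (rule W span weight par B_data_sign_conditions[OF data] minimal_NGT_B_positive_elt[OF data])+
qed


section \<open>The automorphism of the affine Dynkin diagram\<close>

text \<open>
  Exchanges the two mirrors, \<open>x \<mapsto> N - x\<close> on points. The vectors \<open>vec x\<close> are attached to the bottom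
  mirror by their oddness and are not permuted by this map, whence the shift by \<open>[0, 1]\<close> in
  \<open>flip_vec\<close>; conjugation by it preserves the group.
\<close>

definition flip :: "affvec \<Rightarrow> affvec" where
  "flip a = ((\<lambda>i. if i \<in> {1..n} then - fst a (n + 1 - i) else fst a i), snd a + (\<Sum>i=1..n. fst a i))"

lemma sum_reflect: "(\<Sum>i=1..n. g (n + 1 - i)) = (\<Sum>i=1..n. g i)" for g :: "nat \<Rightarrow> real"
  using sum.atLeastAtMost_rev[of g 1 n] by (simp add: add.commute)

lemma flip_flip: "flip (flip a) = a"
proof -
  have "(\<Sum>i=1..n. fst (flip a) i) = - (\<Sum>i=1..n. fst a (n + 1 - i))"
    by (simp add: flip_def sum_negf)
  then show ?thesis unfolding sum_reflect by (auto simp: flip_def prod_eq_iff fun_eq_iff)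
qed

lemma linear_flip: "linear_map flip"
  unfolding linear_map_def by (auto simp: flip_def prod_eq_iff fun_eq_iff sum.distrib sum_distrib_left algebra_simps)

lemma height_flip: "height (flip a) = height a"
proof -
  have "(\<Sum>i=1..n. of_int (N - int i) * fst (flip a) i) = (\<Sum>i=1..n. - (real (n + 1 - i) * fst a (n + 1 - i)))"
    by (rule sum.cong) (auto simp: flip_def of_nat_diff)
  also have "\<dots> = - (\<Sum>i=1..n. real i * fst a i)"
    using sum_reflect[of "\<lambda>i. - (real i * fst a i)"] by (simp add: sum_negf)
  finally show ?thesis unfolding height_def
    by (simp add: flip_def algebra_simps sum.distrib sum_subtractf sum_distrib_left)
qed

lemma flip_vec: "flip (vec x) = vec (x - N) + (0, 1)"
proof (rule affvec_eqI)
  show "fst (flip (vec x)) = fst (vec (x - N) + (0, 1))"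
  proof
    fix i
    show "fst (flip (vec x)) i = fst (vec (x - N) + (0, 1)) i"
    proof (cases "i \<in> {1..n}")
      case True
      then have i: "n + 1 - i \<in> {1..n}" "N - int (n + 1 - i) = int i" by auto
      have "fst (flip (vec x)) i = of_bool (2 * N dvd x + int i) - of_bool (2 * N dvd x - int i)"
        using True fst_vec[of x "n + 1 - i"] unfolding i(2) by (simp only: flip_def fst_conv i(1) if_True minus_diff_eq)
      moreover have e: "x - N - (N - int i) = (x + int i) + 2 * N * (- 1)" "x - N + (N - int i) = x - int i" by simp_all
      have "fst (vec (x - N)) i = of_bool (2 * N dvd x + int i) - of_bool (2 * N dvd x - int i)"
        using True unfolding fst_vec e dvd_period0 by (simp only: if_True)
      ultimately show ?thesis by simp
    next
      case False
      then show ?thesis by (simp only: flip_def fst_conv fst_vec fst_add plus_fun_apply if_False) simp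
    qed
  qed
  show "height (flip (vec x)) = height (vec (x - N) + (0, 1))"
    by (simp add: height_flip height_add)
qed

lemma flip_simple_root: "j \<le> n \<Longrightarrow> flip (simple_root n j) = simple_root n (n - j)"
proof -
  assume j: "j \<le> n"
  have "flip (simple_root n j) = vec (int n - int j + 1 - N) - vec (int n - int j - N)"
    unfolding simple_root_vec[OF j] linear_map_diff[OF linear_flip] flip_vec by simp
  also have "\<dots> = vec (- int j) - vec (- (int j + 1))" by simp
  also have "\<dots> = vec (int j + 1) - vec (int j)" unfolding vec_minus by simp
  also have "\<dots> = simple_root n (n - j)" using simple_root_vec[of "n - j"] j by simp
  finally show ?thesis .
qed

lemma flip_simple_refl: "j \<le> n \<Longrightarrow> flip \<circ> simple_refl n j \<circ> flip = simple_refl n (n - j)"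
proof
  assume j: "j \<le> n"
  fix a
  have "copair n (fst (flip a)) (fst (simple_root n j)) = copair n (fst a) (fst (simple_root n (n - j)))"
  proof -
    have fl: "fst (flip a) i = - fst a (n + 1 - i)" if "i \<in> {1..n}" for i using that by (simp add: flip_def)
    consider "j = 0" | "0 < j" "j < n" | "j = n" using j by linarith
    then show ?thesis
    proof cases
      case 1
      then show ?thesis using fl[of 1] rank by (simp add: copair_simple)
    next
      case 2
      then have "n + 1 - j = (n - j) + 1" "n + 1 - (j + 1) = n - j" by auto
      then show ?thesis using fl[of j] fl[of "j + 1"] 2 by (simp add: copair_simple)
    next
      case 3
      then show ?thesis using fl[of n] rank by (simp add: copair_simple)
    qed
  qed
  then show "(flip \<circ> simple_refl n j \<circ> flip) a = simple_refl n (n - j) a"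
    by (simp add: simple_refl_eq linear_map_diff linear_flip linear_map_scale flip_simple_root j flip_flip)
qed

definition flip_conj :: "(affvec \<Rightarrow> affvec) \<Rightarrow> affvec \<Rightarrow> affvec" where
  "flip_conj w = flip \<circ> w \<circ> flip"

lemma flip_conj_comp: "flip_conj (v \<circ> w) = flip_conj v \<circ> flip_conj w"
  by (simp add: flip_conj_def fun_eq_iff flip_flip)

lemma flip_conj_flip_conj: "flip_conj (flip_conj w) = w"
  by (simp add: flip_conj_def fun_eq_iff flip_flip)

lemma flip_conj_id: "flip_conj id = id"
  by (simp add: flip_conj_def fun_eq_iff flip_flip)

lemma flip_conj_in_lattice_group: "w \<in> lattice_group \<Longrightarrow> flip_conj w \<in> lattice_group"
proof -
  assume "w \<in> lattice_group"
  then obtain "is" where "is": "set is \<subseteq> {0..n}" "w = word n is"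
    using parabolic_eq_words[of "{0..n}"] parabolic_full by auto
  have "set is \<subseteq> {0..n} \<Longrightarrow> flip_conj (word n is) \<in> lattice_group" for "is"
  proof (induction "is")
    case Nil
    then show ?case by (simp only: word.simps flip_conj_id lattice_group_id)
  next
    case (Cons i "is")
    have "flip_conj (simple_refl n i) = simple_refl n (n - i)"
      using flip_simple_refl[of i] Cons.prems by (simp add: flip_conj_def)
    moreover have "flip_conj (word n is) \<in> lattice_group" using Cons by simp
    moreover have "simple_refl n (n - i) \<in> lattice_group" by (simp add: simple_refl_in_lattice_group)
    ultimately show ?case by (simp only: word.simps flip_conj_comp lattice_group_comp)
  qed
  then show ?thesis using "is" by blast
qed

text \<open>
  By oddness the right-hand side is \<open>N - f (N - x)\<close>.
\<close>

lemma perm_flip_conj: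
  assumes "w \<in> lattice_group"
  shows "perm (flip_conj w) x = perm w (x - N) + N"
proof (rule perm_eqI)
  note lin = lattice_group_linear[OF assms] and wm = lattice_group_map[OF assms]
  have const: "w (0, 1) = (0, 1)" by (rule lattice_map_fix[OF wm]) simp
  have fconst: "flip (0, 1) = (0, 1)" by (simp add: flip_def fun_eq_iff)
  have "flip_conj w (vec x) = flip (vec (perm w (x - N)) + (0, 1))"
    unfolding flip_conj_def by (simp add: flip_vec linear_map_add[OF lin] const apply_vec[OF wm])
  also have "\<dots> = vec (perm w (x - N) - N) + (0, 2 * of_int 1)"
    by (simp add: linear_map_add[OF linear_flip] fconst flip_vec)
  also have "\<dots> = vec (perm w (x - N) + N)"
    unfolding vec_period[symmetric] by simp
  finally show "flip_conj w (vec x) = vec (perm w (x - N) + N)" .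
qed

lemma winv_flip_conj: "w \<in> lattice_group \<Longrightarrow> winv (flip_conj w) = flip_conj (winv w)"
  by (rule inv_unique_comp) (simp_all only: flip_conj_comp[symmetric] lattice_group_inv_comp flip_conj_id)

lemma unique_descent_flip_conj:
  assumes "w \<in> lattice_group" "unique_descent w d"
  shows "unique_descent (flip_conj w) (int n - d)"
  unfolding unique_descent_def
proof (intro allI impI)
  fix x assume x: "0 \<le> x \<and> x \<le> int n"
  note wm = lattice_group_map[OF assms(1)]
  have e: "x + 1 - N = - (int n - x)" "x - N = - (int n - x + 1)" by simp_all
  have "perm w (x + 1 - N) = - perm w (int n - x)" "perm w (x - N) = - perm w (int n - x + 1)"
    unfolding e by (rule perm_minus[OF wm])+
  then have "perm (flip_conj w) (x + 1) < perm (flip_conj w) x \<longleftrightarrow> perm w (int n - x + 1) < perm w (int n - x)"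
    unfolding perm_flip_conj[OF assms(1)] by simp
  also have "\<dots> \<longleftrightarrow> int n - x = d" using assms(2) x unfolding unique_descent_def by auto
  finally show "perm (flip_conj w) (x + 1) < perm (flip_conj w) x \<longleftrightarrow> x = int n - d" by auto
qed

lemma carrier_affine_weyl: "carrier (affine_weyl n) = lattice_group"
  by (simp add: affine_weyl_def parabolic_full)

lemma mult_affine_weyl:
  "v \<in> lattice_group \<Longrightarrow> w \<in> lattice_group \<Longrightarrow> v \<otimes>\<^bsub>affine_weyl n\<^esub> w = v \<circ> w"
  using lattice_group_bij[of v] lattice_group_bij[of w]
  by (auto simp: affine_weyl_def BijGroup_def Bij_def compose_def)

text \<open>
  Conjugation with the exchange of mirrors is an automorphism with the required values on the
  simple reflections, and these generate the group.
\<close>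

lemma iota_B_eq: "w \<in> lattice_group \<Longrightarrow> iota_B n w = flip_conj w"
proof -
  assume w: "w \<in> lattice_group"
  let ?\<Phi> = "restrict flip_conj lattice_group"
  have gen: "flip_conj (simple_refl n i) = simple_refl n (n - i)" if "i \<le> n" for i
    using flip_simple_refl[OF that] by (simp add: flip_conj_def)
  have "iota_B n = ?\<Phi>"
    unfolding iota_B_def
  proof (rule the_equality)
    have "bij_betw ?\<Phi> lattice_group lattice_group"
      by (rule bij_betw_byWitness[where f' = flip_conj])
        (auto simp: flip_conj_flip_conj flip_conj_in_lattice_group)
    moreover have "?\<Phi> \<in> hom (affine_weyl n) (affine_weyl n)"
      by (rule homI) (simp_all add: carrier_affine_weyl mult_affine_weyl flip_conj_in_lattice_group
          lattice_group_comp flip_conj_comp del: comp_apply)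
    ultimately show "?\<Phi> \<in> auto (affine_weyl n) \<and> (\<forall>i\<le>n. ?\<Phi> (simple_refl n i) = simple_refl n (n - i))"
      using gen simple_refl_in_lattice_group by (simp add: auto_def Bij_def carrier_affine_weyl)
  next
    fix \<phi> assume "\<phi> \<in> auto (affine_weyl n) \<and> (\<forall>i\<le>n. \<phi> (simple_refl n i) = simple_refl n (n - i))"
    then have hom: "\<phi> \<in> hom (affine_weyl n) (affine_weyl n)" and ext: "\<phi> \<in> extensional lattice_group"
      and \<phi>: "\<And>i. i \<le> n \<Longrightarrow> \<phi> (simple_refl n i) = simple_refl n (n - i)"
      by (auto simp: auto_def Bij_def carrier_affine_weyl)
    have closed: "\<phi> v \<in> lattice_group" if "v \<in> lattice_group" for v
      using hom_in_carrier[OF hom, of v] that by (simp only: carrier_affine_weyl)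
    have comp: "\<phi> (v \<circ> w) = \<phi> v \<circ> \<phi> w" if "v \<in> lattice_group" "w \<in> lattice_group" for v w
      using hom_mult[OF hom, of v w] that closed[OF that(1)] closed[OF that(2)]
      by (simp only: carrier_affine_weyl mult_affine_weyl)
    (* The identity is the square of a generator. *)
    have id: "\<phi> id = id"
    proof -
      have "\<phi> (simple_refl n 0 \<circ> simple_refl n 0) = \<phi> (simple_refl n 0) \<circ> \<phi> (simple_refl n 0)"
        using comp simple_refl_in_lattice_group[of 0] by blast
      then show ?thesis using \<phi>[of 0] by (simp only: simple_refl_involution le0 order_refl diff_zero)
    qed
    have "set is \<subseteq> {0..n} \<Longrightarrow> \<phi> (word n is) = flip_conj (word n is)" for "is"
    proof (induction "is")
      case Nil
      then show ?case by (simp only: word.simps flip_conj_id id)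
    next
      case (Cons i "is")
      then have i: "i \<le> n" "set is \<subseteq> {0..n}" by auto
      have "\<phi> (word n is \<circ> simple_refl n i) = \<phi> (word n is) \<circ> \<phi> (simple_refl n i)"
        using comp word_in_lattice_group[OF i(2)] simple_refl_in_lattice_group[OF i(1)] by blast
      then show ?case using Cons.IH[OF i(2)] \<phi>[OF i(1)] gen[OF i(1)]
        by (simp only: word.simps flip_conj_comp)
    qed
    then have "\<phi> w = flip_conj w" if "w \<in> lattice_group" for w
      using that parabolic_eq_words[of "{0..n}"] parabolic_full by auto
    then show "\<phi> = ?\<Phi>" using ext by (intro extensionalityI[of _ lattice_group]) auto
  qed
  then show ?thesis using w by simp
qed

section \<open>The classification\<close>

lemma B_positive_properties:
  assumes "B_positive n w"
  shows "minimal_NGT n w" "w \<in> lattice_group" "w \<circ> w = id"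
proof -
  obtain u v ps ts where data: "B_positive_data n u v ps ts" and w: "w = B_positive_elt n u ps ts"
    using assms unfolding B_positive_def by blast
  show "minimal_NGT n w" "w \<in> lattice_group" "w \<circ> w = id"
    unfolding w using minimal_NGT_B_positive_elt[OF data] B_positive_elt_in_lattice_group
      B_positive_elt_involution B_data_facts(4)[OF data] by blast+
qed

text \<open>
  If the upper ends of the descents match, exchanging the mirrors turns them into lower ends.
\<close>

lemma minimal_NGT_classification:
  assumes "minimal_NGT n w"
  shows "(B_positive n w \<or> (\<exists>w'. B_positive n w' \<and> minimal_NGT n w' \<and> w = iota_B n w')) \<and> w \<circ> w = id"
  using assms
proof (cases rule: minimal_NGT_cases)
  case (low d e)
  then have "B_positive n w" by (rule low_ends_B_positive)
  then show ?thesis using B_positive_properties(3) by blast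
next
  case (high d e)
  note w = high(1)
  note wim = lattice_group_map[OF lattice_group_inv[OF w]]
  let ?w = "flip_conj w"
  have w': "?w \<in> lattice_group" by (rule flip_conj_in_lattice_group[OF w])
  have perm': "perm (winv ?w) x = N - perm (winv w) (N - x)" for x
    using perm_minus[OF wim, of "N - x"]
    unfolding winv_flip_conj[OF w] perm_flip_conj[OF lattice_group_inv[OF w]] by simp
  have "B_positive n ?w"
  proof (rule low_ends_B_positive[OF w', of "int n - d" "int n - e"])
    show "1 \<le> int n - d" "int n - d < int n" "1 \<le> int n - e" "int n - e < int n" using high by auto
    show "unique_descent ?w (int n - d)" by (rule unique_descent_flip_conj[OF w high(6)])
    show "unique_descent (winv ?w) (int n - e)" unfolding winv_flip_conj[OF w]
      by (rule unique_descent_flip_conj[OF lattice_group_inv[OF w] high(7)])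
    have e: "N - (int n - e) = e + 1" by simp
    show "perm (winv ?w) (int n - e) = int n - d" unfolding perm' e high(8) by simp
    have e': "N - (int n - e + 1) = e" by simp
    have "perm (winv ?w) (int n - e + 1) + (int n - d + 1) = - (perm (winv w) e + d) + 2 * N * 1"
      unfolding perm' e' by simp
    then show "\<not> 2 * N dvd perm (winv ?w) (int n - e + 1) + (int n - d + 1)"
      using high(9) by (simp only: dvd_period0 dvd_minus_iff simp_thms)
  qed
  note props = this B_positive_properties[OF this]
  have "w = iota_B n ?w" using iota_B_eq[OF w'] flip_conj_flip_conj by simp
  moreover have "w \<circ> w = id"
  proof -
    have "flip_conj (?w \<circ> ?w) = id" using props(4) flip_conj_id by simp
    then show ?thesis unfolding flip_conj_comp flip_conj_flip_conj .
  qed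
  ultimately show ?thesis using props by blast
qed

end

theorem theorem3p1:
  fixes n :: nat
  assumes "n \<ge> 3"
  shows
    "(\<forall>w. minimal_NGT n w \<longrightarrow>
        (B_positive n w \<or>
         (\<exists>w'. B_positive n w' \<and> minimal_NGT n w' \<and> w = iota_B n w')) \<and>
        w \<circ> w = id)
     \<and>
     (\<forall>u v ps ts. B_positive_data n u v ps ts \<longrightarrow>
        (let w' = B_positive_elt n u ps ts; k = n - v; \<Gamma>' = {u + 1..n} in
          (\<exists>b \<in> weight_lattice n. \<exists>w \<in> parabolic n {1..n}.
             w' = translation n b \<circ> w \<and>
             b \<in> root_span n \<Gamma>' \<and>
             sign_conditions n k b \<and>
             sign_conditions n k (varsigma n \<Gamma>' b) \<and>
             w' = translation n b \<circ>
               inv_into UNIV (longest n \<Gamma>' \<circ>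
                 longest n {j \<in> \<Gamma>'. j \<noteq> k \<and> form n b (fst (simple_root n j)) = 0})) \<and>
          minimal_NGT n w'))"
proof -
  interpret twisted_B n by unfold_locales (rule assms)
  show ?thesis using minimal_NGT_classification B_positive_decomposition by blast
qed

end
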